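(* Let $A$ be a bounded operator in $L^2(\mathbb{R}^n)$ and assume that $$\sup_{X\in\mathbb{R}^{2n}} \pi^{-n}\int_{\mathbb{R}^{2n}} \left|\frac{\langle A\Psi_{X+Z},\Psi_{X-Z}\rangle}{\langle \Psi_{X+Z},\Psi_{X-Z}\rangle}\right| e^{-|Z|^2}\,dZ<\infty .$$ Then the Weyl symbol $F$ of $A$ is a bounded continuous function on $\mathbb{R}^{2n}$, given for all $X\in\mathbb{R}^{2n}$ by $$F(X)=\pi^{-n}\int_{\mathbb{R}^{2n}} \frac{\langle A\Psi_{X+Z},\Psi_{X-Z}\rangle}{\langle \Psi_{X+Z},\Psi_{X-Z}\rangle}\, e^{-|Z|^2}\,dZ .$$
   Context: Here $\langle f,g\rangle=\int_{\mathbb{R}^n} f(u)\overline{g(u)}\,du$ is the $L^2(\mathbb{R}^n)$ inner product, and $|\cdot|$ is the Euclidean norm. For $X=(x,\xi)\in\mathbb{R}^{2n}$ (with $x,\xi\in\mathbb{R}^n$), the coherent state $\Psi_X\in L^2(\mathbb{R}^n)$ is $$\Psi_{x,\xi}(u)=\pi^{-n/4}e^{-\frac12|u-x|^2+iu\cdot\xi-\frac i2 x\cdot\xi}.$$ These satisfy $\langle\Psi_X,\Psi_Z\rangle=e^{-\frac{|X-Z|^2}{4}+\frac i2\sigma(X,Z)}$, where $\sigma((x,\xi),(y,\eta))=y\cdot\xi-x\cdot\eta$ (so the denominators never vanish). Weyl symbol: for a continuous operator $A$ from $\mathcal{S}(\mathbb{R}^n)$ to $\mathcal{S}'(\mathbb{R}^n)$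 with distributional kernel $K_A(x,y)\in\mathcal{S}'(\mathbb{R}^{2n})$, the Weyl symbol of $A$ is the tempered distribution $F\in\mathcal{S}'(\mathbb{R}^{2n})$ given by $$F(x,\xi)=\int_{\mathbb{R}^n}e^{-iv\cdot\xi}K_A(x+v/2,x-v/2)\,dv,$$ where the integral is a Fourier transform in $v$ in the sense of tempered distributions. *)

theory Defs
  imports "HOL-Analysis.Analysis"
begin

section \<open>The space $L^2$ and its bounded operators\<close>

text \<open>
  Elements of $L^2$ are represented by Borel functions; the identification of functions that agree
  almost everywhere is not built into a type.
\<close>

definition square_integrable :: "('a::euclidean_space \<Rightarrow> complex) \<Rightarrow> bool" where
  "square_integrable f \<longleftrightarrow>
     f \<in> borel_measurable lborel \<and> integrable lborel (\<lambda>u. (norm (f u))\<^sup>2)"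

definition L2_inner :: "('a::euclidean_space \<Rightarrow> complex) \<Rightarrow> ('a \<Rightarrow> complex) \<Rightarrow> complex" where
  "L2_inner f g = (\<integral>u. f u * cnj (g u) \<partial>lborel)"

definition L2_norm :: "('a::euclidean_space \<Rightarrow> complex) \<Rightarrow> real" where
  "L2_norm f = sqrt (\<integral>u. (norm (f u))\<^sup>2 \<partial>lborel)"

text \<open>
  An operator acts on representatives, so linearity is required almost everywhere only. Linearity
  and the norm bound together force almost everywhere equal arguments to have almost everywhere
  equal images, hence such maps, up to almost everywhere equality of their values, are the
  bounded complex-linear operators on the quotient space. Values outside $L^2$ are irrelevant.
\<close>

definition bounded_L2_operator ::
    "(('a::euclidean_space \<Rightarrow> complex) \<Rightarrow> ('a \<Rightarrow> complex)) \<Rightarrow> bool" where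
  "bounded_L2_operator A \<longleftrightarrow>
     (\<forall>f. square_integrable f \<longrightarrow> square_integrable (A f)) \<and>
     (\<forall>f g a b. square_integrable f \<longrightarrow> square_integrable g \<longrightarrow>
        (AE u in lborel. A (\<lambda>v. a * f v + b * g v) u = a * A f u + b * A g u)) \<and>
     (\<exists>C. \<forall>f. square_integrable f \<longrightarrow> L2_norm (A f) \<le> C * L2_norm f)"

section \<open>Coherent states\<close>

definition coherent_state :: "(real^'n) \<times> (real^'n) \<Rightarrow> real^'n \<Rightarrow> complex" where
  "coherent_state X u = (case X of (x, \<xi>) \<Rightarrow>
     of_real (pi powr (- real CARD('n) / 4)) *
     exp (of_real (- (1/2) * (norm (u - x))\<^sup>2) + \<i> * of_real (u \<bullet> \<xi>) - \<i> / 2 * of_real (x \<bullet> \<xi>)))"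

section \<open>Schwartz functions and tempered distributions\<close>

text \<open>
  Iterated directional derivatives. With all directions taken from \<^term>\<open>Basis\<close> these are exactly
  the partial derivatives of all orders.
\<close>

primrec iterated_deriv ::
    "'a list \<Rightarrow> ('a::euclidean_space \<Rightarrow> complex) \<Rightarrow> 'a \<Rightarrow> complex" where
  "iterated_deriv [] f = f"
| "iterated_deriv (e # es) f = (\<lambda>x. frechet_derivative (iterated_deriv es f) (at x) e)"

definition schwartz :: "('a::euclidean_space \<Rightarrow> complex) \<Rightarrow> bool" where
  "schwartz f \<longleftrightarrow>
     (\<forall>es\<in>lists Basis. \<forall>x. iterated_deriv es f differentiable (at x)) \<and>
     (\<forall>es\<in>lists Basis. \<forall>k::nat.
        bdd_above (range (\<lambda>x. (1 + norm x) ^ k * norm (iterated_deriv es f x))))"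

definition schwartz_seminorm :: "nat \<Rightarrow> ('a::euclidean_space \<Rightarrow> complex) \<Rightarrow> real" where
  "schwartz_seminorm N f =
     (\<Sum>es\<in>{es \<in> lists Basis. length es \<le> N}.
        SUP x. (1 + norm x) ^ N * norm (iterated_deriv es f x))"

text \<open>
  A tempered distribution is a linear functional on the Schwartz space that is continuous, i.e.
  bounded by one of the increasing seminorms above. Only its values on Schwartz functions matter.
\<close>

definition tempered_distribution :: "(('a::euclidean_space \<Rightarrow> complex) \<Rightarrow> complex) \<Rightarrow> bool" where
  "tempered_distribution T \<longleftrightarrow>
     (\<forall>f g a b. schwartz f \<longrightarrow> schwartz g \<longrightarrow>
        T (\<lambda>x. a * f x + b * g x) = a * T f + b * T g) \<and>
     (\<exists>C N. \<forall>f. schwartz f \<longrightarrow> norm (T f) \<le> C * schwartz_seminorm N f)"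

definition distribution_of ::
    "('a::euclidean_space \<Rightarrow> complex) \<Rightarrow> ('a \<Rightarrow> complex) \<Rightarrow> complex" where
  "distribution_of f = (\<lambda>\<phi>. \<integral>x. f x * \<phi> x \<partial>lborel)"

section \<open>Distributional kernels and Weyl symbols\<close>

text \<open>
  Operators from the Schwartz space to tempered distributions are maps \<open>B\<close> sending a test function
  to a functional. The kernel is characterised by $(B\varphi)(x) = \int K(x,y)\varphi(y)\,dy$, with
  bilinear pairings throughout (no complex conjugation).
\<close>

definition distributional_kernel ::
    "(('a::euclidean_space \<Rightarrow> complex) \<Rightarrow> ('a \<Rightarrow> complex) \<Rightarrow> complex) \<Rightarrow>
     (('a \<times> 'a \<Rightarrow> complex) \<Rightarrow> complex) \<Rightarrow> bool" where
  "distributional_kernel B K \<longleftrightarrow> tempered_distribution K \<and>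
     (\<forall>\<phi> \<psi>. schwartz \<phi> \<longrightarrow> schwartz \<psi> \<longrightarrow> K (\<lambda>(x, y). \<psi> x * \<phi> y) = B \<phi> \<psi>)"

text \<open>
  The distribution $K(x + v/2, x - v/2)$ in the variables $(x,v)$: the substitution
  $(y,z) = (x + v/2, x - v/2)$ has inverse $((y+z)/2, y-z)$ and Jacobian of modulus one.
\<close>

definition midpoint_pullback ::
    "(('a::euclidean_space \<times> 'a \<Rightarrow> complex) \<Rightarrow> complex) \<Rightarrow> ('a \<times> 'a \<Rightarrow> complex) \<Rightarrow> complex" where
  "midpoint_pullback K = (\<lambda>\<Phi>. K (\<lambda>(y, z). \<Phi> ((1/2) *\<^sub>R (y + z), y - z)))"

text \<open>
  The Fourier transform in the second variable, without normalising factor. Its kernel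
  $e^{-iv\cdot\xi}$ is symmetric in $v$ and $\xi$, so on distributions it acts by transposition.
\<close>

definition fourier_snd :: "('a::euclidean_space \<times> 'a \<Rightarrow> complex) \<Rightarrow> 'a \<times> 'a \<Rightarrow> complex" where
  "fourier_snd \<Phi> = (\<lambda>(x, v). \<integral>\<xi>. exp (- (\<i> * of_real (v \<bullet> \<xi>))) * \<Phi> (x, \<xi>) \<partial>lborel)"

definition dist_fourier_snd ::
    "(('a::euclidean_space \<times> 'a \<Rightarrow> complex) \<Rightarrow> complex) \<Rightarrow> ('a \<times> 'a \<Rightarrow> complex) \<Rightarrow> complex" where
  "dist_fourier_snd T = (\<lambda>\<Phi>. T (fourier_snd \<Phi>))"

text \<open>
  \<open>is_weyl_symbol B F\<close> means that \<open>F\<close> is the Weyl symbol of \<open>B\<close>; as the kernel is unique, the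
  relation determines \<open>F\<close> on Schwartz functions, i.e. as a tempered distribution.
\<close>

definition is_weyl_symbol ::
    "(('a::euclidean_space \<Rightarrow> complex) \<Rightarrow> ('a \<Rightarrow> complex) \<Rightarrow> complex) \<Rightarrow>
     (('a \<times> 'a \<Rightarrow> complex) \<Rightarrow> complex) \<Rightarrow> bool" where
  "is_weyl_symbol B F \<longleftrightarrow> tempered_distribution F \<and>
     (\<exists>K. distributional_kernel B K \<and>
        (\<forall>\<Phi>. schwartz \<Phi> \<longrightarrow> F \<Phi> = dist_fourier_snd (midpoint_pullback K) \<Phi>))"

end

theory Submission
  imports Defs "HOL-Probability.Probability"
begin

text \<open>
  Write $H(P,Q) = \langle A\Psi_P, \Psi_Q\rangle$. The quotient
  $e^{-|Z|^2} / \langle \Psi_{X+Z}, \Psi_{X-Z}\rangle$ is the pure phase $e^{i\sigma(X,Z)}$, so the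
  hypothesis says that $Z \mapsto H(X+Z,X-Z)$ is bounded in $L^1$ uniformly in $X$, and $F$ is the
  integral of $H(X+Z,X-Z)e^{i\sigma(X,Z)}$. The reproducing property
  $\varphi = (2\pi)^{-n}\int \langle\varphi,\Psi_P\rangle\Psi_P\,dP$, pulled through $A$, expands
  $A$ into the rank one operators $f \mapsto \langle f,\Psi_P\rangle\Psi_Q$ with coefficients
  $(2\pi)^{-2n}H(P,Q)$. Their Weyl symbols are Gaussians $w_{P,Q}$ centred at $(P+Q)/2$, and Fubini
  gives $F(X) = (2\pi)^{-2n}\iint H(P,Q)\,w_{P,Q}(X)\,dP\,dQ$, where the integrand has a majorant
  that is locally uniform in $X$; this yields continuity. The Schwartz kernel theorem is not
  needed: $K(\Theta) = (2\pi)^{-2n}\iint H(P,Q)\,\langle\Theta, \overline{\Psi_Q}\otimes\Psi_P\rangle\,dP\,dQ$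
  converges because the coherent transform of a Schwartz function is integrable, and pairing it
  with the partial Fourier transform of $\Phi$ gives $\int F\Phi$ by the formula for $F$.
\<close>

section \<open>Gaussian integrals over Euclidean spaces\<close>

text \<open>Two obstacles shape the argument. First, \<open>H\<close> is only bounded, and the
  modulus of \<open>cross_symbol P Q X\<close> depends on P and Q through the midpoint (P+Q)/2
  alone, so it gives no decay in P - Q. The missing decay is exactly the integrability hypothesis,
  read in midpoint and difference coordinates. Second, that hypothesis bounds one integral for each
  X but supplies no common majorant, so dominated convergence cannot be applied to the formula
  defining F; in the double integral X occurs only in an explicit Gaussian, where it can be varied.
  On the kernel side the decay comes instead from the test function. It has to be controlled by one
  seminorm with a constant independent of the function, so the decay estimate is proved for all
  Schwartz functions at once. Since A acts on representatives, it enters only through scalar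
  functionals, f |-> <Af,g> and g |-> conj <Af,g>.\<close>

lemma product_measurable [measurable]:
  "fst \<in> borel_measurable (borel :: ('a::euclidean_space \<times> 'b::euclidean_space) measure)"
  "snd \<in> borel_measurable (borel :: ('a::euclidean_space \<times> 'b::euclidean_space) measure)"
  by (intro borel_measurable_continuous_onI continuous_intros)+

lemma integrable_lborel_bound:
  fixes f :: "'a::euclidean_space \<Rightarrow> 'b::{banach,second_countable_topology}"
  assumes "integrable lborel g" "f \<in> borel_measurable borel" "\<And>x. norm (f x) \<le> g x"
  shows "integrable lborel f"
  using assms(2) order_trans[OF assms(3) abs_ge_self]
  by (intro Bochner_Integration.integrable_bound[OF assms(1)]) auto

text \<open>\<open>lborel_eq\<close> presents Lebesgue measure as the image of the product of
  one-dimensional ones under the coordinate map, so integrals factor. This serves both the Gaussians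
  and \<open>cauchy_weight\<close>.\<close>

lemma lborel_prod_coords:
  fixes f :: "'a::euclidean_space \<Rightarrow> real \<Rightarrow> 'c::{real_normed_field,banach,second_countable_topology}"
  assumes int: "\<And>b. b \<in> Basis \<Longrightarrow> integrable lborel (f b)"
  shows integrable_lborel_prod_coords: "integrable lborel (\<lambda>x::'a. \<Prod>b\<in>Basis. f b (x \<bullet> b))"
    and integral_lborel_prod_coords:
      "(\<integral>x. (\<Prod>b\<in>Basis. f b (x \<bullet> b)) \<partial>(lborel :: 'a measure)) = (\<Prod>b\<in>Basis. integral\<^sup>L lborel (f b))"
proof -
  interpret product_sigma_finite "\<lambda>_::'a. lborel :: real measure" ..
  have coord: "(\<Sum>b'\<in>Basis. x b' *\<^sub>R b') \<bullet> b = x b" if "b \<in> Basis" for x :: "'a \<Rightarrow> real" and b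
    using that by (simp add: inner_sum_left inner_Basis if_distrib cong: if_cong)
  have [measurable]: "(\<lambda>x::'a. \<Prod>b\<in>Basis. f b (x \<bullet> b)) \<in> borel_measurable borel"
  proof (rule borel_measurable_prod)
    fix b :: 'a assume "b \<in> Basis"
    then have [measurable]: "f b \<in> borel_measurable borel"
      using borel_measurable_integrable[OF int] by simp
    show "(\<lambda>x::'a. f b (x \<bullet> b)) \<in> borel_measurable borel" by measurable
  qed
  have i: "integrable (\<Pi>\<^sub>M b\<in>Basis. lborel) (\<lambda>x. \<Prod>b\<in>(Basis::'a set). f b (x b))"
    by (rule product_integrable_prod) (auto intro: int)
  show "integrable lborel (\<lambda>x::'a. \<Prod>b\<in>Basis. f b (x \<bullet> b))"
    using i by (subst lborel_eq) (simp add: integrable_distr_eq coord cong: prod.cong)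
  show "(\<integral>x. (\<Prod>b\<in>Basis. f b (x \<bullet> b)) \<partial>(lborel :: 'a measure)) = (\<Prod>b\<in>Basis. integral\<^sup>L lborel (f b))"
    by (subst lborel_eq)
      (simp add: integral_distr coord product_integral_prod[OF _ int] cong: prod.cong)
qed

lemma integrable_lborel_affine_iff:
  fixes f :: "'a::euclidean_space \<Rightarrow> 'b::{banach,second_countable_topology}"
  assumes "c \<noteq> 0" and [measurable]: "f \<in> borel_measurable borel"
  shows "integrable lborel (\<lambda>x. f (t + c *\<^sub>R x)) \<longleftrightarrow> integrable lborel f"
proof -
  have "integrable lborel f \<longleftrightarrow> integrable lborel (\<lambda>x. \<bar>c\<bar> ^ DIM('a) *\<^sub>R f (t + c *\<^sub>R x))"
    using assms by (subst lborel_affine[OF assms(1), of t]) (simp add: integrable_density integrable_distr_eq)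
  also have "\<dots> \<longleftrightarrow> integrable lborel (\<lambda>x. f (t + c *\<^sub>R x))"
    using integrable_scaleR_right[of "inverse (\<bar>c\<bar> ^ DIM('a))" lborel "\<lambda>x. \<bar>c\<bar> ^ DIM('a) *\<^sub>R f (t + c *\<^sub>R x)"] assms(1)
    by (auto intro: integrable_scaleR_right)
  finally show ?thesis ..
qed

lemma integral_lborel_affine:
  fixes f :: "'a::euclidean_space \<Rightarrow> 'b::{banach,second_countable_topology}"
  assumes "c \<noteq> 0" and [measurable]: "f \<in> borel_measurable borel"
  shows "integral\<^sup>L lborel f = \<bar>c\<bar> ^ DIM('a) *\<^sub>R (\<integral>x. f (t + c *\<^sub>R x) \<partial>lborel)"
  using assms
  by (subst lborel_affine[OF assms(1), of t]) (simp add: integral_density integral_distr)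

lemma nn_integral_lborel_affine:
  fixes f :: "'a::euclidean_space \<Rightarrow> ennreal"
  assumes "c \<noteq> 0" and [measurable]: "f \<in> borel_measurable borel"
  shows "(\<integral>\<^sup>+x. f x \<partial>lborel) = ennreal (\<bar>c\<bar> ^ DIM('a)) * (\<integral>\<^sup>+x. f (t + c *\<^sub>R x) \<partial>lborel)"
  using assms
  by (subst lborel_affine[OF assms(1), of t])
    (simp add: nn_integral_density nn_integral_distr nn_integral_cmult)

section \<open>Midpoint and difference coordinates\<close>

lemma midpoint_map_measurable [measurable]:
  "(\<lambda>(x, v). (x + (1/2) *\<^sub>R v, x - (1/2) *\<^sub>R v)) \<in>
     borel_measurable (borel :: ('a::euclidean_space \<times> 'a) measure)"
  by (intro borel_measurable_continuous_onI) (auto simp: case_prod_unfold intro!: continuous_intros)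

text \<open>Two affine substitutions replace a determinant: for fixed x put v = 2x - 2z, which costs
  2^d with d the dimension; after interchanging the integrals, the substitution x |-> 2x - z for
  fixed z absorbs the same factor.\<close>

lemma lborel_distr_midpoint:
  "distr lborel borel (\<lambda>(x, v). (x + (1/2) *\<^sub>R v, x - (1/2) *\<^sub>R v)) =
     (lborel :: ('a::euclidean_space \<times> 'a) measure)" (is "distr _ _ ?T = _")
proof (rule measure_eqI)
  fix S assume "S \<in> sets (distr lborel borel ?T :: ('a \<times> 'a) measure)"
  then have S: "S \<in> sets borel" by simp
  define g :: "'a \<times> 'a \<Rightarrow> ennreal" where "g = indicator S"
  have g[measurable]: "g \<in> borel_measurable borel" unfolding g_def using S by simp
  have g2[measurable]: "g \<in> borel_measurable (borel \<Otimes>\<^sub>M borel)"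
    using g by (simp add: borel_prod)
  have "emeasure (distr lborel borel ?T) S = (\<integral>\<^sup>+p. g (?T p) \<partial>lborel)"
    by (subst nn_integral_distr[of ?T lborel borel g, symmetric]) (auto simp: g_def S borel_measurable_indicator_iff)
  also have "\<dots> = (\<integral>\<^sup>+x. \<integral>\<^sup>+v. g (x + (1/2) *\<^sub>R v, x - (1/2) *\<^sub>R v) \<partial>lborel \<partial>lborel)"
    by (simp add: lborel_prod[symmetric] lborel.nn_integral_fst[symmetric] case_prod_unfold)
  also have "\<dots> = (\<integral>\<^sup>+x. 2 ^ DIM('a) * \<integral>\<^sup>+z. g (2 *\<^sub>R x - z, z) \<partial>lborel \<partial>lborel)"
  proof (rule nn_integral_cong)
    fix x :: 'a
    have "x + (1/2) *\<^sub>R (2 *\<^sub>R x + (- 2) *\<^sub>R z) = 2 *\<^sub>R x - z"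
      "x - (1/2) *\<^sub>R (2 *\<^sub>R x + (- 2) *\<^sub>R z) = z" for z :: 'a
      by (simp_all add: euclidean_eq_iff[where 'a='a] inner_simps algebra_simps)
    then show "(\<integral>\<^sup>+v. g (x + (1/2) *\<^sub>R v, x - (1/2) *\<^sub>R v) \<partial>lborel) = 2 ^ DIM('a) * \<integral>\<^sup>+z. g (2 *\<^sub>R x - z, z) \<partial>lborel"
      by (subst nn_integral_lborel_affine[where c="-2" and t="2 *\<^sub>R x"])
        (auto simp: ennreal_power[symmetric])
  qed
  also have "\<dots> = 2 ^ DIM('a) * (\<integral>\<^sup>+z. \<integral>\<^sup>+x. g (2 *\<^sub>R x - z, z) \<partial>lborel \<partial>lborel)"
    by (subst lborel_pair.Fubini') (auto simp: nn_integral_cmult)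
  also have "\<dots> = (\<integral>\<^sup>+z. 2 ^ DIM('a) * \<integral>\<^sup>+x. g (- z + 2 *\<^sub>R x, z) \<partial>lborel \<partial>lborel)"
    by (simp add: nn_integral_cmult)
  also have "\<dots> = (\<integral>\<^sup>+z. \<integral>\<^sup>+x. g (x, z) \<partial>lborel \<partial>lborel)"
  proof (rule nn_integral_cong)
    fix z :: 'a
    show "2 ^ DIM('a) * (\<integral>\<^sup>+x. g (- z + 2 *\<^sub>R x, z) \<partial>lborel) = (\<integral>\<^sup>+x. g (x, z) \<partial>lborel)"
      using nn_integral_lborel_affine[of 2 "\<lambda>x. g (x, z)" "- z"] by (simp add: ennreal_power[symmetric])
  qed
  also have "\<dots> = (\<integral>\<^sup>+p. g p \<partial>lborel)"
    by (simp add: lborel_prod[symmetric] lborel_pair.nn_integral_snd)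
  also have "\<dots> = emeasure lborel S"
    using S by (simp add: g_def)
  finally show "emeasure (distr lborel borel ?T) S = emeasure lborel S" .
qed simp

section \<open>Fourier transforms of Gaussians\<close>

lemma exp_of_real_add: "exp (of_real r + z) = of_real (exp r) * exp (z :: complex)"
  by (simp add: exp_add exp_of_real)

text \<open>Up to the factor sqrt(2 pi) in the density, this is the characteristic function of the
  standard normal law.\<close>

lemma integral_real_gaussian_fourier:
  fixes t :: real
  shows "integrable lborel (\<lambda>x. exp (of_real (- x\<^sup>2 / 2) + \<i> * of_real (x * t)))"
    and "(\<integral>x. exp (of_real (- x\<^sup>2 / 2) + \<i> * of_real (x * t)) \<partial>lborel) =
           of_real (sqrt (2 * pi) * exp (- t\<^sup>2 / 2))"
proof -
  have eq: "exp (of_real (- x\<^sup>2 / 2) + \<i> * of_real (x * t)) =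
      sqrt (2 * pi) *\<^sub>R (std_normal_density x *\<^sub>R iexp (t * x))" for x :: real
    unfolding exp_of_real_add std_normal_density_def by (simp add: scaleR_conv_of_real mult.commute)
  have int: "integrable lborel (\<lambda>x. std_normal_density x *\<^sub>R iexp (t * x))"
  proof (rule Bochner_Integration.integrable_bound)
    show "integrable lborel std_normal_density" by simp
  qed auto
  then show "integrable lborel (\<lambda>x. exp (of_real (- x\<^sup>2 / 2) + \<i> * of_real (x * t)))"
    unfolding eq by (intro integrable_scaleR_right)
  have "(\<integral>x. std_normal_density x *\<^sub>R iexp (t * x) \<partial>lborel) = char std_normal_distribution t"
    unfolding char_def by (subst integral_density) auto
  then show "(\<integral>x. exp (of_real (- x\<^sup>2 / 2) + \<i> * of_real (x * t)) \<partial>lborel) =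
           of_real (sqrt (2 * pi) * exp (- t\<^sup>2 / 2))"
    unfolding eq char_std_normal_distribution by (simp add: scaleR_conv_of_real)
qed

lemma norm_sq_euclidean: "(norm (x::'a::euclidean_space))\<^sup>2 = (\<Sum>b\<in>Basis. (x \<bullet> b)\<^sup>2)"
  by (subst power2_norm_eq_inner, subst euclidean_inner) (simp add: power2_eq_square)

text \<open>The logarithm of the modulus and the phase are kept as two separate real arguments.
  Products, conjugates and norms then become real arithmetic, and each later identity between
  Gaussians splits into one real equation for the exponent (\<open>r\<close>) and one for the phase
  (\<open>s\<close>).\<close>

definition gexp :: "real \<Rightarrow> real \<Rightarrow> complex" where
  "gexp r s = exp (of_real r + \<i> * of_real s)"

abbreviation cgauss :: "real \<Rightarrow> 'a::real_normed_vector \<Rightarrow> real \<Rightarrow> complex" where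
  "cgauss a x \<equiv> gexp (- a * (norm x)\<^sup>2)"

lemma norm_gexp [simp]: "norm (gexp r s) = exp r"
  by (simp add: gexp_def)

lemma cnj_gexp [simp]: "cnj (gexp r s) = gexp r (- s)"
  by (simp add: gexp_def exp_cnj)

lemma gexp_mult: "gexp r s * gexp r' s' = gexp (r + r') (s + s')"
  by (simp add: gexp_def exp_add[symmetric] algebra_simps)

lemma of_real_exp_gexp: "of_real (exp r) = gexp r 0"
  by (simp add: gexp_def exp_of_real)

lemma gexp_nonzero [simp]: "gexp r s \<noteq> 0"
  by (simp add: gexp_def)

lemma gexp_measurable [measurable (raw)]:
  "f \<in> borel_measurable M \<Longrightarrow> g \<in> borel_measurable M \<Longrightarrow> (\<lambda>x. gexp (f x) (g x)) \<in> borel_measurable M"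
  unfolding gexp_def
  by (intro borel_measurable_continuous_on[of exp] borel_measurable_continuous_on[of complex_of_real]
      borel_measurable_add borel_measurable_times borel_measurable_const continuous_intros)

lemma continuous_on_gexp [continuous_intros]:
  "continuous_on S f \<Longrightarrow> continuous_on S g \<Longrightarrow> continuous_on S (\<lambda>x. gexp (f x) (g x))"
  unfolding gexp_def by (intro continuous_intros)

lemma tendsto_gexp [tendsto_intros]:
  "(f \<longlongrightarrow> a) F \<Longrightarrow> (g \<longlongrightarrow> b) F \<Longrightarrow> ((\<lambda>x. gexp (f x) (g x)) \<longlongrightarrow> gexp a b) F"
  unfolding gexp_def by (intro tendsto_intros)

abbreviation gauss :: "real \<Rightarrow> 'a::real_normed_vector \<Rightarrow> real" where
  "gauss a x \<equiv> exp (- a * (norm x)\<^sup>2)"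

text \<open>Rescaling to the standard normal and splitting into coordinates reduces everything to
  dimension one. The overlaps of coherent states, the regularised reproducing kernel and both
  computations of \<open>cross_symbol\<close> are instances.\<close>

lemma integral_gexp:
  fixes q p :: "'a::euclidean_space"
  assumes a: "a > 0"
  shows integrable_gexp: "integrable lborel (\<lambda>u. cgauss a (u - p) (u \<bullet> q))"
    and "(\<integral>u. cgauss a (u - p) (u \<bullet> q) \<partial>lborel) =
        of_real (sqrt (pi / a) ^ DIM('a)) * gexp (- (norm q)\<^sup>2 / (4 * a)) (p \<bullet> q)"
proof -
  \<comment> \<open>Chosen so that a |r s|^2 = |s|^2 / 2.\<close>
  define r where "r = 1 / sqrt (2 * a)"
  have r: "r > 0" "r\<^sup>2 = 1 / (2 * a)" using a by (auto simp: r_def power_divide)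
  define f where "f u = exp (of_real (- a * (norm (u - p))\<^sup>2) + \<i> * of_real (u \<bullet> q))" for u :: 'a
  define g where "g b x = exp (of_real (- x\<^sup>2 / 2) + \<i> * of_real (x * (r *\<^sub>R q \<bullet> b)))" for b :: 'a and x :: real
  have f[measurable]: "f \<in> borel_measurable borel"
    unfolding f_def by measurable
  have "f (p + r *\<^sub>R s) = exp (\<i> * of_real (p \<bullet> q)) * (\<Prod>b\<in>Basis. g b (s \<bullet> b))" for s
  proof -
    have "- a * (norm (p + r *\<^sub>R s - p))\<^sup>2 = - (norm s)\<^sup>2 / 2"
      using r a by (simp add: power_mult_distrib)
    then have "f (p + r *\<^sub>R s) = exp (\<i> * of_real (p \<bullet> q)) *
        exp (of_real (- (norm s)\<^sup>2 / 2) + \<i> * of_real (s \<bullet> (r *\<^sub>R q)))"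
      unfolding f_def by (simp only: exp_of_real_add) (simp add: inner_add_left exp_add algebra_simps)
    also have "of_real (- (norm s)\<^sup>2 / 2) + \<i> * of_real (s \<bullet> (r *\<^sub>R q)) =
        (\<Sum>b\<in>Basis. of_real (- (s \<bullet> b)\<^sup>2 / 2) + \<i> * of_real ((s \<bullet> b) * (r *\<^sub>R q \<bullet> b)))"
      by (subst norm_sq_euclidean, subst euclidean_inner[of s "r *\<^sub>R q"])
        (simp add: sum.distrib sum_distrib_left sum_divide_distrib sum_negf sum_subtractf)
    finally show ?thesis by (simp add: exp_sum g_def)
  qed
  note eq = this
  have ig: "integrable lborel (\<lambda>s::'a. \<Prod>b\<in>Basis. g b (s \<bullet> b))"
    unfolding g_def by (intro integrable_lborel_prod_coords integral_real_gaussian_fourier)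
  have "integrable lborel (\<lambda>s. f (p + r *\<^sub>R s))"
    unfolding eq using ig by simp
  then show "integrable lborel (\<lambda>u. cgauss a (u - p) (u \<bullet> q))"
    using integrable_lborel_affine_iff[of r f p] r unfolding f_def gexp_def by simp
  have "integral\<^sup>L lborel f = of_real (r ^ DIM('a)) * (exp (\<i> * of_real (p \<bullet> q)) *
      (\<integral>s. (\<Prod>b\<in>Basis. g b (s \<bullet> b)) \<partial>(lborel :: 'a measure)))"
    using r by (subst integral_lborel_affine[of r f p]) (auto simp: eq scaleR_conv_of_real)
  also have "(\<integral>s. (\<Prod>b\<in>Basis. g b (s \<bullet> b)) \<partial>(lborel :: 'a measure)) =
      (\<Prod>b\<in>(Basis::'a set). of_real (sqrt (2 * pi) * exp (- (r *\<^sub>R q \<bullet> b)\<^sup>2 / 2)))"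
    unfolding g_def integral_real_gaussian_fourier(2)[symmetric]
    by (rule integral_lborel_prod_coords) (rule integral_real_gaussian_fourier)
  also have "\<dots> = of_real (sqrt (2 * pi) ^ DIM('a) * exp (\<Sum>b\<in>(Basis::'a set). - (r *\<^sub>R q \<bullet> b)\<^sup>2 / 2))"
    by (simp add: prod.distrib exp_sum)
  also have "(\<Sum>b\<in>(Basis::'a set). - (r *\<^sub>R q \<bullet> b)\<^sup>2 / 2) = - (norm (r *\<^sub>R q))\<^sup>2 / 2"
    unfolding norm_sq_euclidean by (simp add: sum_negf sum_divide_distrib)
  also have "\<dots> = - (norm q)\<^sup>2 / (4 * a)"
    using r a by (simp add: power_mult_distrib)
  also have "of_real (r ^ DIM('a)) * (exp (\<i> * of_real (p \<bullet> q)) *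
      of_real (sqrt (2 * pi) ^ DIM('a) * exp (- (norm q)\<^sup>2 / (4 * a)))) =
      of_real ((r * sqrt (2 * pi)) ^ DIM('a)) * exp (of_real (- (norm q)\<^sup>2 / (4 * a)) + \<i> * of_real (p \<bullet> q))"
    unfolding exp_of_real_add by (simp add: power_mult_distrib mult_ac)
  also have "r * sqrt (2 * pi) = sqrt (pi / a)"
    using a by (simp add: r_def real_sqrt_divide real_sqrt_mult)
  finally show "(\<integral>u. cgauss a (u - p) (u \<bullet> q) \<partial>lborel) =
        of_real (sqrt (pi / a) ^ DIM('a)) * gexp (- (norm q)\<^sup>2 / (4 * a)) (p \<bullet> q)"
    unfolding f_def gexp_def .
qed

lemma gaussian_real:
  fixes p :: "'a::euclidean_space"
  assumes a: "a > 0"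
  shows integrable_gaussian: "integrable lborel (\<lambda>u. gauss a (u - p))"
    and integral_gaussian: "(\<integral>u. gauss a (u - p) \<partial>lborel) = sqrt (pi / a) ^ DIM('a)"
    and nn_integral_gaussian:
      "(\<integral>\<^sup>+u. ennreal (gauss a (u - p)) \<partial>lborel) = ennreal (sqrt (pi / a) ^ DIM('a))"
proof -
  have eq: "cgauss a (u - p) (u \<bullet> 0) = of_real (gauss a (u - p))" for u
    by (simp add: of_real_exp_gexp)
  show i: "integrable lborel (\<lambda>u. gauss a (u - p))"
    using integrable_gexp[OF a, of p 0] unfolding eq complex_of_real_integrable_eq .
  show e: "(\<integral>u. gauss a (u - p) \<partial>lborel) = sqrt (pi / a) ^ DIM('a)"
    using integral_gexp(2)[OF a, of p 0] unfolding eq by (simp add: gexp_def flip: of_real_power)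
  show "(\<integral>\<^sup>+u. ennreal (gauss a (u - p)) \<partial>lborel) = ennreal (sqrt (pi / a) ^ DIM('a))"
    using nn_integral_eq_integral[OF i] unfolding e by simp
qed

section \<open>Bounded functionals on $L^2$ under the integral sign\<close>

lemma borel_measurable_cnj [measurable (raw)]:
  "f \<in> borel_measurable M \<Longrightarrow> (\<lambda>x. cnj (f x)) \<in> borel_measurable M"
  by (rule borel_measurable_continuous_on[of cnj]) (auto intro: continuous_intros)

lemma square_integrable_measurable [measurable_dest]:
  "square_integrable f \<Longrightarrow> f \<in> borel_measurable borel"
  by (simp add: square_integrable_def)

lemma L2_norm_nonneg [simp]: "L2_norm f \<ge> 0"
  by (simp add: L2_norm_def)

lemma L2_norm_power2: "(L2_norm f)\<^sup>2 = (\<integral>u. (norm (f u))\<^sup>2 \<partial>lborel)"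
  by (simp add: L2_norm_def)

lemma nn_integral_L2_norm:
  assumes "square_integrable f"
  shows "(\<integral>\<^sup>+u. ennreal (norm (f u)) ^ 2 \<partial>lborel) = ennreal ((L2_norm f)\<^sup>2)"
  using assms unfolding L2_norm_power2 square_integrable_def
  by (simp add: ennreal_power nn_integral_eq_integral)

lemma square_integrableI_nn:
  assumes [measurable]: "f \<in> borel_measurable borel"
    and le: "(\<integral>\<^sup>+u. ennreal (norm (f u)) ^ 2 \<partial>lborel) \<le> ennreal K" and "K \<ge> 0"
  shows "square_integrable f" and "(L2_norm f)\<^sup>2 \<le> K"
proof -
  show sq: "square_integrable f"
    unfolding square_integrable_def
  proof (intro conjI integrableI_bounded)
    have "(\<integral>\<^sup>+u. ennreal (norm ((norm (f u))\<^sup>2)) \<partial>lborel) \<le> ennreal K"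
      using le by (simp add: ennreal_power)
    also have "\<dots> < \<infinity>" by simp
    finally show "(\<integral>\<^sup>+u. ennreal (norm ((norm (f u))\<^sup>2)) \<partial>lborel) < \<infinity>" .
  qed auto
  show "(L2_norm f)\<^sup>2 \<le> K"
    using le \<open>K \<ge> 0\<close> unfolding nn_integral_L2_norm[OF sq] by (simp add: ennreal_le_iff)
qed

lemma square_integrable_linear:
  assumes "square_integrable f" "square_integrable g"
  shows "square_integrable (\<lambda>u. a * f u + b * g u)"
  unfolding square_integrable_def
proof (intro conjI)
  note [measurable] = assms[THEN square_integrable_measurable]
  show "(\<lambda>u. a * f u + b * g u) \<in> borel_measurable lborel" by simp
  show "integrable lborel (\<lambda>u. (norm (a * f u + b * g u))\<^sup>2)"
  proof (rule integrable_lborel_bound)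
    show "integrable lborel (\<lambda>u. 2 * (norm a)\<^sup>2 * (norm (f u))\<^sup>2 + 2 * (norm b)\<^sup>2 * (norm (g u))\<^sup>2)"
      using assms by (auto simp: square_integrable_def)
    show "norm ((norm (a * f u + b * g u))\<^sup>2) \<le> 2 * (norm a)\<^sup>2 * (norm (f u))\<^sup>2 + 2 * (norm b)\<^sup>2 * (norm (g u))\<^sup>2" for u
    proof -
      have "(norm (a * f u + b * g u))\<^sup>2 \<le> (norm (a * f u) + norm (b * g u))\<^sup>2"
        by (intro power_mono norm_triangle_ineq) auto
      also have "\<dots> \<le> 2 * (norm (a * f u))\<^sup>2 + 2 * (norm (b * g u))\<^sup>2"
        using sum_squares_bound[of "norm (a * f u)" "norm (b * g u)"]
        by (simp add: power2_sum)
      finally show ?thesis by (simp add: norm_mult power_mult_distrib)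
    qed
  qed simp
qed

text \<open>The Cauchy-Schwarz inequality is applied to the non-negative integral \<open>I\<close>
  first: its finiteness yields integrability of the product, and the same bound then passes to the
  complex integral.\<close>

lemma L2_product:
  assumes "square_integrable f" "square_integrable g"
  shows integrable_L2_product: "integrable lborel (\<lambda>u. f u * cnj (g u))"
    and L2_Cauchy_Schwarz: "norm (L2_inner f g) \<le> L2_norm f * L2_norm g"
proof -
  note [measurable] = assms[THEN square_integrable_measurable]
  define I where "I = (\<integral>\<^sup>+u. ennreal (norm (f u * cnj (g u))) \<partial>lborel)"
  have "I\<^sup>2 \<le> (\<integral>\<^sup>+u. ennreal (norm (f u)) ^ 2 \<partial>lborel) * (\<integral>\<^sup>+u. ennreal (norm (g u)) ^ 2 \<partial>lborel)"
    unfolding I_def norm_mult complex_mod_cnj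
    by (subst ennreal_mult) (auto intro!: Cauchy_Schwarz_nn_integral)
  also have "\<dots> = ennreal ((L2_norm f * L2_norm g)\<^sup>2)"
    unfolding nn_integral_L2_norm[OF assms(1)] nn_integral_L2_norm[OF assms(2)]
    by (simp add: ennreal_mult[symmetric] power_mult_distrib)
  finally have I2: "I\<^sup>2 \<le> ennreal ((L2_norm f * L2_norm g)\<^sup>2)" .
  then have "I\<^sup>2 < \<infinity>"
    using ennreal_less_top le_less_trans infinity_ennreal_def by metis
  then have "I < \<infinity>" by (simp add: power_less_top_ennreal)
  then obtain r where r: "I = ennreal r" "r \<ge> 0" by (cases I) auto
  have "r\<^sup>2 \<le> (L2_norm f * L2_norm g)\<^sup>2"
    using I2 r by (simp add: ennreal_power)
  then have rle: "r \<le> L2_norm f * L2_norm g"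
    by (rule power2_le_imp_le) simp
  show i: "integrable lborel (\<lambda>u. f u * cnj (g u))"
    using \<open>I < \<infinity>\<close> by (intro integrableI_bounded) (auto simp: I_def)
  have "norm (L2_inner f g) \<le> (\<integral>u. norm (f u * cnj (g u)) \<partial>lborel)"
    unfolding L2_inner_def by (rule integral_norm_bound)
  also have "ennreal \<dots> = ennreal r"
    using nn_integral_eq_integral[OF integrable_norm[OF i]] r unfolding I_def by simp
  then have "(\<integral>u. norm (f u * cnj (g u)) \<partial>lborel) = r"
    using r by (simp add: ennreal_inj)
  finally show "norm (L2_inner f g) \<le> L2_norm f * L2_norm g" using rle by simp
qed

lemma L2_norm_diff_expand:
  assumes "square_integrable f" "square_integrable g"
  shows "(L2_norm (\<lambda>u. f u - g u))\<^sup>2 = (L2_norm f)\<^sup>2 + (L2_norm g)\<^sup>2 - 2 * Re (L2_inner f g)"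
proof -
  define h where "h u = Re (f u * cnj (g u))" for u
  have i: "integrable lborel h" unfolding h_def
    by (rule integrable_Re[OF integrable_L2_product[OF assms]])
  have Re: "Re (L2_inner f g) = integral\<^sup>L lborel h"
    unfolding h_def L2_inner_def by (rule integral_Re[OF integrable_L2_product[OF assms], symmetric])
  have "(norm (f u - g u))\<^sup>2 = (norm (f u))\<^sup>2 + (norm (g u))\<^sup>2 - 2 * h u" for u
    unfolding cmod_power2 h_def by (simp add: power2_eq_square algebra_simps)
  then show ?thesis
    using assms i unfolding L2_norm_power2 Re square_integrable_def by simp
qed

lemma L2_norm_diff_power2_le:
  assumes "square_integrable f" "square_integrable g"
  shows "(L2_norm (\<lambda>u. f u - g u))\<^sup>2 \<le> 2 * (L2_norm f)\<^sup>2 + 2 * (L2_norm g)\<^sup>2"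
  using L2_Cauchy_Schwarz[OF assms] abs_Re_le_cmod[of "L2_inner f g"]
    sum_squares_bound[of "L2_norm f" "L2_norm g"] unfolding L2_norm_diff_expand[OF assms] by linarith

text \<open>The map s takes finitely many values, so G is evaluated at finitely many points and can
  be arbitrary. In particular G may be q |-> l (v q) for a functional l, before anything is known
  about its measurability.\<close>

lemma integral_simple_comp:
  fixes c :: "'p \<Rightarrow> complex" and G :: "'q \<Rightarrow> complex"
  assumes s: "simple_function M s" and c: "integrable M c"
  shows "(\<integral>p. c p * G (s p) \<partial>M) =
    (\<Sum>q\<in>s ` space M. (\<integral>p. c p * indicator (s -` {q} \<inter> space M) p \<partial>M) * G q)"
proof -
  have fin: "finite (s ` space M)" using s by (rule simple_functionD)
  have set: "s -` {q} \<inter> space M \<in> sets M" for q using s by (rule simple_functionD)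
  have int: "integrable M (\<lambda>p. c p * indicator (s -` {q} \<inter> space M) p)" for q
  proof -
    have "(\<lambda>p. c p * indicator (s -` {q} \<inter> space M) p) = (\<lambda>p. indicator (s -` {q} \<inter> space M) p *\<^sub>R c p)"
      by (auto simp: indicator_def)
    then show ?thesis using integrable_mult_indicator[OF set c, of q] by simp
  qed
  have "(\<integral>p. c p * G (s p) \<partial>M) =
      (\<integral>p. (\<Sum>q\<in>s ` space M. c p * indicator (s -` {q} \<inter> space M) p * G q) \<partial>M)"
  proof (rule Bochner_Integration.integral_cong[OF refl])
    fix p assume p: "p \<in> space M"
    have "(\<Sum>q\<in>s ` space M. c p * indicator (s -` {q} \<inter> space M) p * G q) =
        (\<Sum>q\<in>s ` space M. if q = s p then c p * G q else 0)"
      using p by (intro sum.cong) (auto simp: indicator_def)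
    also have "\<dots> = c p * G (s p)"
      using fin p by (simp add: sum.delta')
    finally show "c p * G (s p) = (\<Sum>q\<in>s ` space M. c p * indicator (s -` {q} \<inter> space M) p * G q)" ..
  qed
  also have "\<dots> = (\<Sum>q\<in>s ` space M. (\<integral>p. c p * indicator (s -` {q} \<inter> space M) p \<partial>M) * G q)"
    using int by (subst Bochner_Integration.integral_sum) auto
  finally show ?thesis .
qed

text \<open>Linearity is exact here although operators are linear only almost everywhere: pairing
  with a fixed function removes the null sets.\<close>

definition bounded_L2_functional :: "(('a::euclidean_space \<Rightarrow> complex) \<Rightarrow> complex) \<Rightarrow> bool" where
  "bounded_L2_functional l \<longleftrightarrow>
     (\<forall>f g a b. square_integrable f \<longrightarrow> square_integrable g \<longrightarrow>
        l (\<lambda>u. a * f u + b * g u) = a * l f + b * l g) \<and>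
     (\<exists>C. \<forall>f. square_integrable f \<longrightarrow> norm (l f) \<le> C * L2_norm f)"

lemma bounded_L2_functional_linear:
  assumes "bounded_L2_functional l" "square_integrable f" "square_integrable g"
  shows "l (\<lambda>u. a * f u + b * g u) = a * l f + b * l g"
  using assms by (simp add: bounded_L2_functional_def)

lemma bounded_L2_functional_sum:
  assumes l: "bounded_L2_functional l" and "finite S" and v: "\<And>q. q \<in> S \<Longrightarrow> square_integrable (v q)"
  shows "square_integrable (\<lambda>u. \<Sum>q\<in>S. a q * v q u) \<and> l (\<lambda>u. \<Sum>q\<in>S. a q * v q u) = (\<Sum>q\<in>S. a q * l (v q))"
  using assms(2,3)
proof (induction S rule: finite_induct)
  case empty
  have z: "square_integrable (\<lambda>u::'a. 0)" by (simp add: square_integrable_def)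
  show ?case using bounded_L2_functional_linear[OF l z z, of 0 0] z by simp
next
  case (insert q S)
  then have sq: "square_integrable (v q)" "square_integrable (\<lambda>u. \<Sum>q\<in>S. a q * v q u)"
    and eq: "l (\<lambda>u. \<Sum>q\<in>S. a q * v q u) = (\<Sum>q\<in>S. a q * l (v q))" by auto
  show ?case
    using square_integrable_linear[OF sq, of "a q" 1]
      bounded_L2_functional_linear[OF l sq, of "a q" 1] insert.hyps eq by simp
qed

text \<open>Plays the part of Minkowski's integral inequality: split |c| |w| as sqrt|c| times
  sqrt|c| |w|, apply Cauchy-Schwarz for each u, and integrate over u by Tonelli. The norm of w p
  stays under the integral against |c p|, so that dominated convergence can later be applied to
  it.\<close>

lemma L2_norm_integral_le:
  fixes c :: "'p::euclidean_space \<Rightarrow> complex" and w :: "'p \<Rightarrow> 'a::euclidean_space \<Rightarrow> complex"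
  assumes c: "integrable lborel c"
    and w[measurable]: "case_prod w \<in> borel_measurable borel"
    and sq: "\<And>p. square_integrable (w p)" and M: "\<And>p. (L2_norm (w p))\<^sup>2 \<le> M"
  shows "square_integrable (\<lambda>u. \<integral>p. c p * w p u \<partial>lborel)" (is ?A)
    and "(L2_norm (\<lambda>u. \<integral>p. c p * w p u \<partial>lborel))\<^sup>2 \<le>
      (\<integral>p. norm (c p) \<partial>lborel) * (\<integral>p. norm (c p) * (L2_norm (w p))\<^sup>2 \<partial>lborel)" (is ?B)
proof -
  have [measurable]: "c \<in> borel_measurable borel" using borel_measurable_integrable[OF c] by simp
  have w2[measurable]: "case_prod w \<in> borel_measurable (borel \<Otimes>\<^sub>M borel)"
    using w by (simp add: borel_prod)
  have [measurable]: "(\<lambda>p. (L2_norm (w p))\<^sup>2) \<in> borel_measurable borel"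
    unfolding L2_norm_power2 by measurable
  have int: "integrable lborel (\<lambda>p. norm (c p) * (L2_norm (w p))\<^sup>2)"
  proof (rule integrable_lborel_bound)
    show "integrable lborel (\<lambda>p. norm (c p) * M)" using c by simp
    show "norm (norm (c p) * (L2_norm (w p))\<^sup>2) \<le> norm (c p) * M" for p
      using M[of p] by (auto intro!: mult_left_mono simp: abs_mult)
  qed measurable
  define I J where "I = (\<integral>p. norm (c p) \<partial>lborel)" and "J = (\<integral>p. norm (c p) * (L2_norm (w p))\<^sup>2 \<partial>lborel)"
  have IJ: "I \<ge> 0" "J \<ge> 0" unfolding I_def J_def by (auto intro!: integral_nonneg_AE)
  have pt: "ennreal (norm (\<integral>p. c p * w p u \<partial>lborel)) ^ 2 \<le>
      ennreal I * (\<integral>\<^sup>+p. ennreal (norm (c p)) * ennreal (norm (w p u)) ^ 2 \<partial>lborel)" for u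
  proof -
    \<comment> \<open>If the integrand is not integrable for this u, its integral is 0 by convention
      and the bound still holds.\<close>
    have "ennreal (norm (\<integral>p. c p * w p u \<partial>lborel)) \<le> (\<integral>\<^sup>+p. ennreal (norm (c p * w p u)) \<partial>lborel)"
      by (cases "integrable lborel (\<lambda>p. c p * w p u)")
        (auto simp: integral_norm_bound_ennreal not_integrable_integral_eq)
    also have "\<dots> = (\<integral>\<^sup>+p. ennreal (sqrt (norm (c p))) * ennreal (sqrt (norm (c p)) * norm (w p u)) \<partial>lborel)"
      by (intro nn_integral_cong) (simp add: ennreal_mult[symmetric] norm_mult flip: mult.assoc)
    finally have "ennreal (norm (\<integral>p. c p * w p u \<partial>lborel)) ^ 2 \<le>
        (\<integral>\<^sup>+p. ennreal (sqrt (norm (c p))) * ennreal (sqrt (norm (c p)) * norm (w p u)) \<partial>lborel)\<^sup>2"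
      by (rule power_mono) simp
    also have "\<dots> \<le> (\<integral>\<^sup>+p. ennreal (sqrt (norm (c p))) ^ 2 \<partial>lborel) *
        (\<integral>\<^sup>+p. ennreal (sqrt (norm (c p)) * norm (w p u)) ^ 2 \<partial>lborel)"
      by (rule Cauchy_Schwarz_nn_integral) measurable
    also have "(\<integral>\<^sup>+p. ennreal (sqrt (norm (c p))) ^ 2 \<partial>lborel) = ennreal I"
      unfolding I_def using c by (simp add: ennreal_power nn_integral_eq_integral)
    also have "(\<integral>\<^sup>+p. ennreal (sqrt (norm (c p)) * norm (w p u)) ^ 2 \<partial>lborel) =
        (\<integral>\<^sup>+p. ennreal (norm (c p)) * ennreal (norm (w p u)) ^ 2 \<partial>lborel)"
      by (intro nn_integral_cong) (simp add: ennreal_power power_mult_distrib ennreal_mult)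
    finally show ?thesis .
  qed
  have "(\<integral>\<^sup>+u. ennreal (norm (\<integral>p. c p * w p u \<partial>lborel)) ^ 2 \<partial>lborel) \<le>
      (\<integral>\<^sup>+u. ennreal I * (\<integral>\<^sup>+p. ennreal (norm (c p)) * ennreal (norm (w p u)) ^ 2 \<partial>lborel) \<partial>lborel)"
    by (intro nn_integral_mono pt)
  also have "\<dots> = ennreal I * (\<integral>\<^sup>+p. (\<integral>\<^sup>+u. ennreal (norm (c p)) * ennreal (norm (w p u)) ^ 2 \<partial>lborel) \<partial>lborel)"
    by (subst lborel_pair.Fubini') (auto simp: nn_integral_cmult case_prod_unfold)
  also have "\<dots> = ennreal I * (\<integral>\<^sup>+p. ennreal (norm (c p) * (L2_norm (w p))\<^sup>2) \<partial>lborel)"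
    by (intro arg_cong2[where f=times] nn_integral_cong refl)
      (simp add: nn_integral_cmult nn_integral_L2_norm sq ennreal_mult square_integrable_measurable)
  also have "\<dots> = ennreal (I * J)"
  proof -
    have "(\<integral>\<^sup>+p. ennreal (norm (c p) * (L2_norm (w p))\<^sup>2) \<partial>lborel) = ennreal J"
      unfolding J_def using int by (intro nn_integral_eq_integral) auto
    then show ?thesis by (simp only: ennreal_mult[OF IJ])
  qed
  finally have le: "(\<integral>\<^sup>+u. ennreal (norm (\<integral>p. c p * w p u \<partial>lborel)) ^ 2 \<partial>lborel) \<le> ennreal (I * J)" .
  have meas: "(\<lambda>u. \<integral>p. c p * w p u \<partial>lborel) \<in> borel_measurable borel"
    by measurable
  show ?A by (rule square_integrableI_nn(1)[OF meas le]) (use IJ in simp)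
  show ?B unfolding I_def[symmetric] J_def[symmetric]
    by (rule square_integrableI_nn(2)[OF meas le]) (use IJ in simp)
qed

text \<open>
  Without a Bochner integral in $L^2$: approximating the parameter by simple functions turns the
  integral into finite linear combinations, which converge in $L^2$.
\<close>

lemma bounded_L2_functional_integral:
  fixes c :: "'p::euclidean_space \<Rightarrow> complex" and v :: "'p \<Rightarrow> 'a::euclidean_space \<Rightarrow> complex"
  assumes l: "bounded_L2_functional l"
    and c: "integrable lborel c"
    and v[measurable]: "case_prod v \<in> borel_measurable borel"
    and sq: "\<And>p. square_integrable (v p)" and M: "\<And>p. L2_norm (v p) \<le> M"
    and bd: "\<And>p u. norm (v p u) \<le> D"
    and cont: "\<And>s p. s \<longlonglongrightarrow> p \<Longrightarrow> (\<lambda>k. L2_norm (\<lambda>u. v (s k) u - v p u)) \<longlonglongrightarrow> 0"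
  shows "l (\<lambda>u. \<integral>p. c p * v p u \<partial>lborel) = (\<integral>p. c p * l (v p) \<partial>lborel)" (is "l ?f = _")
proof -
  obtain C where C: "\<And>f. square_integrable f \<Longrightarrow> norm (l f) \<le> C * L2_norm f"
    using l by (auto simp: bounded_L2_functional_def)
  have [measurable]: "c \<in> borel_measurable borel" using borel_measurable_integrable[OF c] by simp
  have v2[measurable]: "case_prod v \<in> borel_measurable (borel \<Otimes>\<^sub>M borel)"
    using v by (simp add: borel_prod)
  have v1[measurable]: "v p \<in> borel_measurable borel" for p
    using sq by (rule square_integrable_measurable)
  have M0: "M \<ge> 0" using M[of undefined] L2_norm_nonneg order_trans by blast
  \<comment> \<open>Simple functions converging to the identity of the parameter space: replacing p
    by s k p turns a continuous superposition into a finite one.\<close>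
  have "\<exists>s. (\<forall>i. simple_function lborel (s i)) \<and> (\<forall>x. (\<lambda>i. s i x) \<longlonglongrightarrow> (x::'p))"
    using borel_measurable_implies_sequence_metric[of "\<lambda>x. x" "lborel::'p measure" 0] by auto
  then obtain s where s: "\<And>i. simple_function lborel (s i)" "\<And>x. (\<lambda>i. s i x) \<longlonglongrightarrow> (x::'p)"
    by blast
  have [measurable]: "s i \<in> borel_measurable borel" for i
    using borel_measurable_simple_function[OF s(1)] by simp
  have vs2: "(\<lambda>(p, u). v (s k p) u) \<in> borel_measurable (borel \<Otimes>\<^sub>M borel)" for k
    using measurable_compose[OF _ v2, of "\<lambda>(p, u). (s k p, u)" "borel \<Otimes>\<^sub>M borel"]
    by (simp add: case_prod_unfold)
  have vs[measurable]: "(\<lambda>(p, u). v (s k p) u) \<in> borel_measurable borel" for k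
    using vs2 by (simp add: borel_prod)
  have diff_sq: "square_integrable (\<lambda>u. v p u - v q u)" for p q
    using square_integrable_linear[OF sq sq, of 1 p "-1" q] by simp
  have conv: "(\<lambda>k. l (v (s k p))) \<longlonglongrightarrow> l (v p)" for p
  proof (rule Lim_null_comparison[THEN LIM_zero_cancel])
    show "\<forall>\<^sub>F k in sequentially. norm (l (v (s k p)) - l (v p)) \<le> C * L2_norm (\<lambda>u. v (s k p) u - v p u)"
    proof (intro always_eventually allI)
      fix k
      have "l (\<lambda>u. v (s k p) u - v p u) = l (v (s k p)) - l (v p)"
        using bounded_L2_functional_linear[OF l sq sq, of 1 "s k p" "-1" p] by simp
      then show "norm (l (v (s k p)) - l (v p)) \<le> C * L2_norm (\<lambda>u. v (s k p) u - v p u)"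
        using C[OF diff_sq, of "s k p" p] by simp
    qed
    show "(\<lambda>k. C * L2_norm (\<lambda>u. v (s k p) u - v p u)) \<longlonglongrightarrow> 0"
      using tendsto_mult_left[OF cont[OF s(2)], of C p] by simp
  qed
  \<comment> \<open>The functional l has no measurability of its own. Composed with a simple
    function it is simple, and p |-> l (v p) is then measurable as a pointwise limit.\<close>
  have lv_meas: "(\<lambda>p. l (v (s k p))) \<in> borel_measurable borel" for k
    using borel_measurable_simple_function[OF simple_function_compose1[OF s(1), of "\<lambda>q. l (v q)" k]] by simp
  have lv: "norm (l (v p)) \<le> \<bar>C\<bar> * M" for p
  proof -
    have "norm (l (v p)) \<le> C * L2_norm (v p)" using C[OF sq] .
    also have "\<dots> \<le> \<bar>C\<bar> * M" using M[of p] M0 by (intro mult_mono) auto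
    finally show ?thesis .
  qed
  have lim1: "(\<lambda>k. \<integral>p. c p * l (v (s k p)) \<partial>lborel) \<longlonglongrightarrow> (\<integral>p. c p * l (v p) \<partial>lborel)"
  proof (rule integral_dominated_convergence[where w="\<lambda>p. norm (c p) * (\<bar>C\<bar> * M)"])
    have "(\<lambda>p. l (v p)) \<in> borel_measurable borel"
      by (rule borel_measurable_LIMSEQ_metric[OF lv_meas conv])
    then show "(\<lambda>p. c p * l (v p)) \<in> borel_measurable lborel" by simp
    show "(\<lambda>p. c p * l (v (s k p))) \<in> borel_measurable lborel" for k using lv_meas by simp
    show "integrable lborel (\<lambda>p. norm (c p) * (\<bar>C\<bar> * M))" using c by simp
    show "AE p in lborel. (\<lambda>k. c p * l (v (s k p))) \<longlonglongrightarrow> c p * l (v p)"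
      using conv by (auto intro!: tendsto_mult)
    show "AE p in lborel. norm (c p * l (v (s k p))) \<le> norm (c p) * (\<bar>C\<bar> * M)" for k
      using lv by (auto simp: norm_mult intro!: mult_left_mono)
  qed
  define fk where "fk k = (\<lambda>u. \<integral>p. c p * v (s k p) u \<partial>lborel)" for k
  have l_fk: "l (fk k) = (\<integral>p. c p * l (v (s k p)) \<partial>lborel)" and sq_fk: "square_integrable (fk k)" for k
  proof -
    have fin: "finite (s k ` space lborel)" using simple_functionD(1)[OF s(1)] .
    have "fk k = (\<lambda>u. \<Sum>q\<in>s k ` space lborel. (\<integral>p. c p * indicator (s k -` {q} \<inter> space lborel) p \<partial>lborel) * v q u)"
      unfolding fk_def by (rule ext) (rule integral_simple_comp[OF s(1) c])
    then show "l (fk k) = (\<integral>p. c p * l (v (s k p)) \<partial>lborel)" "square_integrable (fk k)"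
      using bounded_L2_functional_sum[OF l fin, of v] sq
      by (auto simp: integral_simple_comp[OF s(1) c, of "\<lambda>q. l (v q)"])
  qed
  have f_sq: "square_integrable ?f"
    by (rule L2_norm_integral_le(1)[OF c v sq, of "M\<^sup>2"]) (simp add: M power_mono)
  \<comment> \<open>The uniform bound D makes the parameter integrals converge for every u, so that
    the difference of \<open>?f\<close> and \<open>fk k\<close> is the integral of the
    differences.\<close>
  have int: "integrable lborel (\<lambda>p. c p * v p u)" "integrable lborel (\<lambda>p. c p * v (s k p) u)" for k u
  proof -
    have "norm (c p * v q u) \<le> norm (c p) * D" for p q
      using mult_left_mono[OF bd[of q u], of "norm (c p)"] by (simp add: norm_mult)
    note le = this
    have i: "integrable lborel (\<lambda>p. norm (c p) * D)" using c by simp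
    have m[measurable]: "(\<lambda>p. v p u) \<in> borel_measurable borel" "(\<lambda>p. v (s k p) u) \<in> borel_measurable borel"
      using measurable_Pair1[OF v2, of u] measurable_Pair1[OF vs2, of u k] by simp_all
    show "integrable lborel (\<lambda>p. c p * v p u)" "integrable lborel (\<lambda>p. c p * v (s k p) u)"
      by (rule integrable_lborel_bound[OF i _ le]; simp)+
  qed
  define N where "N k p = (L2_norm (\<lambda>u. v p u - v (s k p) u))\<^sup>2" for k p
  have N_le: "N k p \<le> 4 * M\<^sup>2" for k p
  proof -
    have "N k p \<le> 2 * (L2_norm (v p))\<^sup>2 + 2 * (L2_norm (v (s k p)))\<^sup>2"
      unfolding N_def by (rule L2_norm_diff_power2_le[OF sq sq])
    also have "\<dots> \<le> 2 * M\<^sup>2 + 2 * M\<^sup>2"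
      by (intro add_mono mult_left_mono power_mono M) auto
    finally show ?thesis by simp
  qed
  have diff_meas: "(\<lambda>(p, u). v p u - v (s k p) u) \<in> borel_measurable borel" for k
    using borel_measurable_diff[OF v vs[of k]] by (simp add: case_prod_unfold)
  have fk_le: "(L2_norm (\<lambda>u. ?f u - fk k u))\<^sup>2 \<le> (\<integral>p. norm (c p) \<partial>lborel) * (\<integral>p. norm (c p) * N k p \<partial>lborel)" for k
  proof -
    have "?f u - fk k u = (\<integral>p. c p * (v p u - v (s k p) u) \<partial>lborel)" for u
      unfolding fk_def using int by (simp add: right_diff_distrib)
    then show ?thesis unfolding N_def
      using L2_norm_integral_le(2)[OF c diff_meas[of k] diff_sq N_le[of k, unfolded N_def]] by simp
  qed
  have "(\<lambda>k. \<integral>p. norm (c p) * N k p \<partial>lborel) \<longlonglongrightarrow> (\<integral>p. 0 \<partial>(lborel :: 'p measure))"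
  proof (rule integral_dominated_convergence[where w="\<lambda>p. norm (c p) * (4 * M\<^sup>2)"])
    show "integrable lborel (\<lambda>p. norm (c p) * (4 * M\<^sup>2))" using c by simp
    show "(\<lambda>p. norm (c p) * N k p) \<in> borel_measurable lborel" for k
      unfolding N_def L2_norm_power2 using diff_meas[of k] borel_prod[where 'a='p and 'b='a] by measurable
    show "AE p in lborel. norm (norm (c p) * N k p) \<le> norm (c p) * (4 * M\<^sup>2)" for k
      using N_le by (auto simp: N_def intro!: mult_left_mono)
    have "(\<lambda>k. N k p) \<longlonglongrightarrow> 0" for p
      using tendsto_power[OF cont[OF s(2)[of p]], of 2]
      unfolding N_def by (simp add: L2_norm_def norm_minus_commute)
    then show "AE p in lborel. (\<lambda>k. norm (c p) * N k p) \<longlonglongrightarrow> 0"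
      using tendsto_mult_right_zero by blast
  qed simp
  then have "(\<lambda>k. (\<integral>p. norm (c p) \<partial>lborel) * (\<integral>p. norm (c p) * N k p \<partial>lborel)) \<longlonglongrightarrow> 0"
    using tendsto_mult_right_zero by fastforce
  then have "(\<lambda>k. (L2_norm (\<lambda>u. ?f u - fk k u))\<^sup>2) \<longlonglongrightarrow> 0"
    by (rule Lim_null_comparison[rotated]) (use fk_le in auto)
  then have L2_lim: "(\<lambda>k. L2_norm (\<lambda>u. ?f u - fk k u)) \<longlonglongrightarrow> 0"
    using tendsto_real_sqrt[of _ 0] by fastforce
  have "(\<lambda>k. l ?f - l (fk k)) \<longlonglongrightarrow> 0"
  proof (rule Lim_null_comparison)
    show "(\<lambda>k. C * L2_norm (\<lambda>u. ?f u - fk k u)) \<longlonglongrightarrow> 0"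
      using tendsto_mult_left[OF L2_lim, of C] by simp
    have sub: "square_integrable (\<lambda>u. ?f u - fk k u)" "l (\<lambda>u. ?f u - fk k u) = l ?f - l (fk k)" for k
      using square_integrable_linear[OF f_sq sq_fk, of 1 "-1" k]
        bounded_L2_functional_linear[OF l f_sq sq_fk, of 1 "-1" k] by simp_all
    show "\<forall>\<^sub>F k in sequentially. norm (l ?f - l (fk k)) \<le> C * L2_norm (\<lambda>u. ?f u - fk k u)"
      using C[OF sub(1)] unfolding sub(2) by simp
  qed
  then have "(\<lambda>k. l (fk k)) \<longlonglongrightarrow> l ?f"
    using tendsto_diff[OF tendsto_const[of "l ?f"]] by fastforce
  then show ?thesis
    using LIMSEQ_unique lim1 unfolding l_fk by blast
qed

section \<open>Coherent states and their reproducing property\<close>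

definition sympl :: "'a::real_inner \<times> 'a \<Rightarrow> 'a \<times> 'a \<Rightarrow> real" where
  "sympl X Z = fst Z \<bullet> snd X - fst X \<bullet> snd Z"

definition cs_const :: "nat \<Rightarrow> real" where
  "cs_const n = pi powr (- real n / 4)"

lemma cs_const_pos: "cs_const n > 0"
  by (simp add: cs_const_def)

lemma cs_const_sq: "cs_const n * cs_const n * sqrt pi ^ n = 1"
proof -
  have "cs_const n * cs_const n = pi powr (- (real n / 2))"
    by (simp add: cs_const_def powr_add[symmetric])
  moreover have "sqrt pi ^ n = pi powr (real n / 2)"
    by (simp add: powr_half_sqrt[symmetric] powr_powr powr_realpow[symmetric])
  ultimately show ?thesis by (simp add: powr_add[symmetric])
qed

lemma coherent_state_gexp:
  fixes X :: "(real^'n) \<times> (real^'n)"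
  shows "coherent_state X u =
    of_real (cs_const CARD('n)) * gexp (- (norm (u - fst X))\<^sup>2 / 2) (u \<bullet> snd X - fst X \<bullet> snd X / 2)"
  by (simp add: coherent_state_def cs_const_def gexp_def case_prod_unfold algebra_simps)

lemma norm_coherent_state:
  fixes X :: "(real^'n) \<times> (real^'n)"
  shows "norm (coherent_state X u) = cs_const CARD('n) * exp (- (norm (u - fst X))\<^sup>2 / 2)"
  using cs_const_pos[of "CARD('n)"] by (simp add: coherent_state_gexp norm_mult)

lemma norm_coherent_state_le:
  fixes X :: "(real^'n) \<times> (real^'n)"
  shows "norm (coherent_state X u) \<le> cs_const CARD('n)"
  using cs_const_pos[of "CARD('n)"] by (simp add: norm_coherent_state mult_le_cancel_left1)

lemma continuous_coherent_state:
  "continuous_on UNIV (\<lambda>(X, u). coherent_state (X :: (real^'n) \<times> (real^'n)) u)"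
  unfolding coherent_state_gexp case_prod_unfold by (intro continuous_intros) auto

lemma coherent_state_measurable:
  "(\<lambda>(X, u). coherent_state (X :: (real^'n) \<times> (real^'n)) u) \<in> borel_measurable borel"
  by (rule borel_measurable_continuous_onI[OF continuous_coherent_state])

lemma coherent_state_measurable' [measurable (raw)]:
  assumes [measurable]: "f \<in> borel_measurable M" "g \<in> borel_measurable M"
  shows "(\<lambda>x. coherent_state (f x :: (real^'n) \<times> (real^'n)) (g x)) \<in> borel_measurable M"
  using borel_measurable_continuous_Pair[OF assms] continuous_coherent_state by (simp add: case_prod_unfold)

lemma norm_prod_sq: "(norm X)\<^sup>2 = (norm (fst X))\<^sup>2 + (norm (snd X))\<^sup>2"
  by (simp add: norm_prod_def)

text \<open>Since |u-x|^2 / 2 + |u-y|^2 / 2 = |u-(x+y)/2|^2 + |x-y|^2 / 4, the product is a Gaussian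
  at the midpoint with frequency \<xi> - \<eta>. Its Fourier transform supplies the missing
  |\<xi>-\<eta>|^2 / 4, and the normalisation cancels by \<open>cs_const_sq\<close>.\<close>

lemma inner_coherent_states:
  fixes X Y :: "(real^'n) \<times> (real^'n)"
  shows "L2_inner (coherent_state X) (coherent_state Y) = gexp (- (norm (X - Y))\<^sup>2 / 4) (sympl X Y / 2)"
proof -
  obtain x \<xi> y \<eta> where XY: "X = (x, \<xi>)" "Y = (y, \<eta>)" by (cases X, cases Y)
  let ?c = "of_real (cs_const CARD('n)) :: complex"
  have eq: "coherent_state X u * cnj (coherent_state Y u) =
      ?c * ?c * gexp (- (norm (x - y))\<^sup>2 / 4) (- x \<bullet> \<xi> / 2 + y \<bullet> \<eta> / 2) *
      cgauss 1 (u - (1/2) *\<^sub>R (x + y)) (u \<bullet> (\<xi> - \<eta>))" for u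
  proof -
    have r: "- (norm (u - x))\<^sup>2 / 2 + - (norm (u - y))\<^sup>2 / 2 =
        - (norm (x - y))\<^sup>2 / 4 + - 1 * (norm (u - (1/2) *\<^sub>R (x + y)))\<^sup>2"
      by (simp add: power2_norm_eq_inner inner_simps inner_commute field_simps)
    have s: "u \<bullet> \<xi> - x \<bullet> \<xi> / 2 + - (u \<bullet> \<eta> - y \<bullet> \<eta> / 2) =
        (- x \<bullet> \<xi> / 2 + y \<bullet> \<eta> / 2) + u \<bullet> (\<xi> - \<eta>)"
      by (simp add: inner_simps)
    have "coherent_state X u * cnj (coherent_state Y u) =
        ?c * ?c * (gexp (- (norm (u - x))\<^sup>2 / 2) (u \<bullet> \<xi> - x \<bullet> \<xi> / 2) *
          gexp (- (norm (u - y))\<^sup>2 / 2) (- (u \<bullet> \<eta> - y \<bullet> \<eta> / 2)))"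
      by (simp add: coherent_state_gexp XY)
    then show ?thesis
      unfolding gexp_mult r s by (simp add: gexp_mult mult.assoc)
  qed
  have "L2_inner (coherent_state X) (coherent_state Y) =
      ?c * ?c * gexp (- (norm (x - y))\<^sup>2 / 4) (- x \<bullet> \<xi> / 2 + y \<bullet> \<eta> / 2) *
      (of_real (sqrt (pi / 1) ^ CARD('n)) * gexp (- (norm (\<xi> - \<eta>))\<^sup>2 / (4 * 1)) ((1/2) *\<^sub>R (x + y) \<bullet> (\<xi> - \<eta>)))"
    unfolding L2_inner_def eq integral_mult_right_zero
    by (subst integral_gexp(2)) simp_all
  also have "\<dots> = of_real (cs_const CARD('n) * cs_const CARD('n) * sqrt pi ^ CARD('n)) *
      (gexp (- (norm (x - y))\<^sup>2 / 4) (- x \<bullet> \<xi> / 2 + y \<bullet> \<eta> / 2) *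
       gexp (- (norm (\<xi> - \<eta>))\<^sup>2 / (4 * 1)) ((1/2) *\<^sub>R (x + y) \<bullet> (\<xi> - \<eta>)))"
    by simp
  also have "\<dots> = gexp (- (norm (X - Y))\<^sup>2 / 4) (sympl X Y / 2)"
  proof -
    have r: "- (norm (x - y))\<^sup>2 / 4 + - (norm (\<xi> - \<eta>))\<^sup>2 / (4 * 1) = - (norm (X - Y))\<^sup>2 / 4"
      by (simp add: XY norm_prod_sq)
    have s: "- x \<bullet> \<xi> / 2 + y \<bullet> \<eta> / 2 + (1/2) *\<^sub>R (x + y) \<bullet> (\<xi> - \<eta>) = sympl X Y / 2"
      by (simp add: XY sympl_def inner_simps inner_commute field_simps)
    show ?thesis unfolding cs_const_sq gexp_mult r s by simp
  qed
  finally show ?thesis .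
qed

lemma square_integrable_coherent_state [simp]:
  "square_integrable (coherent_state (X :: (real^'n) \<times> (real^'n)))"
  and L2_norm_coherent_state [simp]: "L2_norm (coherent_state (X :: (real^'n) \<times> (real^'n))) = 1"
proof -
  have eq: "(norm (coherent_state X u))\<^sup>2 =
      cs_const CARD('n) * cs_const CARD('n) * gauss 1 (u - fst X)" for u
    unfolding norm_coherent_state power_mult_distrib by (simp add: power2_eq_square exp_add[symmetric])
  show "square_integrable (coherent_state X)"
    unfolding square_integrable_def eq
    by (intro conjI integrable_mult_right integrable_gaussian) auto
  show "L2_norm (coherent_state X) = 1"
    unfolding L2_norm_def eq integral_mult_right_zero integral_gaussian[OF zero_less_one]
    using cs_const_sq[of "CARD('n)"] by (simp add: mult.assoc)
qed

text \<open>For unit vectors the squared distance is 2 - 2 Re of the overlap, and the overlap is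
  explicit and continuous.\<close>

lemma tendsto_coherent_state:
  fixes s :: "nat \<Rightarrow> (real^'n) \<times> (real^'n)"
  assumes "s \<longlonglongrightarrow> X"
  shows "(\<lambda>k. L2_norm (\<lambda>u. coherent_state (s k) u - coherent_state X u)) \<longlonglongrightarrow> 0"
proof -
  have "(\<lambda>k. sympl (s k) X) \<longlonglongrightarrow> sympl X X"
    unfolding sympl_def by (intro tendsto_intros assms)
  then have "(\<lambda>k. sqrt (2 - 2 * Re (gexp (- (norm (s k - X))\<^sup>2 / 4) (sympl (s k) X / 2)))) \<longlonglongrightarrow>
      sqrt (2 - 2 * Re (gexp (- (norm (X - X))\<^sup>2 / 4) (sympl X X / 2)))"
    by (intro tendsto_intros assms) auto
  moreover have "L2_norm (\<lambda>u. coherent_state (s k) u - coherent_state X u) =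
      sqrt (2 - 2 * Re (gexp (- (norm (s k - X))\<^sup>2 / 4) (sympl (s k) X / 2)))" for k
    using L2_norm_diff_expand[OF square_integrable_coherent_state[of "s k"] square_integrable_coherent_state[of X]]
    by (intro real_sqrt_unique[symmetric]) (auto simp: inner_coherent_states)
  moreover have "sqrt (2 - 2 * Re (gexp (- (norm (X - X))\<^sup>2 / 4) (sympl X X / 2))) = 0"
    by (simp add: sympl_def gexp_def)
  ultimately show ?thesis by simp
qed

lemma lborel_product:
  fixes f :: "'a::euclidean_space \<Rightarrow> 'c::{real_normed_field,banach,second_countable_topology}"
    and g :: "'b::euclidean_space \<Rightarrow> 'c"
  assumes f: "integrable lborel f" and g: "integrable lborel g"
  shows integrable_lborel_product: "integrable lborel (\<lambda>(x, y). f x * g y)"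
    and integral_lborel_product:
      "(\<integral>(x, y). f x * g y \<partial>lborel) = integral\<^sup>L lborel f * integral\<^sup>L lborel g"
proof -
  have fg: "integrable (lborel \<Otimes>\<^sub>M lborel) (\<lambda>(x, y). f x * g y)"
    using f g by (intro lborel_pair.Fubini_integrable) (auto simp: norm_mult)
  then show "integrable lborel (\<lambda>(x, y). f x * g y)" unfolding lborel_prod .
  show "(\<integral>(x, y). f x * g y \<partial>lborel) = integral\<^sup>L lborel f * integral\<^sup>L lborel g"
    unfolding lborel_prod[symmetric] using lborel_pair.integral_fst[OF fg, symmetric] by simp
qed

text \<open>Without the factor in \<open>snd P\<close> the modulus of the integrand would not depend
  on the frequency at all, and the integral would diverge. The third part is the mass in absolute
  value required for Fubini; the second is, as e tends to 0, an approximate identity in u - t of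
  total mass tending to (2 pi)^n.\<close>

lemma coherent_kernel_integral:
  fixes t u :: "real^'n"
  assumes e: "e > 0"
  shows "integrable lborel (\<lambda>P :: (real^'n) \<times> (real^'n).
           cnj (coherent_state P t) * coherent_state P u * of_real (gauss e (snd P)))" (is ?I)
    and "(\<integral>P. cnj (coherent_state P t) * coherent_state P u * of_real (gauss e (snd P))
            \<partial>(lborel :: ((real^'n) \<times> (real^'n)) measure)) =
         of_real (sqrt (pi / e) ^ CARD('n) * exp (- (1 / 4 + 1 / (4 * e)) * (norm (u - t))\<^sup>2))" (is ?E)
    and "(\<integral>P. norm (cnj (coherent_state P t) * coherent_state P u * of_real (gauss e (snd P)))
            \<partial>(lborel :: ((real^'n) \<times> (real^'n)) measure)) =
         sqrt (pi / e) ^ CARD('n) * exp (- (norm (u - t))\<^sup>2 / 4)" (is ?N)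
proof -
  let ?c = "of_real (cs_const CARD('n)) :: complex"
  define f where "f y = ?c * ?c * gexp (- (norm (u - t))\<^sup>2 / 4) 0 *
      cgauss 1 (y - (1/2) *\<^sub>R (u + t)) (y \<bullet> 0)" for y :: "real^'n"
  define g where "g \<eta> = cgauss e (\<eta> - 0) (\<eta> \<bullet> (u - t))" for \<eta> :: "real^'n"
  have eq: "cnj (coherent_state P t) * coherent_state P u * of_real (gauss e (snd P)) =
      (case P of (y, \<eta>) \<Rightarrow> f y * g \<eta>)" for P :: "(real^'n) \<times> (real^'n)"
  proof -
    obtain y \<eta> where P: "P = (y, \<eta>)" by (cases P)
    have r: "- (norm (t - y))\<^sup>2 / 2 + - (norm (u - y))\<^sup>2 / 2 + - e * (norm \<eta>)\<^sup>2 =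
        - (norm (u - t))\<^sup>2 / 4 + - 1 * (norm (y - (1/2) *\<^sub>R (u + t)))\<^sup>2 + - e * (norm (\<eta> - 0))\<^sup>2"
      by (simp add: power2_norm_eq_inner inner_simps inner_commute field_simps)
    have s: "- (t \<bullet> \<eta> - y \<bullet> \<eta> / 2) + (u \<bullet> \<eta> - y \<bullet> \<eta> / 2) + 0 = 0 + y \<bullet> 0 + \<eta> \<bullet> (u - t)"
      by (simp add: inner_simps inner_commute)
    have "cnj (coherent_state P t) * coherent_state P u * of_real (gauss e (snd P)) =
        ?c * ?c * (gexp (- (norm (t - y))\<^sup>2 / 2) (- (t \<bullet> \<eta> - y \<bullet> \<eta> / 2)) *
          gexp (- (norm (u - y))\<^sup>2 / 2) (u \<bullet> \<eta> - y \<bullet> \<eta> / 2) * cgauss e \<eta> 0)"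
      by (simp add: coherent_state_gexp P of_real_exp_gexp)
    also have "\<dots> = f y * g \<eta>"
      unfolding gexp_mult r s f_def g_def by (simp add: gexp_mult mult.assoc)
    finally show ?thesis by (simp add: P)
  qed
  have f: "integrable lborel f" unfolding f_def by (intro integrable_mult_right integrable_gexp) simp
  have g: "integrable lborel g" unfolding g_def by (intro integrable_gexp e)
  show ?I unfolding eq by (rule integrable_lborel_product[OF f g])
  have "(\<integral>P. norm (case P of (y, \<eta>) \<Rightarrow> f y * g \<eta>) \<partial>lborel) = (\<integral>(y, \<eta>). norm (f y) * norm (g \<eta>) \<partial>lborel)"
    by (simp add: case_prod_unfold norm_mult)
  also have "\<dots> = (\<integral>y. norm (f y) \<partial>lborel) * (\<integral>\<eta>. norm (g \<eta>) \<partial>lborel)"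
    using f g by (intro integral_lborel_product) auto
  also have "(\<integral>y. norm (f y) \<partial>lborel) =
      cs_const CARD('n) * cs_const CARD('n) * exp (- (norm (u - t))\<^sup>2 / 4) * sqrt pi ^ CARD('n)"
    unfolding f_def norm_mult norm_gexp integral_mult_right_zero integral_gaussian[OF zero_less_one]
    using cs_const_pos[of "CARD('n)"] by simp
  also have "\<dots> = cs_const CARD('n) * cs_const CARD('n) * sqrt pi ^ CARD('n) * exp (- (norm (u - t))\<^sup>2 / 4)"
    by simp
  also have "(\<integral>\<eta>. norm (g \<eta>) \<partial>lborel) = sqrt (pi / e) ^ CARD('n)"
    unfolding g_def norm_gexp integral_gaussian[OF e] by simp
  finally show ?N unfolding eq cs_const_sq by simp
  have "(\<integral>P. (case P of (y, \<eta>) \<Rightarrow> f y * g \<eta>) \<partial>lborel) = (\<integral>y. f y \<partial>lborel) * (\<integral>\<eta>. g \<eta> \<partial>lborel)"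
    by (rule integral_lborel_product[OF f g])
  also have "(\<integral>y. f y \<partial>lborel) = ?c * ?c * gexp (- (norm (u - t))\<^sup>2 / 4) 0 * of_real (sqrt pi ^ CARD('n))"
    unfolding f_def integral_mult_right_zero
    by (subst integral_gexp(2)) (simp_all add: gexp_def)
  also have "\<dots> = of_real (cs_const CARD('n) * cs_const CARD('n) * sqrt pi ^ CARD('n)) * gexp (- (norm (u - t))\<^sup>2 / 4) 0"
    by simp
  also have "(\<integral>\<eta>. g \<eta> \<partial>lborel) = of_real (sqrt (pi / e) ^ CARD('n)) * gexp (- (norm (u - t))\<^sup>2 / (4 * e)) 0"
    unfolding g_def by (subst integral_gexp(2)[OF e]) simp
  finally have "(\<integral>P. (case P of (y, \<eta>) \<Rightarrow> f y * g \<eta>) \<partial>lborel) = of_real (sqrt (pi / e) ^ CARD('n)) *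
      (gexp (- (norm (u - t))\<^sup>2 / 4) 0 * gexp (- (norm (u - t))\<^sup>2 / (4 * e)) 0)"
    unfolding cs_const_sq by simp
  also have "\<dots> = of_real (sqrt (pi / e) ^ CARD('n) * exp (- (1 / 4 + 1 / (4 * e)) * (norm (u - t))\<^sup>2))"
    unfolding gexp_mult of_real_mult of_real_exp_gexp by (simp add: algebra_simps add_divide_distrib)
  finally show ?E unfolding eq .
qed

text \<open>
  The integral is regularised by $e^{-\epsilon^2|\eta|^2/2}$ in the frequency variable $\eta$;
  Fubini then produces an approximate identity.
\<close>

lemma coherent_expansion_pointwise:
  fixes \<phi> :: "real^'n \<Rightarrow> complex"
  assumes cont: "continuous_on UNIV \<phi>" and bd: "\<And>u. norm (\<phi> u) \<le> B"
    and int: "integrable lborel (\<lambda>P. L2_inner \<phi> (coherent_state P))"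
  shows "(\<integral>P. L2_inner \<phi> (coherent_state P) * coherent_state P u \<partial>lborel) = of_real ((2 * pi) ^ CARD('n)) * \<phi> u"
proof -
  let ?\<psi> = "coherent_state :: (real^'n) \<times> (real^'n) \<Rightarrow> real^'n \<Rightarrow> complex"
  let ?n = "CARD('n)"
  have [measurable]: "\<phi> \<in> borel_measurable borel" by (rule borel_measurable_continuous_onI[OF cont])
  have [measurable]: "(\<lambda>P. L2_inner \<phi> (?\<psi> P)) \<in> borel_measurable borel"
    using borel_measurable_integrable[OF int] by simp
  have B0: "B \<ge> 0" using bd[of 0] norm_ge_zero order_trans by blast
  define I where "I e = (\<integral>P. L2_inner \<phi> (?\<psi> P) * ?\<psi> P u * of_real (gauss e (snd P)) \<partial>lborel)" for e :: real
  define e where "e k = 1 / real (Suc k)" for k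
  have e: "e k > 0" for k by (simp add: e_def)
  have e0: "e \<longlonglongrightarrow> 0" unfolding e_def by (rule LIMSEQ_Suc[OF lim_1_over_n])
  have regular: "I (\<epsilon>\<^sup>2 / 2) = of_real (sqrt (2 * pi) ^ ?n) *
      (\<integral>s. \<phi> (u + \<epsilon> *\<^sub>R s) * of_real (exp (- (\<epsilon>\<^sup>2 / 4 + 1 / 2) * (norm s)\<^sup>2)) \<partial>lborel)"
    if eps: "\<epsilon> > 0" for \<epsilon>
  proof -
    \<comment> \<open>With this choice the substitution t = u + \<epsilon> s turns |u-t|^2 / (4
      \<delta>) into |s|^2 / 2, so the limiting Gaussian has fixed width.\<close>
    define \<delta> where "\<delta> = \<epsilon>\<^sup>2 / 2"
    have d: "\<delta> > 0" using eps by (simp add: \<delta>_def)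
    define h where "h t P = \<phi> t * (cnj (?\<psi> P t) * ?\<psi> P u * of_real (gauss \<delta> (snd P)))" for t P
    have h_meas: "case_prod h \<in> borel_measurable (lborel \<Otimes>\<^sub>M lborel)"
      unfolding h_def case_prod_unfold by measurable
    have "integrable (lborel \<Otimes>\<^sub>M lborel) (case_prod h)"
    proof (rule lborel_pair.Fubini_integrable[OF h_meas])
      show "AE t in lborel. integrable lborel (\<lambda>P. case_prod h (t, P))"
        using coherent_kernel_integral(1)[OF d] by (auto simp: h_def simp del: mult_minus_left intro!: AE_I2 integrable_mult_right)
      have "integrable lborel (\<lambda>t. B * (sqrt (pi / \<delta>) ^ ?n * gauss (1/4) (t - u)))"
        by (intro integrable_mult_right integrable_gaussian) simp
      then show "integrable lborel (\<lambda>t. \<integral>P. norm (case_prod h (t, P)) \<partial>lborel)"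
      proof (rule integrable_lborel_bound)
        show "(\<lambda>t. \<integral>P. norm (case_prod h (t, P)) \<partial>lborel) \<in> borel_measurable borel"
          using h_meas by (intro lborel.borel_measurable_lebesgue_integral) (simp add: case_prod_unfold)
        have "(\<integral>P. norm (case_prod h (t, P)) \<partial>lborel) =
            norm (\<phi> t) * (sqrt (pi / \<delta>) ^ ?n * exp (- (norm (u - t))\<^sup>2 / 4))" for t
          unfolding h_def case_prod_conv norm_mult[of "\<phi> t"] integral_mult_right_zero coherent_kernel_integral(3)[OF d] ..
        then show "norm (\<integral>P. norm (case_prod h (t, P)) \<partial>lborel) \<le>
            B * (sqrt (pi / \<delta>) ^ ?n * gauss (1/4) (t - u))" for t
          using B0 d bd by (auto simp: abs_mult norm_minus_commute intro!: mult_right_mono)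
      qed
    qed
    note h_int = this
    have "I \<delta> = (\<integral>P. (\<integral>t. h t P \<partial>lborel) \<partial>lborel)"
      unfolding I_def h_def L2_inner_def mult.assoc integral_mult_left_zero[symmetric] ..
    also have "\<dots> = (\<integral>t. (\<integral>P. h t P \<partial>lborel) \<partial>lborel)"
      by (rule lborel_pair.Fubini_integral[OF h_int])
    also have "\<dots> = (\<integral>t. \<phi> t * of_real (sqrt (pi / \<delta>) ^ ?n * exp (- (1 / 4 + 1 / (4 * \<delta>)) * (norm (u - t))\<^sup>2)) \<partial>lborel)"
      unfolding h_def integral_mult_right_zero coherent_kernel_integral(2)[OF d] ..
    also have "\<dots> = \<epsilon> ^ ?n *\<^sub>R (\<integral>s. \<phi> (u + \<epsilon> *\<^sub>R s) *
        of_real (sqrt (pi / \<delta>) ^ ?n * exp (- (1 / 4 + 1 / (4 * \<delta>)) * (norm (u - (u + \<epsilon> *\<^sub>R s)))\<^sup>2)) \<partial>lborel)"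
      using eps by (subst integral_lborel_affine[of \<epsilon> _ u]) auto
    also have "\<dots> = \<epsilon> ^ ?n *\<^sub>R (\<integral>s. \<phi> (u + \<epsilon> *\<^sub>R s) *
        of_real (exp (- (\<epsilon>\<^sup>2 / 4 + 1 / 2) * (norm s)\<^sup>2)) * of_real (sqrt (pi / \<delta>) ^ ?n) \<partial>lborel)"
    proof -
      have "- (1 / 4 + 1 / (4 * \<delta>)) * (norm (u - (u + \<epsilon> *\<^sub>R s)))\<^sup>2 = - (\<epsilon>\<^sup>2 / 4 + 1 / 2) * (norm s)\<^sup>2" for s :: "real^'n"
        using eps by (simp add: \<delta>_def power_mult_distrib field_simps)
      then show ?thesis by (simp only: of_real_mult mult_ac)
    qed
    also have "\<dots> = of_real ((\<epsilon> * sqrt (pi / \<delta>)) ^ ?n) *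
      (\<integral>s. \<phi> (u + \<epsilon> *\<^sub>R s) * of_real (exp (- (\<epsilon>\<^sup>2 / 4 + 1 / 2) * (norm s)\<^sup>2)) \<partial>lborel)"
      unfolding integral_mult_left_zero by (simp add: scaleR_conv_of_real power_mult_distrib)
    also have "\<epsilon> * sqrt (pi / \<delta>) = sqrt (2 * pi)"
      using eps unfolding \<delta>_def by (intro real_sqrt_unique[symmetric]) (auto simp: power_mult_distrib)
    finally show ?thesis unfolding \<delta>_def .
  qed
  have "(\<lambda>k. I ((e k)\<^sup>2 / 2)) \<longlonglongrightarrow> (\<integral>P. L2_inner \<phi> (?\<psi> P) * ?\<psi> P u \<partial>lborel)"
    unfolding I_def
  proof (rule integral_dominated_convergence[where w="\<lambda>P. norm (L2_inner \<phi> (?\<psi> P)) * cs_const ?n"])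
    show "integrable lborel (\<lambda>P. norm (L2_inner \<phi> (?\<psi> P)) * cs_const ?n)"
      using int by simp
    have "(\<lambda>k. L2_inner \<phi> (?\<psi> P) * ?\<psi> P u * of_real (exp (- ((e k)\<^sup>2 / 2) * (norm (snd P))\<^sup>2)))
        \<longlonglongrightarrow> L2_inner \<phi> (?\<psi> P) * ?\<psi> P u * of_real (exp (- (0\<^sup>2 / 2) * (norm (snd P))\<^sup>2))" for P :: "(real^'n) \<times> (real^'n)"
      by (intro tendsto_intros e0) auto
    then show "AE P in lborel. (\<lambda>k. L2_inner \<phi> (?\<psi> P) * ?\<psi> P u * of_real (exp (- ((e k)\<^sup>2 / 2) * (norm (snd P))\<^sup>2)))
        \<longlonglongrightarrow> L2_inner \<phi> (?\<psi> P) * ?\<psi> P u" by simp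
    show "AE P in lborel. norm (L2_inner \<phi> (?\<psi> P) * ?\<psi> P u * of_real (exp (- ((e k)\<^sup>2 / 2) * (norm (snd P))\<^sup>2)))
        \<le> norm (L2_inner \<phi> (?\<psi> P)) * cs_const ?n" for k
    proof (rule AE_I2)
      fix P :: "(real^'n) \<times> (real^'n)"
      have "exp (- ((e k)\<^sup>2 / 2) * (norm (snd P))\<^sup>2) \<le> 1" by simp
      then have "norm (?\<psi> P u) * exp (- ((e k)\<^sup>2 / 2) * (norm (snd P))\<^sup>2) \<le> cs_const ?n * 1"
        by (intro mult_mono norm_coherent_state_le) (auto simp: cs_const_def)
      then show "norm (L2_inner \<phi> (?\<psi> P) * ?\<psi> P u * of_real (exp (- ((e k)\<^sup>2 / 2) * (norm (snd P))\<^sup>2)))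
        \<le> norm (L2_inner \<phi> (?\<psi> P)) * cs_const ?n"
        by (simp add: norm_mult mult.assoc mult_left_mono)
    qed
  qed measurable
  \<comment> \<open>After rescaling, \<epsilon> survives only in the argument of \<phi> and in a
    term that sharpens the Gaussian, so exp(-|s|^2 / 2) times the bound of \<phi> dominates.\<close>
  moreover have "(\<lambda>k. I ((e k)\<^sup>2 / 2)) \<longlonglongrightarrow> of_real (sqrt (2 * pi) ^ ?n) *
      (\<integral>s. \<phi> u * of_real (gauss (1 / 2) (s - 0)) \<partial>(lborel :: (real^'n) measure))"
    unfolding regular[OF e]
  proof (intro tendsto_mult tendsto_const,
      rule integral_dominated_convergence[where w="\<lambda>s. B * gauss (1 / 2) (s - 0)"])
    show "integrable lborel (\<lambda>s::real^'n. B * gauss (1 / 2) (s - 0))"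
      by (intro integrable_mult_right integrable_gaussian) simp
    have "(\<lambda>k. \<phi> (u + e k *\<^sub>R s) * of_real (exp (- ((e k)\<^sup>2 / 4 + 1 / 2) * (norm s)\<^sup>2)))
        \<longlonglongrightarrow> \<phi> u * of_real (exp (- (0\<^sup>2 / 4 + 1 / 2) * (norm s)\<^sup>2))" for s
    proof (intro tendsto_intros e0)
      have "(\<lambda>k. u + e k *\<^sub>R s) \<longlonglongrightarrow> u + 0 *\<^sub>R s" by (intro tendsto_intros e0)
      then show "(\<lambda>k. \<phi> (u + e k *\<^sub>R s)) \<longlonglongrightarrow> \<phi> u"
        using continuous_on_tendsto_compose[OF cont, of _ u] by simp
    qed auto
    then show "AE s in lborel. (\<lambda>k. \<phi> (u + e k *\<^sub>R s) * of_real (exp (- ((e k)\<^sup>2 / 4 + 1 / 2) * (norm s)\<^sup>2)))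
        \<longlonglongrightarrow> \<phi> u * of_real (gauss (1 / 2) (s - 0))" by simp
    show "AE s in lborel. norm (\<phi> (u + e k *\<^sub>R s) * of_real (exp (- ((e k)\<^sup>2 / 4 + 1 / 2) * (norm s)\<^sup>2)))
        \<le> B * gauss (1 / 2) (s - 0)" for k
    proof (rule AE_I2)
      fix s :: "real^'n"
      have "- ((e k)\<^sup>2 / 4 + 1 / 2) * (norm s)\<^sup>2 \<le> - (1 / 2) * (norm (s - 0))\<^sup>2"
        using mult_right_mono[of "- ((e k)\<^sup>2 / 4 + 1 / 2)" "- (1 / 2)" "(norm s)\<^sup>2"] by simp
      then show "norm (\<phi> (u + e k *\<^sub>R s) * of_real (exp (- ((e k)\<^sup>2 / 4 + 1 / 2) * (norm s)\<^sup>2)))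
        \<le> B * gauss (1 / 2) (s - 0)"
        unfolding norm_mult norm_of_real abs_exp_cancel by (intro mult_mono bd B0) (auto simp del: mult_minus_left)
    qed
  qed measurable
  ultimately have "(\<integral>P. L2_inner \<phi> (?\<psi> P) * ?\<psi> P u \<partial>lborel) = of_real (sqrt (2 * pi) ^ ?n) *
      (\<integral>s. \<phi> u * of_real (gauss (1 / 2) (s - 0)) \<partial>(lborel :: (real^'n) measure))"
    by (rule LIMSEQ_unique)
  also have "\<dots> = of_real (sqrt (2 * pi) ^ ?n) * (\<phi> u * of_real (sqrt (pi / (1 / 2)) ^ ?n))"
    by (subst integral_mult_right_zero, subst integral_complex_of_real, subst integral_gaussian) auto
  also have "\<dots> = of_real ((2 * pi) ^ ?n) * \<phi> u"
  proof -
    \<comment> \<open>One factor comes from the rescaled kernel, the other from the mass of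
      exp(-|s|^2 / 2).\<close>
    have "sqrt (2 * pi) ^ ?n * sqrt (pi / (1 / 2)) ^ ?n = (2 * pi) ^ ?n"
    proof -
      have "sqrt (2 * pi) * sqrt (pi / (1 / 2)) = 2 * pi"
        by (simp add: mult.commute[of pi 2])
      then show ?thesis by (simp only: power_mult_distrib[symmetric])
    qed
    from this[symmetric] show ?thesis by (simp only: of_real_mult mult_ac)
  qed
  finally show ?thesis .
qed

lemma integral_lborel_fst:
  fixes f :: "'a::euclidean_space \<Rightarrow> 'b::euclidean_space \<Rightarrow> 'c::{banach,second_countable_topology}"
  assumes "integrable lborel (case_prod f)"
  shows "(\<integral>x. \<integral>y. f x y \<partial>lborel \<partial>lborel) = integral\<^sup>L lborel (case_prod f)"
  using assms unfolding lborel_prod[symmetric] by (rule lborel_pair.integral_fst)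

text \<open>The common domain of the expansion. It contains the coherent states, which lead to
  \<open>F\<close>, and the Schwartz functions with their conjugates, which lead to the kernel.
  Continuity and boundedness feed the approximate identity; integrability of the transform makes the
  superposition converge absolutely.\<close>

definition coherent_admissible :: "(real^'n \<Rightarrow> complex) \<Rightarrow> bool" where
  "coherent_admissible \<phi> \<longleftrightarrow> square_integrable \<phi> \<and> continuous_on UNIV \<phi> \<and> (\<exists>B. \<forall>u. norm (\<phi> u) \<le> B) \<and>
     integrable lborel (\<lambda>P. L2_inner \<phi> (coherent_state P))"

lemma coherent_expansion_functional:
  fixes \<phi> :: "real^'n \<Rightarrow> complex"
  assumes l: "bounded_L2_functional l" and adm: "coherent_admissible \<phi>"
  shows "of_real ((2 * pi) ^ CARD('n)) * l \<phi> = (\<integral>P. L2_inner \<phi> (coherent_state P) * l (coherent_state P) \<partial>lborel)"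
proof -
  \<comment> \<open>The summand with coefficient 0 brings the scalar multiple into the shape of the
    linearity law.\<close>
  have "(\<lambda>u. \<integral>P. L2_inner \<phi> (coherent_state P) * coherent_state P u \<partial>lborel) =
      (\<lambda>u. of_real ((2 * pi) ^ CARD('n)) * \<phi> u + 0 * \<phi> u)"
    using adm coherent_expansion_pointwise[of \<phi>] by (auto simp: coherent_admissible_def)
  moreover have "l (\<lambda>u. \<integral>P. L2_inner \<phi> (coherent_state P) * coherent_state P u \<partial>lborel) =
      (\<integral>P. L2_inner \<phi> (coherent_state P) * l (coherent_state P) \<partial>lborel)"
    using adm
    by (intro bounded_L2_functional_integral[OF l, where M=1 and D="cs_const CARD('n)"])
      (auto simp: coherent_admissible_def norm_coherent_state_le coherent_state_measurable tendsto_coherent_state)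
  ultimately show ?thesis
    using adm bounded_L2_functional_linear[OF l, of \<phi> \<phi> "of_real ((2 * pi) ^ CARD('n))" 0]
    by (simp add: coherent_admissible_def)
qed

lemma coherent_state_admissible: "coherent_admissible (coherent_state (X :: (real^'n) \<times> (real^'n)))"
  unfolding coherent_admissible_def
proof (intro conjI)
  show "continuous_on UNIV (coherent_state X)"
    unfolding coherent_state_gexp by (intro continuous_intros) auto
  show "\<exists>B. \<forall>u. norm (coherent_state X u) \<le> B"
    using norm_coherent_state_le[of X] by blast
  have "integrable lborel (\<lambda>P :: (real^'n) \<times> (real^'n). gauss (1/4) (P - X))"
    by (rule integrable_gaussian) simp
  then show "integrable lborel (\<lambda>P. L2_inner (coherent_state X) (coherent_state P))"
  proof (rule integrable_lborel_bound)
    have "continuous_on UNIV (\<lambda>P. L2_inner (coherent_state X) (coherent_state P))"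
      unfolding inner_coherent_states sympl_def by (intro continuous_intros) auto
    then show "(\<lambda>P. L2_inner (coherent_state X) (coherent_state P)) \<in> borel_measurable borel"
      by (rule borel_measurable_continuous_onI)
  qed (simp add: inner_coherent_states norm_minus_commute)
qed simp

lemma nn_integral_midpoint:
  fixes f :: "'a::euclidean_space \<times> 'a \<Rightarrow> ennreal"
  assumes [measurable]: "f \<in> borel_measurable borel"
  shows "(\<integral>\<^sup>+p. f p \<partial>lborel) = (\<integral>\<^sup>+x. \<integral>\<^sup>+v. f (x + (1/2) *\<^sub>R v, x - (1/2) *\<^sub>R v) \<partial>lborel \<partial>lborel)"
proof -
  note T = midpoint_map_measurable[where 'a='a]
  have [measurable]: "(\<lambda>(x, v). f (x + (1/2) *\<^sub>R v, x - (1/2) *\<^sub>R v)) \<in> borel_measurable (borel \<Otimes>\<^sub>M borel)"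
    unfolding borel_prod using measurable_compose[OF T assms] by (simp add: case_prod_unfold)
  have "(\<integral>\<^sup>+p. f p \<partial>lborel) = (\<integral>\<^sup>+p. f (case p of (x, v) \<Rightarrow> (x + (1/2) *\<^sub>R v, x - (1/2) *\<^sub>R v)) \<partial>lborel)"
    using T by (subst lborel_distr_midpoint[symmetric]) (simp add: nn_integral_distr)
  also have "\<dots> = (\<integral>\<^sup>+x. \<integral>\<^sup>+v. f (x + (1/2) *\<^sub>R v, x - (1/2) *\<^sub>R v) \<partial>lborel \<partial>lborel)"
    by (subst lborel_prod[symmetric], subst lborel.nn_integral_fst[symmetric]) (auto simp: case_prod_unfold)
  finally show ?thesis .
qed

text \<open>Conjugating the value repairs the antilinearity of the second slot, so one expansion
  lemma serves both arguments of <A f, g>.\<close>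

lemma bounded_functional_right:
  fixes f :: "'a::euclidean_space \<Rightarrow> complex"
  assumes f: "square_integrable f"
  shows "bounded_L2_functional (\<lambda>g. cnj (L2_inner f g))"
  unfolding bounded_L2_functional_def
proof (intro conjI allI impI)
  fix g h :: "'a \<Rightarrow> complex" and a b assume g: "square_integrable g" and h: "square_integrable h"
  have "L2_inner f (\<lambda>u. a * g u + b * h u) = (\<integral>u. cnj a * (f u * cnj (g u)) + cnj b * (f u * cnj (h u)) \<partial>lborel)"
    unfolding L2_inner_def by (simp add: algebra_simps)
  also have "\<dots> = cnj a * L2_inner f g + cnj b * L2_inner f h"
    unfolding L2_inner_def using integrable_L2_product[OF f g] integrable_L2_product[OF f h] by simp
  finally show "cnj (L2_inner f (\<lambda>u. a * g u + b * h u)) = a * cnj (L2_inner f g) + b * cnj (L2_inner f h)"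
    by simp
next
  show "\<exists>C. \<forall>g. square_integrable g \<longrightarrow> norm (cnj (L2_inner f g)) \<le> C * L2_norm g"
    using L2_Cauchy_Schwarz[OF f] by (intro exI[of _ "L2_norm f"]) auto
qed

section \<open>Coherent matrix elements and the symbol $F$\<close>

text \<open>Collects what follows from boundedness of A: the matrix elements, their expansion, and
  the distributional kernel. The integrability hypothesis enters with
  \<open>weyl_L1\<close>.\<close>

locale weyl_bounded =
  fixes A :: "(real^'n \<Rightarrow> complex) \<Rightarrow> (real^'n \<Rightarrow> complex)"
  assumes A: "bounded_L2_operator A"
begin

definition H :: "(real^'n) \<times> (real^'n) \<Rightarrow> (real^'n) \<times> (real^'n) \<Rightarrow> complex" where
  "H P Q = L2_inner (A (coherent_state P)) (coherent_state Q)"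

lemma A_square_integrable: "square_integrable f \<Longrightarrow> square_integrable (A f)"
  using A by (simp add: bounded_L2_operator_def)

lemma bounded_functional_left: "square_integrable g \<Longrightarrow> bounded_L2_functional (\<lambda>f. L2_inner (A f) g)"
  unfolding bounded_L2_functional_def
proof (intro conjI allI impI)
  fix f h :: "real^'n \<Rightarrow> complex" and a b assume g: "square_integrable g" and f: "square_integrable f" and h: "square_integrable h"
  note [measurable] = f g h A_square_integrable[OF f] A_square_integrable[OF h]
    A_square_integrable[OF square_integrable_linear[OF f h, of a b]]
  have "AE u in lborel. A (\<lambda>v. a * f v + b * h v) u = a * A f u + b * A h u"
    using A f h by (simp add: bounded_L2_operator_def)
  \<comment> \<open>The almost everywhere linearity of A becomes exact under the integral
    sign.\<close>
  then have "L2_inner (A (\<lambda>u. a * f u + b * h u)) g = (\<integral>u. a * (A f u * cnj (g u)) + b * (A h u * cnj (g u)) \<partial>lborel)"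
    unfolding L2_inner_def
    by (intro integral_cong_AE) (auto elim!: eventually_mono simp: algebra_simps)
  also have "\<dots> = a * L2_inner (A f) g + b * L2_inner (A h) g"
    unfolding L2_inner_def using integrable_L2_product[OF A_square_integrable[OF f] g]
      integrable_L2_product[OF A_square_integrable[OF h] g] by simp
  finally show "L2_inner (A (\<lambda>u. a * f u + b * h u)) g = a * L2_inner (A f) g + b * L2_inner (A h) g" .
next
  assume g: "square_integrable g"
  obtain C where C: "\<And>f. square_integrable f \<Longrightarrow> L2_norm (A f) \<le> C * L2_norm f"
    using A by (auto simp: bounded_L2_operator_def)
  show "\<exists>C. \<forall>f. square_integrable f \<longrightarrow> norm (L2_inner (A f) g) \<le> C * L2_norm f"
  proof (intro exI allI impI)
    fix f :: "real^'n \<Rightarrow> complex" assume f: "square_integrable f"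
    have "norm (L2_inner (A f) g) \<le> L2_norm (A f) * L2_norm g"
      by (rule L2_Cauchy_Schwarz[OF A_square_integrable[OF f] g])
    also have "\<dots> \<le> C * L2_norm f * L2_norm g"
      by (intro mult_right_mono C f) simp
    finally show "norm (L2_inner (A f) g) \<le> (C * L2_norm g) * L2_norm f" by (simp add: mult_ac)
  qed
qed

lemma H_bounded: "\<exists>C. \<forall>P Q. norm (H P Q) \<le> C"
proof -
  obtain C where C: "\<And>f. square_integrable f \<Longrightarrow> L2_norm (A f) \<le> C * L2_norm f"
    using A by (auto simp: bounded_L2_operator_def)
  have "norm (H P Q) \<le> C" for P Q
    using L2_Cauchy_Schwarz[OF A_square_integrable square_integrable_coherent_state, of "coherent_state P" Q]
      C[of "coherent_state P"] by (simp add: H_def)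
  then show ?thesis by blast
qed

text \<open>This is the route to Borel measurability of \<open>H\<close>: A acts on representatives,
  so joint measurability of (P, u) |-> A \<Psi>_P u is not at hand. The difference is split as
  <A(\<Psi>_p - \<Psi>_P), \<Psi>_q> + <A \<Psi>_P, \<Psi>_q - \<Psi>_Q>, and P |-> \<Psi>_P is norm
  continuous.\<close>

lemma H_continuous: "continuous_on UNIV (\<lambda>(P, Q). H P Q)"
  unfolding continuous_on_sequentially
proof (intro ballI allI impI, elim conjE)
  fix s :: "nat \<Rightarrow> _" and PQ :: "((real^'n) \<times> (real^'n)) \<times> ((real^'n) \<times> (real^'n))"
  assume lim: "s \<longlonglongrightarrow> PQ"
  obtain P Q where PQ: "PQ = (P, Q)" by (cases PQ)
  define p q where "p k = fst (s k)" and "q k = snd (s k)" for k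
  have pq: "p \<longlonglongrightarrow> P" "q \<longlonglongrightarrow> Q"
    using tendsto_fst[OF lim] tendsto_snd[OF lim] by (simp_all add: PQ p_def[abs_def] q_def[abs_def])
  obtain C where C: "\<And>f. square_integrable f \<Longrightarrow> L2_norm (A f) \<le> C * L2_norm f"
    using A by (auto simp: bounded_L2_operator_def)
  let ?\<psi> = "coherent_state :: (real^'n) \<times> (real^'n) \<Rightarrow> real^'n \<Rightarrow> complex"
  have diff: "square_integrable (\<lambda>u. ?\<psi> X u - ?\<psi> Y u)" for X Y
    using square_integrable_linear[of "?\<psi> X" "?\<psi> Y" 1 "-1"] by simp
  have le: "norm (H (p k) (q k) - H P Q) \<le> C * L2_norm (\<lambda>u. ?\<psi> (p k) u - ?\<psi> P u) +
      L2_norm (A (?\<psi> P)) * L2_norm (\<lambda>u. ?\<psi> (q k) u - ?\<psi> Q u)" for k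
  proof -
    have "L2_inner (A (\<lambda>u. ?\<psi> (p k) u - ?\<psi> P u)) (?\<psi> (q k)) = H (p k) (q k) - H P (q k)"
      using bounded_L2_functional_linear[OF bounded_functional_left, of "?\<psi> (q k)" "?\<psi> (p k)" "?\<psi> P" 1 "-1"]
      by (simp add: H_def)
    moreover have "norm (L2_inner (A (\<lambda>u. ?\<psi> (p k) u - ?\<psi> P u)) (?\<psi> (q k))) \<le> C * L2_norm (\<lambda>u. ?\<psi> (p k) u - ?\<psi> P u)"
      using L2_Cauchy_Schwarz[OF A_square_integrable[OF diff] square_integrable_coherent_state, of "p k" P "q k"]
        C[OF diff[of "p k" P]] by simp
    moreover have "cnj (L2_inner (A (?\<psi> P)) (\<lambda>u. ?\<psi> (q k) u - ?\<psi> Q u)) = cnj (H P (q k) - H P Q)"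
      using bounded_L2_functional_linear[OF bounded_functional_right[OF A_square_integrable], of "?\<psi> P" "?\<psi> (q k)" "?\<psi> Q" 1 "-1"]
      by (simp add: H_def)
    then have "L2_inner (A (?\<psi> P)) (\<lambda>u. ?\<psi> (q k) u - ?\<psi> Q u) = H P (q k) - H P Q"
      by (simp only: complex_cnj_cancel_iff)
    moreover have "norm (L2_inner (A (?\<psi> P)) (\<lambda>u. ?\<psi> (q k) u - ?\<psi> Q u)) \<le>
        L2_norm (A (?\<psi> P)) * L2_norm (\<lambda>u. ?\<psi> (q k) u - ?\<psi> Q u)"
      by (rule L2_Cauchy_Schwarz[OF A_square_integrable[OF square_integrable_coherent_state] diff])
    ultimately show ?thesis
      using norm_triangle_ineq[of "H (p k) (q k) - H P (q k)" "H P (q k) - H P Q"] by simp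
  qed
  have "(\<lambda>k. H (p k) (q k)) \<longlonglongrightarrow> H P Q"
  proof (rule Lim_null_comparison[THEN LIM_zero_cancel])
    show "\<forall>\<^sub>F k in sequentially. norm (H (p k) (q k) - H P Q) \<le> C * L2_norm (\<lambda>u. ?\<psi> (p k) u - ?\<psi> P u) +
      L2_norm (A (?\<psi> P)) * L2_norm (\<lambda>u. ?\<psi> (q k) u - ?\<psi> Q u)"
      using le by simp
    show "(\<lambda>k. C * L2_norm (\<lambda>u. ?\<psi> (p k) u - ?\<psi> P u) +
      L2_norm (A (?\<psi> P)) * L2_norm (\<lambda>u. ?\<psi> (q k) u - ?\<psi> Q u)) \<longlonglongrightarrow> 0"
      using tendsto_add[OF tendsto_mult_left[OF tendsto_coherent_state[OF pq(1)], of C]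
          tendsto_mult_left[OF tendsto_coherent_state[OF pq(2)], of "L2_norm (A (?\<psi> P))"]] by simp
  qed
  then show "((\<lambda>(P, Q). H P Q) \<circ> s) \<longlonglongrightarrow> (case PQ of (P, Q) \<Rightarrow> H P Q)"
    by (simp add: PQ o_def case_prod_unfold p_def q_def)
qed

lemma H_measurable: "(\<lambda>(P, Q). H P Q) \<in> borel_measurable borel"
  by (rule borel_measurable_continuous_onI[OF H_continuous])

lemma H_measurable' [measurable (raw)]:
  assumes "f \<in> borel_measurable M" "g \<in> borel_measurable M"
  shows "(\<lambda>x. H (f x) (g x)) \<in> borel_measurable M"
  using borel_measurable_continuous_Pair[OF assms] H_continuous by (simp add: case_prod_unfold)

text \<open>The expansion of a functional is used twice: for g |-> conj <A \<Psi>_P, g> at \<theta>,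
  with P fixed, and for f |-> <A f, \<theta>> at \<phi>. Each use contributes (2 pi)^n. The double
  integral converges absolutely because \<open>H\<close> is bounded and both transforms are
  integrable.\<close>

lemma bilinear_expansion:
  fixes \<phi> \<theta> :: "real^'n \<Rightarrow> complex"
  assumes \<phi>: "coherent_admissible \<phi>" and \<theta>: "coherent_admissible \<theta>"
  shows "integrable lborel (\<lambda>(P, Q). H P Q * (L2_inner \<phi> (coherent_state P) * cnj (L2_inner \<theta> (coherent_state Q))))"
      (is "integrable _ ?h")
    and "of_real ((2 * pi) ^ (2 * CARD('n))) * L2_inner (A \<phi>) \<theta> =
      (\<integral>(P, Q). H P Q * (L2_inner \<phi> (coherent_state P) * cnj (L2_inner \<theta> (coherent_state Q))) \<partial>lborel)"
proof -
  have sq: "square_integrable \<phi>" "square_integrable \<theta>"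
    and i\<phi>: "integrable lborel (\<lambda>P. L2_inner \<phi> (coherent_state P))"
    and i\<theta>: "integrable lborel (\<lambda>P. L2_inner \<theta> (coherent_state P))"
    using assms by (auto simp: coherent_admissible_def)
  obtain C where C: "\<And>P Q. norm (H P Q) \<le> C" using H_bounded by blast
  let ?g = "\<lambda>P Q. L2_inner \<phi> (coherent_state P) * cnj (L2_inner \<theta> (coherent_state Q))"
  have prod: "integrable lborel (case_prod ?g)"
    using i\<theta> by (intro integrable_lborel_product i\<phi>) simp
  show int: "integrable lborel ?h"
  proof (rule integrable_lborel_bound)
    show "integrable lborel (\<lambda>x. C * norm (case_prod ?g x))"
      using prod by (intro integrable_mult_right integrable_norm)
    show "?h \<in> borel_measurable borel"
      using borel_measurable_times[OF H_measurable, of "case_prod ?g"] borel_measurable_integrable[OF prod]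
      by (simp add: case_prod_unfold)
    show "norm (?h x) \<le> C * norm (case_prod ?g x)" for x
      using C by (auto simp: norm_mult intro!: mult_right_mono split: prod.split)
  qed
  have inner: "of_real ((2 * pi) ^ CARD('n)) * L2_inner (A (coherent_state P)) \<theta> =
      (\<integral>Q. cnj (L2_inner \<theta> (coherent_state Q)) * H P Q \<partial>lborel)" for P
  proof -
    define L where "L Q = L2_inner \<theta> (coherent_state Q)" for Q
    \<comment> \<open>The expansion concerns the conjugated pairing, which is the linear one;
      conjugating once more returns to \<open>H\<close>.\<close>
    have "cnj (of_real ((2 * pi) ^ CARD('n)) * cnj (L2_inner (A (coherent_state P)) \<theta>)) =
        cnj (\<integral>Q. L Q * cnj (H P Q) \<partial>lborel)"
      unfolding H_def L_def
      by (subst coherent_expansion_functional[OF bounded_functional_right[OF A_square_integrable[OF square_integrable_coherent_state]] \<theta>]) simp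
    also have "\<dots> = (\<integral>Q. cnj (L Q) * H P Q \<partial>lborel)"
      by (subst Bochner_Integration.integral_cnj[symmetric]) simp
    finally show ?thesis unfolding L_def by simp
  qed
  have "of_real ((2 * pi) ^ (2 * CARD('n))) * L2_inner (A \<phi>) \<theta> =
      of_real ((2 * pi) ^ CARD('n)) * (of_real ((2 * pi) ^ CARD('n)) * L2_inner (A \<phi>) \<theta>)"
    by (simp only: mult_2[of "CARD('n)"] power_add of_real_mult mult.assoc)
  also have "\<dots> = (\<integral>P. L2_inner \<phi> (coherent_state P) * (of_real ((2 * pi) ^ CARD('n)) * L2_inner (A (coherent_state P)) \<theta>) \<partial>lborel)"
    unfolding coherent_expansion_functional[OF bounded_functional_left[OF sq(2)] \<phi>] integral_mult_right_zero[symmetric]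
    by (simp only: mult_ac)
  also have "\<dots> = (\<integral>P. \<integral>Q. H P Q * (L2_inner \<phi> (coherent_state P) * cnj (L2_inner \<theta> (coherent_state Q))) \<partial>lborel \<partial>lborel)"
    unfolding inner integral_mult_right_zero[symmetric] by (simp only: mult_ac)
  also have "\<dots> = integral\<^sup>L lborel ?h"
    by (rule integral_lborel_fst[OF int])
  finally show "of_real ((2 * pi) ^ (2 * CARD('n))) * L2_inner (A \<phi>) \<theta> = integral\<^sup>L lborel ?h" .
qed

end

section \<open>The symplectic form and the symbols of rank one operators\<close>

lemma sympl_add_left: "sympl (X + Y) Z = sympl X Z + sympl Y Z"
  and sympl_add_right: "sympl Z (X + Y) = sympl Z X + sympl Z Y"
  and sympl_diff_left: "sympl (X - Y) Z = sympl X Z - sympl Y Z"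
  and sympl_diff_right: "sympl Z (X - Y) = sympl Z X - sympl Z Y"
  and sympl_scale_left: "sympl (c *\<^sub>R X) Z = c * sympl X Z"
  and sympl_scale_right: "sympl Z (c *\<^sub>R X) = c * sympl Z X"
  by (simp_all add: sympl_def inner_simps algebra_simps)

lemmas sympl_bilinear = sympl_add_left sympl_add_right sympl_diff_left sympl_diff_right
  sympl_scale_left sympl_scale_right

lemma sympl_flip: "sympl Z X = - sympl X Z"
  by (simp add: sympl_def inner_commute)

lemma sympl_self [simp]: "sympl X X = 0"
  by (simp add: sympl_def)

text \<open>A symplectic phase is an ordinary Fourier phase with the frequency turned by a right
  angle; in this form \<open>integral_gexp\<close> applies on phase space.\<close>

lemma sympl_eq_inner: "sympl Z Y = Z \<bullet> (- snd Y, fst Y)"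
  by (simp add: sympl_def inner_prod_def inner_commute)

text \<open>The Weyl symbol of the rank one operator $f \mapsto \langle f,\Psi_P\rangle\Psi_Q$.\<close>

definition cross_symbol ::
    "(real^'n) \<times> (real^'n) \<Rightarrow> (real^'n) \<times> (real^'n) \<Rightarrow> (real^'n) \<times> (real^'n) \<Rightarrow> complex" where
  "cross_symbol P Q X = of_real (2 ^ CARD('n)) *
     cgauss 1 (X - (1/2) *\<^sub>R (P + Q)) (sympl X (P - Q) + sympl P Q / 2)"

lemma norm_cross_symbol:
  "norm (cross_symbol P Q (X :: (real^'n) \<times> (real^'n))) =
     2 ^ CARD('n) * gauss 1 (X - (1/2) *\<^sub>R (P + Q))"
  unfolding cross_symbol_def norm_mult norm_gexp norm_of_real by simp

lemma cross_symbol_continuous: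
  "continuous_on UNIV (\<lambda>((P, Q), X). cross_symbol P Q (X :: (real^'n) \<times> (real^'n)))"
  unfolding cross_symbol_def case_prod_unfold sympl_def by (intro continuous_intros) auto

lemma cross_symbol_measurable [measurable (raw)]:
  assumes "f \<in> borel_measurable M" "g \<in> borel_measurable M" "h \<in> borel_measurable M"
  shows "(\<lambda>x. cross_symbol (f x) (g x) (h x :: (real^'n) \<times> (real^'n))) \<in> borel_measurable M"
proof -
  have "(\<lambda>x. ((f x, g x), h x)) \<in> measurable M borel"
    using measurable_Pair[OF measurable_Pair[OF assms(1,2)] assms(3)] by (simp only: borel_prod)
  from measurable_compose[OF this borel_measurable_continuous_onI[OF cross_symbol_continuous]]
  show ?thesis by simp
qed

text \<open>Here \<open>k Z\<close> is the coefficient of \<open>H P Q\<close> when H(X+Z, X-Z)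
  times its phase is expanded by \<open>bilinear_expansion\<close>. With M = (P+Q)/2 and N = (P-Q)/2
  the parallelogram law separates the exponent into |X-M|^2 / 2 and |Z-N|^2 / 2, and the phase is
  affine in Z with frequency \<open>q\<close>, the quarter turn of M - X. The Fourier integral over
  Z therefore produces a second factor exp(-|X-M|^2 / 2), and its constant is (2 pi)^n because phase
  space has dimension 2n.\<close>

lemma reproducing_kernel_cross_symbol:
  fixes P Q X :: "(real^'n) \<times> (real^'n)"
  defines "k \<equiv> \<lambda>Z. L2_inner (coherent_state (X + Z)) (coherent_state P) *
      cnj (L2_inner (coherent_state (X - Z)) (coherent_state Q)) * gexp 0 (sympl X Z)"
  shows "norm (k Z) = gauss (1/2) (X - (1/2) *\<^sub>R (P + Q)) *
      gauss (1/2) (Z - (1/2) *\<^sub>R (P - Q))" (is ?N)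
    and "integrable lborel k"
    and "(\<integral>Z. k Z \<partial>lborel) = of_real (pi ^ CARD('n)) * cross_symbol P Q X"
proof -
  define M N q where "M = (1/2) *\<^sub>R (P + Q)" and "N = (1/2) *\<^sub>R (P - Q)"
    and "q = (- snd (M - X), fst (M - X))"
  have PQ: "P = M + N" "Q = M - N"
    unfolding M_def N_def by (auto simp: prod_eq_iff vec_eq_iff field_simps)
  have k: "k Z = cgauss (1/2) (X - M) (sympl X N) *
      cgauss (1/2) (Z - N) (Z \<bullet> q)" for Z
  proof -
    have r: "- (norm (X + Z - P))\<^sup>2 / 4 + - (norm (X - Z - Q))\<^sup>2 / 4 + 0 =
        - (1/2) * (norm (X - M))\<^sup>2 + - (1/2) * (norm (Z - N))\<^sup>2"
      unfolding PQ by (simp add: power2_norm_eq_inner inner_simps inner_commute field_simps)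
    have s: "sympl (X + Z) P / 2 + - (sympl (X - Z) Q / 2) + sympl X Z = sympl X N + Z \<bullet> q"
      unfolding PQ q_def sympl_eq_inner[symmetric] sympl_bilinear sympl_flip[of Z X] by (simp add: field_simps)
    show ?thesis
      unfolding k_def inner_coherent_states cnj_gexp gexp_mult r s ..
  qed
  show ?N unfolding k norm_mult norm_gexp M_def N_def ..
  show "integrable lborel k"
    unfolding k by (intro integrable_mult_right integrable_gexp) simp
  have nq: "(norm q)\<^sup>2 = (norm (X - M))\<^sup>2"
    by (simp add: q_def norm_prod_sq norm_minus_commute[of X M] add.commute)
       (metis fst_diff snd_diff norm_minus_commute)
  have "(\<integral>Z. k Z \<partial>lborel) = cgauss (1/2) (X - M) (sympl X N) *
      (of_real (sqrt (pi / (1/2)) ^ (CARD('n) + CARD('n))) * gexp (- (norm q)\<^sup>2 / (4 * (1/2))) (N \<bullet> q))"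
    unfolding k integral_mult_right_zero by (subst integral_gexp(2)) auto
  also have "\<dots> = of_real (sqrt (pi / (1/2)) ^ (CARD('n) + CARD('n))) *
      gexp (- (1/2) * (norm (X - M))\<^sup>2 + - (norm q)\<^sup>2 / (4 * (1/2))) (sympl X N + N \<bullet> q)"
    by (simp only: gexp_mult[symmetric] mult_ac)
  also have "- (1/2) * (norm (X - M))\<^sup>2 + - (norm q)\<^sup>2 / (4 * (1/2)) = - 1 * (norm (X - M))\<^sup>2"
    unfolding nq by simp
  also have "sympl X N + N \<bullet> q = sympl X (P - Q) + sympl P Q / 2"
    unfolding q_def sympl_eq_inner[symmetric] PQ sympl_bilinear sympl_flip[of N X] sympl_flip[of N M] sympl_self
    by (simp add: field_simps)
  also have "sqrt (pi / (1/2)) ^ (CARD('n) + CARD('n)) = pi ^ CARD('n) * 2 ^ CARD('n)"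
  proof -
    have "sqrt (pi / (1/2)) * sqrt (pi / (1/2)) = pi * 2" by simp
    then show ?thesis unfolding power_add by (simp only: power_mult_distrib[symmetric])
  qed
  finally show "(\<integral>Z. k Z \<partial>lborel) = of_real (pi ^ CARD('n)) * cross_symbol P Q X"
    unfolding cross_symbol_def M_def by simp
qed

section \<open>Consequences of the integrability hypothesis for F\<close>

abbreviation centre :: "'a::real_vector \<times> 'a \<Rightarrow> 'a" where
  "centre p \<equiv> (1/2) *\<^sub>R (fst p + snd p)"

text \<open>\<open>HB\<close> is the hypothesis of the theorem with the quotient reduced to its
  modulus and the factor pi^(-n) moved to the right: B will be pi^n times the supremum.\<close>

locale weyl_L1 = weyl_bounded A for A :: "(real^'n \<Rightarrow> complex) \<Rightarrow> (real^'n \<Rightarrow> complex)" +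
  fixes B :: real
  assumes B0: "B \<ge> 0"
    and HB: "\<And>X. (\<integral>\<^sup>+Z. ennreal (norm (H (X + Z) (X - Z))) \<partial>lborel) \<le> ennreal B"
begin

text \<open>The estimate behind every use of Fubini with \<open>F\<close>. In coordinates (x, v) of
  midpoint and difference the Gaussian depends on x alone, and for fixed x the hypothesis bounds the
  integral over v = 2Z by 2^(2n) B. What remains is a Gaussian integral in dimension 2n.\<close>

lemma nn_integral_H_gaussian:
  fixes X :: "(real^'n) \<times> (real^'n)"
  assumes a: "a > 0"
  shows "(\<integral>\<^sup>+p. ennreal (norm (H (fst p) (snd p))) * ennreal (gauss a (X - centre p)) \<partial>lborel)
    \<le> ennreal (2 ^ (2 * CARD('n)) * B * sqrt (pi / a) ^ (2 * CARD('n)))"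
proof -
  have meas: "(\<lambda>p. ennreal (norm (H (fst p) (snd p))) * ennreal (gauss a (X - centre p)))
      \<in> borel_measurable borel" by measurable
  have mid: "(1/2) *\<^sub>R (x + (1/2) *\<^sub>R v + (x - (1/2) *\<^sub>R v)) = x" for x v :: "(real^'n) \<times> (real^'n)"
    by (auto simp: prod_eq_iff vec_eq_iff)
  have "(\<integral>\<^sup>+p. ennreal (norm (H (fst p) (snd p))) * ennreal (gauss a (X - centre p)) \<partial>lborel) =
      (\<integral>\<^sup>+x. \<integral>\<^sup>+v. ennreal (norm (H (x + (1/2) *\<^sub>R v) (x - (1/2) *\<^sub>R v))) * ennreal (gauss a (X - x)) \<partial>lborel \<partial>lborel)"
    by (subst nn_integral_midpoint[OF meas]) (simp only: fst_conv snd_conv mid)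
  also have "\<dots> \<le> (\<integral>\<^sup>+x. ennreal (2 ^ (2 * CARD('n)) * B) * ennreal (gauss a (x - X)) \<partial>lborel)"
  proof (rule nn_integral_mono)
    fix x :: "(real^'n) \<times> (real^'n)"
    have "(\<integral>\<^sup>+v. ennreal (norm (H (x + (1/2) *\<^sub>R v) (x - (1/2) *\<^sub>R v))) \<partial>lborel) =
        ennreal (2 ^ (2 * CARD('n))) * (\<integral>\<^sup>+Z. ennreal (norm (H (x + Z) (x - Z))) \<partial>lborel)"
      by (subst nn_integral_lborel_affine[where c=2 and t=0]) (auto simp: mult_2)
    also have "\<dots> \<le> ennreal (2 ^ (2 * CARD('n))) * ennreal B"
      by (intro mult_left_mono HB) simp
    finally show "(\<integral>\<^sup>+v. ennreal (norm (H (x + (1/2) *\<^sub>R v) (x - (1/2) *\<^sub>R v))) * ennreal (gauss a (X - x)) \<partial>lborel)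
        \<le> ennreal (2 ^ (2 * CARD('n)) * B) * ennreal (gauss a (x - X))"
      by (subst nn_integral_multc) (auto simp: ennreal_mult B0 norm_minus_commute[of x X] intro!: mult_right_mono)
  qed
  also have "\<dots> = ennreal (2 ^ (2 * CARD('n)) * B) * ennreal (sqrt (pi / a) ^ (2 * CARD('n)))"
  proof -
    have "(\<integral>\<^sup>+x. ennreal (gauss a (x - X)) \<partial>lborel) = ennreal (sqrt (pi / a) ^ (2 * CARD('n)))"
      using nn_integral_gaussian[OF a, of X] by (simp add: mult_2)
    then show ?thesis by (subst nn_integral_cmult; simp)
  qed
  finally show ?thesis using B0 a by (simp add: ennreal_mult)
qed

definition F :: "(real^'n) \<times> (real^'n) \<Rightarrow> complex" where
  "F X = of_real (1 / pi ^ CARD('n)) * (\<integral>Z. H (X + Z) (X - Z) * gexp 0 (sympl X Z) \<partial>lborel)"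

lemma integrable_H_gaussian:
  fixes X :: "(real^'n) \<times> (real^'n)"
  assumes a: "a > 0"
  shows "integrable lborel (\<lambda>p. H (fst p) (snd p) * of_real (gauss a (X - centre p)))"
proof (rule integrableI_bounded)
  have "(\<integral>\<^sup>+p. ennreal (norm (H (fst p) (snd p) * of_real (gauss a (X - centre p)))) \<partial>lborel)
    = (\<integral>\<^sup>+p. ennreal (norm (H (fst p) (snd p))) * ennreal (gauss a (X - centre p)) \<partial>lborel)"
    by (intro nn_integral_cong) (simp add: norm_mult ennreal_mult)
  also note nn_integral_H_gaussian[OF a, of X]
  also have "ennreal (2 ^ (2 * CARD('n)) * B * sqrt (pi / a) ^ (2 * CARD('n))) < \<infinity>" by simp
  finally show "(\<integral>\<^sup>+p. ennreal (norm (H (fst p) (snd p) * of_real (gauss a (X - centre p)))) \<partial>lborel) < \<infinity>" .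
qed measurable

text \<open>Joint integrability is checked by integrating over Z first: the modulus of
  \<open>k p Z\<close> is a Gaussian in X - \<open>centre p\<close> times a Gaussian in Z whose mass
  does not depend on p, which leaves \<open>nn_integral_H_gaussian\<close> with a = 1/2.\<close>

lemma F_eq_cross_symbol_integral:
  "of_real ((2 * pi) ^ (2 * CARD('n))) * F X = (\<integral>p. H (fst p) (snd p) * cross_symbol (fst p) (snd p) X \<partial>lborel)"
proof -
  define c :: complex where "c = of_real ((2 * pi) ^ (2 * CARD('n)))"
  define k where "k p Z = L2_inner (coherent_state (X + Z)) (coherent_state (fst p)) *
      cnj (L2_inner (coherent_state (X - Z)) (coherent_state (snd p))) * gexp 0 (sympl X Z)" for p Z
  have k_norm: "norm (k p Z) = gauss (1/2) (X - centre p) *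
      gauss (1/2) (Z - (1/2) *\<^sub>R (fst p - snd p))" for p Z
    unfolding k_def by (rule reproducing_kernel_cross_symbol(1))
  have k_cont: "continuous_on UNIV (case_prod k)"
    unfolding k_def case_prod_unfold inner_coherent_states sympl_def cnj_gexp by (intro continuous_intros) auto
  have k_meas[measurable]: "case_prod k \<in> borel_measurable (borel \<Otimes>\<^sub>M borel)"
    unfolding borel_prod by (rule borel_measurable_continuous_onI[OF k_cont])
  have int: "integrable (lborel \<Otimes>\<^sub>M lborel) (\<lambda>(p, Z). H (fst p) (snd p) * k p Z)"
  proof (rule integrableI_bounded)
    have "(\<integral>\<^sup>+x. ennreal (norm (case x of (p, Z) \<Rightarrow> H (fst p) (snd p) * k p Z)) \<partial>(lborel \<Otimes>\<^sub>M lborel)) =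
        (\<integral>\<^sup>+p. \<integral>\<^sup>+Z. ennreal (norm (H (fst p) (snd p) * k p Z)) \<partial>lborel \<partial>lborel)"
      by (subst lborel.nn_integral_fst[symmetric]) auto
    also have "\<dots> = (\<integral>\<^sup>+p. ennreal (norm (H (fst p) (snd p))) * ennreal (gauss (1/2) (X - centre p)) *
        ennreal (sqrt (pi / (1/2)) ^ (CARD('n) + CARD('n))) \<partial>lborel)"
    proof (rule nn_integral_cong)
      fix p :: "((real^'n) \<times> (real^'n)) \<times> ((real^'n) \<times> (real^'n))"
      have "(\<integral>\<^sup>+Z. ennreal (norm (H (fst p) (snd p) * k p Z)) \<partial>lborel) =
          (\<integral>\<^sup>+Z. (ennreal (norm (H (fst p) (snd p))) * ennreal (gauss (1/2) (X - centre p))) *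
            ennreal (gauss (1/2) (Z - (1/2) *\<^sub>R (fst p - snd p))) \<partial>lborel)"
        unfolding norm_mult k_norm by (simp only: ennreal_mult[OF norm_ge_zero] ennreal_mult exp_ge_zero mult_nonneg_nonneg mult.assoc)
      also have "\<dots> = ennreal (norm (H (fst p) (snd p))) * ennreal (gauss (1/2) (X - centre p)) *
        ennreal (sqrt (pi / (1/2)) ^ (CARD('n) + CARD('n)))"
        by (subst nn_integral_cmult, measurable, subst nn_integral_gaussian) auto
      finally show "(\<integral>\<^sup>+Z. ennreal (norm (H (fst p) (snd p) * k p Z)) \<partial>lborel) =
        ennreal (norm (H (fst p) (snd p))) * ennreal (gauss (1/2) (X - centre p)) *
        ennreal (sqrt (pi / (1/2)) ^ (CARD('n) + CARD('n)))" .
    qed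
    also have "\<dots> = (\<integral>\<^sup>+p. ennreal (norm (H (fst p) (snd p))) * ennreal (gauss (1/2) (X - centre p)) \<partial>lborel) *
        ennreal (sqrt (pi / (1/2)) ^ (CARD('n) + CARD('n)))"
      by (rule nn_integral_multc) measurable
    also have "\<dots> \<le> ennreal (2 ^ (2 * CARD('n)) * B * sqrt (pi / (1/2)) ^ (2 * CARD('n))) *
        ennreal (sqrt (pi / (1/2)) ^ (CARD('n) + CARD('n)))"
      by (intro mult_right_mono nn_integral_H_gaussian) auto
    also have "\<dots> < \<infinity>" by (simp add: ennreal_mult_less_top)
    finally show "(\<integral>\<^sup>+x. ennreal (norm (case x of (p, Z) \<Rightarrow> H (fst p) (snd p) * k p Z)) \<partial>(lborel \<Otimes>\<^sub>M lborel)) < \<infinity>" .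
  qed measurable
  \<comment> \<open>The expansion is applied with coherent states themselves as the two arguments,
    at the points X + Z and X - Z.\<close>
  have HZ: "c * H (X + Z) (X - Z) * gexp 0 (sympl X Z) = (\<integral>p. H (fst p) (snd p) * k p Z \<partial>lborel)" for Z
    unfolding c_def k_def H_def[of "X + Z"]
      bilinear_expansion(2)[OF coherent_state_admissible coherent_state_admissible]
    by (simp only: integral_mult_left_zero[symmetric] case_prod_unfold mult.assoc)
  have "c * F X = of_real (1 / pi ^ CARD('n)) * (\<integral>Z. c * H (X + Z) (X - Z) * gexp 0 (sympl X Z) \<partial>lborel)"
    unfolding F_def by (simp add: mult.assoc)
  also have "\<dots> = of_real (1 / pi ^ CARD('n)) * (\<integral>p. (\<integral>Z. H (fst p) (snd p) * k p Z \<partial>lborel) \<partial>lborel)"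
    unfolding HZ lborel_pair.Fubini_integral[OF int] ..
  also have "\<dots> = of_real (1 / pi ^ CARD('n)) *
      (\<integral>p. of_real (pi ^ CARD('n)) * (H (fst p) (snd p) * cross_symbol (fst p) (snd p) X) \<partial>lborel)"
  proof -
    have "(\<integral>Z. H (fst p) (snd p) * k p Z \<partial>lborel) =
        of_real (pi ^ CARD('n)) * (H (fst p) (snd p) * cross_symbol (fst p) (snd p) X)" for p
      unfolding k_def integral_mult_right_zero reproducing_kernel_cross_symbol(3) by (simp only: mult_ac)
    then show ?thesis by (simp only:)
  qed
  also have "\<dots> = (\<integral>p. H (fst p) (snd p) * cross_symbol (fst p) (snd p) X \<partial>lborel)"
    by simp
  finally show ?thesis unfolding c_def .
qed

lemma F_bounded: "norm (F X) \<le> B / pi ^ CARD('n)"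
proof -
  have "ennreal (norm (\<integral>Z. H (X + Z) (X - Z) * gexp 0 (sympl X Z) \<partial>lborel)) \<le> ennreal B"
  \<comment> \<open>In the other case the integral is 0 by convention and the bound is
    trivial.\<close>
  proof (cases "integrable lborel (\<lambda>Z. H (X + Z) (X - Z) * gexp 0 (sympl X Z))")
    case True
    then have "ennreal (norm (\<integral>Z. H (X + Z) (X - Z) * gexp 0 (sympl X Z) \<partial>lborel)) \<le>
        (\<integral>\<^sup>+Z. ennreal (norm (H (X + Z) (X - Z) * gexp 0 (sympl X Z))) \<partial>lborel)"
      by (rule integral_norm_bound_ennreal)
    also have "\<dots> \<le> ennreal B" using HB[of X] by (simp add: norm_mult)
    finally show ?thesis .
  qed (simp add: not_integrable_integral_eq B0)
  then have "norm (\<integral>Z. H (X + Z) (X - Z) * gexp 0 (sympl X Z) \<partial>lborel) \<le> B"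
    using B0 by simp
  then show ?thesis unfolding F_def norm_mult norm_of_real by (simp add: divide_right_mono)
qed

lemma F_continuous: "continuous_on UNIV F"
  unfolding continuous_on_sequentially
proof (intro ballI allI impI, elim conjE)
  fix s :: "nat \<Rightarrow> _" and X :: "(real^'n) \<times> (real^'n)"
  assume lim: "s \<longlonglongrightarrow> X"
  obtain R where R: "\<And>k. norm (s k - X) \<le> R"
    using convergent_imp_Bseq[OF convergentI[OF tendsto_diff[OF lim tendsto_const[of X]]]]
    by (auto simp: Bseq_def)
  define c :: complex where "c = of_real ((2 * pi) ^ (2 * CARD('n)))"
  have c: "c \<noteq> 0" by (simp add: c_def)
  let ?M = "\<lambda>p. centre p :: (real^'n) \<times> (real^'n)"
  have "(\<lambda>k. c * F (s k)) \<longlonglongrightarrow> c * F X"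
    unfolding c_def F_eq_cross_symbol_integral
  proof (rule integral_dominated_convergence[where
        w="\<lambda>p. 2 ^ CARD('n) * exp (R\<^sup>2) * norm (H (fst p) (snd p) * of_real (gauss (1/2) (X - ?M p)))"])
    show "integrable lborel (\<lambda>p. 2 ^ CARD('n) * exp (R\<^sup>2) * norm (H (fst p) (snd p) * of_real (gauss (1/2) (X - ?M p))))"
      by (intro integrable_mult_right integrable_norm integrable_H_gaussian) simp
    have "(\<lambda>k. cross_symbol (fst p) (snd p) (s k)) \<longlonglongrightarrow> cross_symbol (fst p) (snd p) X" for p
      unfolding cross_symbol_def sympl_def by (intro tendsto_intros lim)
    then show "AE p in lborel. (\<lambda>k. H (fst p) (snd p) * cross_symbol (fst p) (snd p) (s k))
        \<longlonglongrightarrow> H (fst p) (snd p) * cross_symbol (fst p) (snd p) X"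
      by (intro AE_I2 tendsto_mult_left)
    show "AE p in lborel. norm (H (fst p) (snd p) * cross_symbol (fst p) (snd p) (s k)) \<le>
        2 ^ CARD('n) * exp (R\<^sup>2) * norm (H (fst p) (snd p) * of_real (gauss (1/2) (X - ?M p)))" for k
    proof (rule AE_I2)
      fix p :: "((real^'n) \<times> (real^'n)) \<times> ((real^'n) \<times> (real^'n))"
      \<comment> \<open>This moves the Gaussian from the point s k to the limit X, at the price of
        halving its rate and of the factor exp(R^2), where R bounds the distance from s k to
        X.\<close>
      have "(norm (X - ?M p))\<^sup>2 \<le> (norm (X - s k) + norm (s k - ?M p))\<^sup>2"
        using norm_triangle_ineq[of "X - s k" "s k - ?M p"] by (intro power_mono) auto
      also have "\<dots> \<le> 2 * (norm (X - s k))\<^sup>2 + 2 * (norm (s k - ?M p))\<^sup>2"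
        using sum_squares_bound[of "norm (X - s k)" "norm (s k - ?M p)"] by (simp add: power2_sum)
      also have "(norm (X - s k))\<^sup>2 \<le> R\<^sup>2"
        using R[of k] by (intro power_mono) (auto simp: norm_minus_commute)
      finally have "- 1 * (norm (s k - ?M p))\<^sup>2 \<le> R\<^sup>2 + - (1/2) * (norm (X - ?M p))\<^sup>2" by simp
      then have "gauss 1 (s k - ?M p) \<le> exp (R\<^sup>2) * gauss (1/2) (X - ?M p)"
        unfolding exp_add[symmetric] by (simp only: exp_le_cancel_iff)
      from mult_left_mono[OF this, of "2 ^ CARD('n) * norm (H (fst p) (snd p))"]
      show "norm (H (fst p) (snd p) * cross_symbol (fst p) (snd p) (s k)) \<le>
        2 ^ CARD('n) * exp (R\<^sup>2) * norm (H (fst p) (snd p) * of_real (gauss (1/2) (X - ?M p)))"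
        unfolding norm_mult[of "H _ _"] norm_cross_symbol norm_of_real abs_exp_cancel
        by (simp only: mult_ac) simp
    qed
  qed measurable
  from tendsto_mult_left[OF this, of "1 / c"] show "(F \<circ> s) \<longlonglongrightarrow> F X"
    using c by (simp add: o_def)
qed

end

section \<open>Decay of the coherent transform of Schwartz functions\<close>

text \<open>
  The integrals of the difference quotients vanish by translation invariance.
\<close>

lemma integral_directional_derivative_eq_0:
  fixes g g' :: "'b::euclidean_space \<Rightarrow> complex" and e :: 'b
  assumes e: "norm e \<le> 1" and g[measurable]: "g \<in> borel_measurable borel"
    and deriv: "\<And>t. ((\<lambda>r. g (t + r *\<^sub>R e)) has_vector_derivative g' t) (at 0)"
    and bd: "\<And>t. norm (g t) \<le> C * gauss (1/4) t"
    and bd': "\<And>t. norm (g' t) \<le> C * gauss (1/4) t"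
  shows "(\<integral>t. g' t \<partial>lborel) = 0"
proof -
  have "0 \<le> C * gauss (1/4) (0::'b)" using bd[of 0] norm_ge_zero order_trans by blast
  then have C0: "C \<ge> 0" by simp
  define h where "h k = 1 / real (Suc k)" for k
  have h: "h k > 0" "h k \<le> 1" for k by (auto simp: h_def)
  have h_lim: "filterlim h (at 0) sequentially"
    unfolding filterlim_at h_def using LIMSEQ_Suc[OF lim_1_over_n] by auto
  define q where "q k t = (g (t + h k *\<^sub>R e) - g t) / of_real (h k)" for k t
  \<comment> \<open>The derivative is given at parameter 0 on every line; shifting the base point
    gives it at every parameter.\<close>
  have deriv': "((\<lambda>r. g (t + r *\<^sub>R e)) has_vector_derivative g' (t + r0 *\<^sub>R e)) (at r0)" for t r0
  proof -
    have "((\<lambda>r. r - r0) has_vector_derivative 1) (at r0)"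
      by (auto intro!: derivative_eq_intros)
    from vector_diff_chain_at[OF this, of "\<lambda>r. g ((t + r0 *\<^sub>R e) + r *\<^sub>R e)" "g' (t + r0 *\<^sub>R e)"]
    show ?thesis using deriv[of "t + r0 *\<^sub>R e"] by (simp add: o_def algebra_simps)
  qed
  have g_int: "integrable lborel g"
    by (rule integrable_lborel_bound[where g="\<lambda>t. C * gauss (1/4) (t - 0)"])
      (use bd integrable_gaussian[of "1/4" "0::'b"] in auto)
  have q_lim: "(\<lambda>k. q k t) \<longlonglongrightarrow> g' t" for t
  proof (rule LIM_zero_cancel, rule tendsto_norm_zero_cancel)
    have "((\<lambda>y. norm ((g (t + y *\<^sub>R e) - g (t + 0 *\<^sub>R e)) - (y - 0) *\<^sub>R g' t) / norm (y - 0)) \<longlongrightarrow> 0) (at 0)"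
      using deriv[of t] unfolding has_vector_derivative_def has_derivative_iff_norm by blast
    from filterlim_compose[OF this h_lim]
    have "(\<lambda>k. norm ((g (t + h k *\<^sub>R e) - g t) - h k *\<^sub>R g' t) / h k) \<longlonglongrightarrow> 0"
      using h(1) by (simp add: abs_of_pos)
    moreover have "norm ((g (t + h k *\<^sub>R e) - g t) - h k *\<^sub>R g' t) / h k = norm (q k t - g' t)" for k
    proof -
      have "q k t - g' t = ((g (t + h k *\<^sub>R e) - g t) - h k *\<^sub>R g' t) / of_real (h k)"
        unfolding q_def using h(1)[of k] by (simp add: diff_divide_distrib scaleR_conv_of_real)
      then show ?thesis using h(1)[of k] by (simp add: norm_divide)
    qed
    ultimately show "(\<lambda>k. norm (q k t - g' t)) \<longlonglongrightarrow> 0" by simp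
  qed
  \<comment> \<open>Mean value inequality on the segment from t to t + h e, whose length is at most
    1. There |t|^2 <= 2 |t + x e|^2 + 2, so the Gaussian of rate 1/4 is dominated by exp(1/4) times
    the one of rate 1/8 at t.\<close>
  have q_bd: "norm (q k t) \<le> C * exp (1/4) * gauss (1/8) (t - 0)" for k t
  proof -
    let ?K = "C * exp (1/4) * gauss (1/8) (t - 0)"
    have "norm (g (t + h k *\<^sub>R e) - g (t + 0 *\<^sub>R e)) \<le> ?K * h k - ?K * 0"
    proof (rule differentiable_bound_general[OF h(1), where f'="\<lambda>r. g' (t + r *\<^sub>R e)" and \<phi>'="\<lambda>_. ?K"])
      show "continuous_on {0..h k} (\<lambda>r. g (t + r *\<^sub>R e))"
        by (intro continuous_at_imp_continuous_on ballI has_vector_derivative_continuous[OF deriv'])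
      show "continuous_on {0..h k} ((*) ?K)" by (intro continuous_intros)
      show "((\<lambda>r. g (t + r *\<^sub>R e)) has_vector_derivative g' (t + x *\<^sub>R e)) (at x)" for x by (rule deriv')
      show "((*) ?K has_vector_derivative ?K) (at x)" for x
        by (auto intro!: derivative_eq_intros)
      fix x :: real assume x: "0 < x" "x < h k"
      have "norm (x *\<^sub>R e) \<le> 1 * 1"
        unfolding norm_scaleR using x h(2)[of k] e by (intro mult_mono) auto
      then have xe: "(norm (x *\<^sub>R e))\<^sup>2 \<le> 1" by (simp add: abs_square_le_1 del: norm_scaleR)
      have "(norm t)\<^sup>2 \<le> (norm (t + x *\<^sub>R e) + norm (x *\<^sub>R e))\<^sup>2"
        using norm_triangle_ineq4[of "t + x *\<^sub>R e" "x *\<^sub>R e"] by (intro power_mono) auto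
      also have "\<dots> \<le> 2 * (norm (t + x *\<^sub>R e))\<^sup>2 + 2 * (norm (x *\<^sub>R e))\<^sup>2"
        using sum_squares_bound[of "norm (t + x *\<^sub>R e)" "norm (x *\<^sub>R e)"] by (simp add: power2_sum)
      finally have "- (1/4) * (norm (t + x *\<^sub>R e))\<^sup>2 \<le> 1/4 + - (1/8) * (norm (t - 0))\<^sup>2"
        using xe by simp
      then have "gauss (1/4) (t + x *\<^sub>R e) \<le> exp (1/4) * gauss (1/8) (t - 0)"
        unfolding exp_add[symmetric] by (simp only: exp_le_cancel_iff)
      from order_trans[OF bd' mult_left_mono[OF this C0]]
      show "norm (g' (t + x *\<^sub>R e)) \<le> ?K" by (simp add: mult.assoc)
    qed
    then show ?thesis unfolding q_def using h(1)[of k] by (simp add: norm_divide divide_le_eq)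
  qed
  have "(\<lambda>k. \<integral>t. q k t \<partial>lborel) \<longlonglongrightarrow> (\<integral>t. g' t \<partial>lborel)"
  proof (rule integral_dominated_convergence[where w="\<lambda>t. C * exp (1/4) * gauss (1/8) (t - 0)"])
    show qm: "q k \<in> borel_measurable lborel" for k unfolding q_def by measurable
    show "g' \<in> borel_measurable lborel"
      by (rule borel_measurable_LIMSEQ_metric[OF qm q_lim])
    show "integrable lborel (\<lambda>t::'b. C * exp (1/4) * gauss (1/8) (t - 0))"
      by (intro integrable_mult_right integrable_gaussian) simp
    show "AE t in lborel. (\<lambda>k. q k t) \<longlonglongrightarrow> g' t" using q_lim by simp
    show "AE t in lborel. norm (q k t) \<le> C * exp (1/4) * gauss (1/8) (t - 0)" for k
      using q_bd by simp
  qed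
  moreover have "(\<integral>t. q k t \<partial>lborel) = 0" for k
  proof -
    have shift: "integrable lborel (\<lambda>t. g (t + h k *\<^sub>R e))" "(\<integral>t. g (t + h k *\<^sub>R e) \<partial>lborel) = (\<integral>t. g t \<partial>lborel)"
      using integrable_lborel_affine_iff[of 1 g "h k *\<^sub>R e"] integral_lborel_affine[of 1 g "h k *\<^sub>R e"] g_int
      by (simp_all add: add.commute)
    then show ?thesis unfolding q_def using g_int by simp
  qed
  ultimately show ?thesis using LIMSEQ_unique[OF _ tendsto_const] by simp
qed

text \<open>From 1 + r <= exp r and m r <= m^2 + r^2 / 4, with r the norm of s.\<close>

lemma polynomial_gaussian_bound:
  "(1 + norm (s::'b::real_normed_vector)) ^ m * gauss (1/2) s \<le>
     exp ((real m)\<^sup>2) * gauss (1/4) s"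
proof -
  have "(1 + norm s) ^ m \<le> exp (norm s) ^ m"
    by (intro power_mono exp_ge_add_one_self) simp
  also have "\<dots> = exp (real m * norm s)" by (simp add: exp_of_nat_mult)
  finally have "(1 + norm s) ^ m * gauss (1/2) s \<le> exp (real m * norm s) * gauss (1/2) s"
    by (intro mult_right_mono) auto
  also have "\<dots> \<le> exp ((real m)\<^sup>2) * gauss (1/4) s"
    using sum_squares_bound[of "real m" "norm s / 2"]
    unfolding exp_add[symmetric] exp_le_cancel_iff by (simp add: power_divide)
  finally show ?thesis .
qed

section \<open>Schwartz functions along lines and under seminorms\<close>

lemma iterated_deriv_append: "iterated_deriv (es @ fs) f = iterated_deriv es (iterated_deriv fs f)"
  by (induction es) auto

lemma schwartz_iterated_deriv:
  assumes "schwartz f" "es \<in> lists Basis"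
  shows "schwartz (iterated_deriv es f)"
  using assms by (auto simp: schwartz_def iterated_deriv_append[symmetric])

lemma schwartz_differentiable: "schwartz f \<Longrightarrow> f differentiable (at x)"
  unfolding schwartz_def using lists.Nil iterated_deriv.simps(1) by metis

lemma schwartz_continuous: "schwartz f \<Longrightarrow> continuous_on S f"
  by (intro continuous_at_imp_continuous_on ballI differentiable_imp_continuous_within schwartz_differentiable)

lemma schwartz_measurable [measurable_dest]: "schwartz f \<Longrightarrow> f \<in> borel_measurable borel"
  by (intro borel_measurable_continuous_onI schwartz_continuous)

lemma schwartz_vector_derivative:
  assumes "schwartz f"
  shows "((\<lambda>r. f (x + r *\<^sub>R e)) has_vector_derivative iterated_deriv [e] f x) (at 0)"
proof -
  have line: "((\<lambda>r::real. x + r *\<^sub>R e) has_derivative (\<lambda>r. r *\<^sub>R e)) (at 0)"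
    by (auto intro!: derivative_eq_intros)
  have "(f has_derivative frechet_derivative f (at (x + 0 *\<^sub>R e))) (at (x + 0 *\<^sub>R e))"
    using schwartz_differentiable[OF assms] frechet_derivative_works by auto
  from has_derivative_compose[OF line this]
  have "((\<lambda>r. f (x + r *\<^sub>R e)) has_derivative (\<lambda>r. frechet_derivative f (at x) (r *\<^sub>R e))) (at 0)" by simp
  then show ?thesis
    unfolding has_vector_derivative_def
    using linear_scale[OF linear_frechet_derivative[OF schwartz_differentiable[OF assms]], of x] by simp
qed

lemma schwartz_le_seminorm:
  assumes f: "schwartz f" and es: "es \<in> lists Basis" "length es \<le> N"
  shows "(1 + norm x) ^ N * norm (iterated_deriv es f x) \<le> schwartz_seminorm N f"
proof -
  have bdd: "bdd_above (range (\<lambda>x. (1 + norm x) ^ N * norm (iterated_deriv es f x)))"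
    if "es \<in> lists Basis" for es
    using f that by (auto simp: schwartz_def)
  have le: "(1 + norm x) ^ N * norm (iterated_deriv es f x) \<le>
      (SUP x. (1 + norm x) ^ N * norm (iterated_deriv es f x))" if "es \<in> lists Basis" for es x
    by (rule cSUP_upper[OF _ bdd[OF that]]) simp
  have nonneg: "0 \<le> (SUP x. (1 + norm x) ^ N * norm (iterated_deriv es f x))" if "es \<in> lists Basis" for es
    by (rule order_trans[OF _ le[OF that, of 0]]) simp
  have fin: "finite {es \<in> lists (Basis :: 'a set). length es \<le> N}"
    using finite_lists_length_le[OF finite_Basis] by (simp add: lists_eq_set)
  have "(SUP x. (1 + norm x) ^ N * norm (iterated_deriv es f x)) \<le> schwartz_seminorm N f"
    unfolding schwartz_seminorm_def
    by (rule member_le_sum[where f="\<lambda>es. SUP x. (1 + norm x) ^ N * norm (iterated_deriv es f x)", OF _ _ fin])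
      (use es nonneg in auto)
  with le[OF es(1)] show ?thesis by (rule order_trans)
qed

lemma schwartz_seminorm_nonneg: "schwartz f \<Longrightarrow> schwartz_seminorm N f \<ge> 0"
proof -
  assume "schwartz f"
  from schwartz_le_seminorm[OF this lists.Nil, of N 0] have "norm (f 0) \<le> schwartz_seminorm N f" by simp
  then show ?thesis using norm_ge_zero order_trans by blast
qed

text \<open>
  The powers $(s \bullet e)^k$ in the window make the class closed under integration by parts, so
  the decay in $\eta$ follows by an induction that never expands a Leibniz rule.
\<close>

definition window_transform ::
    "'b \<Rightarrow> nat \<Rightarrow> ('b::euclidean_space \<Rightarrow> complex) \<Rightarrow> 'b \<Rightarrow> 'b \<Rightarrow> complex" where
  "window_transform e k f y \<eta> =
     (\<integral>s. f (y + s) * (of_real (s \<bullet> e) ^ k * cgauss (1/2) s (- (s \<bullet> \<eta>))) \<partial>lborel)"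

text \<open>The inequality 1 + |y| <= (1 + |y+s|)(1 + |s|) transfers the weight in y to the argument
  of f; the powers of 1 + |s| that appear are absorbed by half of the Gaussian.\<close>

lemma window_integrand_bound:
  fixes f :: "'b::euclidean_space \<Rightarrow> complex"
  assumes e: "norm e \<le> 1" and D: "\<And>x. (1 + norm x) ^ L * norm (f x) \<le> D"
  shows "(1 + norm y) ^ L * norm (f (y + s) * (of_real (s \<bullet> e) ^ k * cgauss (1/2) s (- (s \<bullet> \<eta>))))
    \<le> D * (exp ((real (L + k))\<^sup>2) * gauss (1/4) s)"
proof -
  have D0: "D \<ge> 0" using D[of 0] by (auto intro: order_trans[rotated])
  have "(1 + norm y) \<le> (1 + norm (y + s)) * (1 + norm s)"
  proof -
    have "norm y \<le> norm (y + s) + norm s" using norm_triangle_ineq4[of "y + s" s] by simp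
    moreover have "0 \<le> norm (y + s) * norm s" by simp
    moreover have "(1 + norm (y + s)) * (1 + norm s) = 1 + norm (y + s) + norm s + norm (y + s) * norm s"
      by (simp add: distrib_left distrib_right)
    ultimately show ?thesis by linarith
  qed
  then have y: "(1 + norm y) ^ L \<le> (1 + norm (y + s)) ^ L * (1 + norm s) ^ L"
    unfolding power_mult_distrib[symmetric] by (intro power_mono) auto
  have se: "\<bar>s \<bullet> e\<bar> ^ k \<le> (1 + norm s) ^ k"
  proof (intro power_mono)
    have "\<bar>s \<bullet> e\<bar> \<le> norm s * norm e" by (rule Cauchy_Schwarz_ineq2)
    also have "\<dots> \<le> norm s * 1" by (intro mult_left_mono e) simp
    finally show "\<bar>s \<bullet> e\<bar> \<le> 1 + norm s" by simp
  qed simp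
  have "(1 + norm y) ^ L * norm (f (y + s) * (of_real (s \<bullet> e) ^ k * cgauss (1/2) s (- (s \<bullet> \<eta>)))) =
      (1 + norm y) ^ L * norm (f (y + s)) * (\<bar>s \<bullet> e\<bar> ^ k * gauss (1/2) s)"
    unfolding norm_mult norm_gexp norm_power norm_of_real by (simp only: mult_ac)
  also have "\<dots> \<le> ((1 + norm (y + s)) ^ L * (1 + norm s) ^ L) * norm (f (y + s)) * ((1 + norm s) ^ k * gauss (1/2) s)"
    by (intro mult_mono y se mult_nonneg_nonneg order_refl) auto
  also have "\<dots> = ((1 + norm (y + s)) ^ L * norm (f (y + s))) * ((1 + norm s) ^ (L + k) * gauss (1/2) s)"
    by (simp only: power_add mult_ac)
  also have "\<dots> \<le> D * (exp ((real (L + k))\<^sup>2) * gauss (1/4) s)"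
    by (intro mult_mono D polynomial_gaussian_bound D0) auto
  finally show ?thesis .
qed

lemma schwartz_bounded:
  assumes "schwartz f" "es \<in> lists Basis"
  obtains D where "\<And>x. (1 + norm x) ^ L * norm (iterated_deriv es f x) \<le> D"
proof -
  have "bdd_above (range (\<lambda>x. (1 + norm x) ^ L * norm (iterated_deriv es f x)))"
    using assms by (auto simp: schwartz_def)
  then show thesis using that by (auto simp: bdd_above_def)
qed

lemma window_integrable:
  assumes f: "schwartz f" and e: "norm e \<le> 1"
  shows "integrable lborel (\<lambda>s. f (y + s) * (of_real (s \<bullet> e) ^ k * cgauss (1/2) s (- (s \<bullet> \<eta>))))"
proof -
  note [measurable] = schwartz_measurable[OF f]
  obtain D where D: "\<And>x. (1 + norm x) ^ 0 * norm (f x) \<le> D"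
    using schwartz_bounded[OF f lists.Nil, of 0] by auto
  show ?thesis
  proof (rule integrable_lborel_bound)
    show "integrable lborel (\<lambda>s. D * (exp ((real (0 + k))\<^sup>2) * gauss (1/4) (s - 0 :: 'a)))"
      by (intro integrable_mult_right integrable_gaussian) simp
    show "norm (f (y + s) * (of_real (s \<bullet> e) ^ k * cgauss (1/2) s (- (s \<bullet> \<eta>))))
        \<le> D * (exp ((real (0 + k))\<^sup>2) * gauss (1/4) (s - 0))" for s
      using window_integrand_bound[OF e D, of y s k \<eta>] by simp
  qed measurable
qed

text \<open>The integrand of \<open>window_transform e k f y \<eta>\<close> is differentiated in
  direction e; the integral of that derivative vanishes. Differentiating the Gaussian raises the
  power of s . e by one, differentiating the power lowers it, and the phase contributes the factor
  on the left.\<close>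

lemma window_transform_parts:
  fixes f :: "'b::euclidean_space \<Rightarrow> complex"
  assumes f: "schwartz f" and e: "e \<in> Basis"
  shows "\<i> * of_real (\<eta> \<bullet> e) * window_transform e k f y \<eta> =
    window_transform e k (iterated_deriv [e] f) y \<eta> +
    of_nat k * window_transform e (k - 1) f y \<eta> - window_transform e (Suc k) f y \<eta>"
proof -
  have e1: "norm e \<le> 1" "e \<bullet> e = 1" using e by (auto simp: inner_same_Basis)
  have ef: "schwartz (iterated_deriv [e] f)" using f e by (intro schwartz_iterated_deriv) auto
  note [measurable] = schwartz_measurable[OF f]
  define u where "u f k s = f (y + s) * (of_real (s \<bullet> e) ^ k * cgauss (1/2) s (- (s \<bullet> \<eta>)))"
    for f :: "'b \<Rightarrow> complex" and k s
  \<comment> \<open>The terms are the derivatives of f, of the power, of the Gaussian and of the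
    phase. At k = 0 the truncated \<open>k - 1\<close> does no harm, since its coefficient is
    0.\<close>
  define u' where "u' s = u (iterated_deriv [e] f) k s + of_nat k * u f (k - 1) s - u f (Suc k) s
      - \<i> * of_real (\<eta> \<bullet> e) * u f k s" for s
  have deriv: "((\<lambda>r. u f k (s + r *\<^sub>R e)) has_vector_derivative u' s) (at 0)" for s
  proof -
    let ?a = "of_real (s \<bullet> e) :: complex"
    let ?c0 = "of_real (- (1/2) * (norm s)\<^sup>2) + \<i> * of_real (- (s \<bullet> \<eta>)) :: complex"
    let ?c1 = "- ?a - \<i> * of_real (\<eta> \<bullet> e)"
    \<comment> \<open>On the line s + r e the window is the restriction to real r of an entire
      function, so its derivative is a complex one computed by the field rules.\<close>
    let ?G = "\<lambda>z. (?a + z) ^ k * exp (?c0 + ?c1 * z - z\<^sup>2 / 2)"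
    have eq: "u f k (s + r *\<^sub>R e) = f ((y + s) + r *\<^sub>R e) * ?G (of_real r)" for r
    proof -
      have "- (1/2) * (norm (s + r *\<^sub>R e))\<^sup>2 = - (1/2) * (norm s)\<^sup>2 - (s \<bullet> e) * r - r\<^sup>2 / 2"
        using e1 unfolding power2_norm_eq_inner by (simp add: inner_simps inner_commute algebra_simps power2_eq_square)
      moreover have "- ((s + r *\<^sub>R e) \<bullet> \<eta>) = - (s \<bullet> \<eta>) - (\<eta> \<bullet> e) * r"
        by (simp add: inner_simps inner_commute)
      ultimately have "cgauss (1/2) (s + r *\<^sub>R e) (- ((s + r *\<^sub>R e) \<bullet> \<eta>)) =
          exp (?c0 + ?c1 * of_real r - (of_real r)\<^sup>2 / 2)"
        unfolding gexp_def by (simp only:) (simp add: algebra_simps)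
      then show ?thesis using e1 by (simp add: u_def inner_simps add.assoc)
    qed
    have "(?G has_field_derivative (of_nat k * ?a ^ (k - 1) + ?a ^ k * ?c1) * exp ?c0) (at (of_real 0))"
      by (rule derivative_eq_intros refl | simp)+ (simp add: algebra_simps)
    from has_vector_derivative_mult[OF schwartz_vector_derivative[OF f, of "y + s" e]
        has_vector_derivative_real_field[OF this]]
    have "((\<lambda>r. f ((y + s) + r *\<^sub>R e) * ?G (of_real r)) has_vector_derivative
        f (y + s) * ((of_nat k * ?a ^ (k - 1) + ?a ^ k * ?c1) * exp ?c0) +
        iterated_deriv [e] f (y + s) * (?a ^ k * exp ?c0)) (at 0)" by simp
    moreover have "f (y + s) * ((of_nat k * ?a ^ (k - 1) + ?a ^ k * ?c1) * exp ?c0) +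
        iterated_deriv [e] f (y + s) * (?a ^ k * exp ?c0) = u' s"
      unfolding u'_def u_def gexp_def by (simp add: algebra_simps)
    ultimately show ?thesis unfolding eq by simp
  qed
  have u_int: "integrable lborel (u f k)" "integrable lborel (u f (k - 1))" "integrable lborel (u f (Suc k))"
     "integrable lborel (u (iterated_deriv [e] f) k)"
    unfolding u_def by (rule window_integrable[OF f e1(1)] window_integrable[OF ef e1(1)])+
  have bd: "\<exists>C. \<forall>s. norm (u g j s) \<le> C * gauss (1/4) s" if g: "schwartz g" for g j
  proof -
    obtain D where D: "\<And>x. (1 + norm x) ^ 0 * norm (g x) \<le> D"
      using schwartz_bounded[OF g lists.Nil, of 0] by auto
    show ?thesis
      using window_integrand_bound[OF e1(1) D, of y _ j \<eta>]
      by (intro exI[of _ "D * exp ((real (0 + j))\<^sup>2)"]) (simp add: u_def mult.assoc)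
  qed
  obtain C1 C2 C3 C4 where C:
    "\<And>s. norm (u f k s) \<le> C1 * gauss (1/4) s"
    "\<And>s. norm (u f (k - 1) s) \<le> C2 * gauss (1/4) s"
    "\<And>s. norm (u f (Suc k) s) \<le> C3 * gauss (1/4) s"
    "\<And>s. norm (u (iterated_deriv [e] f) k s) \<le> C4 * gauss (1/4) s"
    using bd[OF f] bd[OF ef] by metis
  define C where "C = \<bar>C1\<bar> + (\<bar>C4\<bar> + real k * \<bar>C2\<bar> + \<bar>C3\<bar> + \<bar>\<eta> \<bullet> e\<bar> * \<bar>C1\<bar>)"
  have abs_bd: "norm z \<le> \<bar>c\<bar> * w" if "norm z \<le> c * w" "w \<ge> 0" for z :: complex and c w :: real
    using that mult_right_mono[OF abs_ge_self[of c] that(2)] by linarith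
  have "(\<integral>s. u' s \<partial>lborel) = 0"
  proof (rule integral_directional_derivative_eq_0[OF e1(1) _ deriv])
    show "u f k \<in> borel_measurable borel" unfolding u_def by measurable
    fix s :: 'b
    let ?E = "gauss (1/4) s"
    have E: "?E \<ge> 0" by simp
    have "norm (u f k s) \<le> \<bar>C1\<bar> * ?E" by (rule abs_bd[OF C(1) E])
    also have "\<dots> \<le> C * ?E" unfolding C_def by (intro mult_right_mono) auto
    finally show "norm (u f k s) \<le> C * ?E" .
    have "norm (u' s) \<le> norm (u (iterated_deriv [e] f) k s) + norm (of_nat k * u f (k - 1) s)
        + norm (u f (Suc k) s) + norm (\<i> * of_real (\<eta> \<bullet> e) * u f k s)"
      unfolding u'_def
      by (intro order_trans[OF norm_triangle_ineq4] add_mono order_refl order_trans[OF norm_triangle_ineq])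
    also have "\<dots> \<le> \<bar>C4\<bar> * ?E + real k * (\<bar>C2\<bar> * ?E) + \<bar>C3\<bar> * ?E + \<bar>\<eta> \<bullet> e\<bar> * (\<bar>C1\<bar> * ?E)"
      unfolding norm_mult norm_ii norm_of_real norm_of_nat mult_1_left
      by (intro add_mono mult_left_mono abs_bd[OF C(1) E] abs_bd[OF C(2) E] abs_bd[OF C(3) E] abs_bd[OF C(4) E])
        simp_all
    also have "\<dots> = (\<bar>C4\<bar> + real k * \<bar>C2\<bar> + \<bar>C3\<bar> + \<bar>\<eta> \<bullet> e\<bar> * \<bar>C1\<bar>) * ?E"
      by (simp only: distrib_right mult.assoc)
    also have "\<dots> \<le> C * ?E" unfolding C_def by (intro mult_right_mono) auto
    finally show "norm (u' s) \<le> C * ?E" .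
  qed
  moreover have "(\<integral>s. u' s \<partial>lborel) = window_transform e k (iterated_deriv [e] f) y \<eta> +
    of_nat k * window_transform e (k - 1) f y \<eta> - window_transform e (Suc k) f y \<eta>
      - \<i> * of_real (\<eta> \<bullet> e) * window_transform e k f y \<eta>"
  proof -
    have wt: "window_transform e j g y \<eta> = integral\<^sup>L lborel (u g j)" for j g
      unfolding window_transform_def by (rule Bochner_Integration.integral_cong[OF refl]) (simp only: u_def)
    show ?thesis using u_int unfolding u'_def wt by (simp del: iterated_deriv.simps)
  qed
  ultimately show ?thesis by simp
qed

text \<open>Each integration by parts trades one factor \<eta> . e for a derivative of f or a shift
  of k, which is why k varies in the induction on m. The constant is quantified before f and D and
  the bound is linear in D: that uniformity later becomes continuity with respect to a
  seminorm.\<close>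

lemma window_transform_decay:
  fixes e :: "'b::euclidean_space"
  assumes e: "e \<in> Basis"
  shows "\<exists>C\<ge>0. \<forall>f D. schwartz f \<longrightarrow>
      (\<forall>i\<le>m. \<forall>x. (1 + norm x) ^ L * norm (iterated_deriv (replicate i e) f x) \<le> D) \<longrightarrow>
      (\<forall>y \<eta>. (1 + norm y) ^ L * (\<bar>\<eta> \<bullet> e\<bar> ^ m * norm (window_transform e k f y \<eta>)) \<le> C * D)"
proof (induction m arbitrary: k)
  case 0
  have e1: "norm e \<le> 1" using e by simp
  define C where "C = exp ((real (L + k))\<^sup>2) * (\<integral>s. gauss (1/4) (s - 0) \<partial>(lborel :: 'b measure))"
  have C0: "C \<ge> 0" unfolding C_def by (intro mult_nonneg_nonneg integral_nonneg_AE) auto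
  have "(1 + norm y) ^ L * norm (window_transform e k f y \<eta>) \<le> C * D"
    if f: "schwartz f" and D: "\<And>x. (1 + norm x) ^ L * norm (f x) \<le> D" for f :: "'b \<Rightarrow> complex" and D y \<eta>
  proof -
    let ?u = "\<lambda>s. f (y + s) * (of_real (s \<bullet> e) ^ k * cgauss (1/2) s (- (s \<bullet> \<eta>)))"
    have i: "integrable lborel ?u" by (rule window_integrable[OF f e1])
    have "(1 + norm y) ^ L * norm (window_transform e k f y \<eta>) \<le> (1 + norm y) ^ L * (\<integral>s. norm (?u s) \<partial>lborel)"
      unfolding window_transform_def by (intro mult_left_mono integral_norm_bound) simp
    also have "\<dots> = (\<integral>s. (1 + norm y) ^ L * norm (?u s) \<partial>lborel)" by simp
    also have "\<dots> \<le> (\<integral>s. D * (exp ((real (L + k))\<^sup>2) * gauss (1/4) (s - 0)) \<partial>(lborel :: 'b measure))"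
    proof (rule integral_mono)
      show "integrable lborel (\<lambda>s. (1 + norm y) ^ L * norm (?u s))" using i by simp
      show "integrable lborel (\<lambda>s::'b. D * (exp ((real (L + k))\<^sup>2) * gauss (1/4) (s - 0)))"
        by (intro integrable_mult_right integrable_gaussian) simp
      show "(1 + norm y) ^ L * norm (?u s) \<le> D * (exp ((real (L + k))\<^sup>2) * gauss (1/4) (s - 0))" for s
        using window_integrand_bound[OF e1 D, of y s k \<eta>] by simp
    qed
    also have "\<dots> = C * D" unfolding C_def integral_mult_right_zero by (simp only: mult_ac)
    finally show ?thesis .
  qed
  then show ?case using C0 by (intro exI[of _ C]) auto
next
  case (Suc m)
  let ?P = "\<lambda>C k. \<forall>f D. schwartz f \<longrightarrow>
      (\<forall>i\<le>m. \<forall>x. (1 + norm x) ^ L * norm (iterated_deriv (replicate i e) f x) \<le> D) \<longrightarrow>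
      (\<forall>y \<eta>. (1 + norm y) ^ L * (\<bar>\<eta> \<bullet> e\<bar> ^ m * norm (window_transform e k f y \<eta>)) \<le> C * D)"
  obtain C1 C2 C3 where C: "C1 \<ge> 0" "C2 \<ge> 0" "C3 \<ge> 0" and P: "?P C1 k" "?P C2 (k - 1)" "?P C3 (Suc k)"
    using Suc.IH[of k] Suc.IH[of "k - 1"] Suc.IH[of "Suc k"] by blast
  have "(1 + norm y) ^ L * (\<bar>\<eta> \<bullet> e\<bar> ^ Suc m * norm (window_transform e k f y \<eta>)) \<le> (C1 + real k * C2 + C3) * D"
    if f: "schwartz f" and D: "\<And>i x. i \<le> Suc m \<Longrightarrow> (1 + norm x) ^ L * norm (iterated_deriv (replicate i e) f x) \<le> D"
    for f :: "'b \<Rightarrow> complex" and D y \<eta>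
  proof -
    let ?W = "(1 + norm y) ^ L * \<bar>\<eta> \<bullet> e\<bar> ^ m"
    have W: "?W \<ge> 0" by simp
    let ?t = "\<lambda>k f. window_transform e k f y \<eta>"
    have ef: "schwartz (iterated_deriv [e] f)" using f e by (intro schwartz_iterated_deriv) auto
    have D': "(1 + norm x) ^ L * norm (iterated_deriv (replicate i e) (iterated_deriv [e] f) x) \<le> D" if "i \<le> m" for i x
      using D[of "Suc i" x] that unfolding iterated_deriv_append[symmetric] replicate_append_same by simp
    have "\<bar>\<eta> \<bullet> e\<bar> * norm (?t k f) = norm (\<i> * of_real (\<eta> \<bullet> e) * ?t k f)" by (simp add: norm_mult)
    also have "\<dots> \<le> norm (?t k (iterated_deriv [e] f)) + norm (of_nat k * ?t (k - 1) f) + norm (?t (Suc k) f)"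
      unfolding window_transform_parts[OF f e]
      by (intro order_trans[OF norm_triangle_ineq4] add_mono order_refl norm_triangle_ineq)
    finally have "?W * (\<bar>\<eta> \<bullet> e\<bar> * norm (?t k f)) \<le>
        ?W * (norm (?t k (iterated_deriv [e] f)) + real k * norm (?t (k - 1) f) + norm (?t (Suc k) f))"
      using W by (intro mult_left_mono) (simp_all add: norm_mult)
    also have "\<dots> = ?W * norm (?t k (iterated_deriv [e] f)) + real k * (?W * norm (?t (k - 1) f)) + ?W * norm (?t (Suc k) f)"
      by (simp only: distrib_left mult_ac)
    also have "\<dots> \<le> C1 * D + real k * (C2 * D) + C3 * D"
      using P(1)[rule_format, OF ef D', of y \<eta>] P(2)[rule_format, OF f D, of y \<eta>] P(3)[rule_format, OF f D, of y \<eta>]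
      by (intro add_mono mult_left_mono) (simp_all add: mult.assoc)
    also have "\<dots> = (C1 + real k * C2 + C3) * D" by (simp add: algebra_simps)
    finally show ?thesis by (simp add: mult_ac)
  qed
  then show ?case using C by (intro exI[of _ "C1 + real k * C2 + C3"]) auto
qed

section \<open>Integrable weights and decay of the Gaussian short-time Fourier transform\<close>

text \<open>A product over coordinates is chosen because it is integrable by one-dimensional
  integration, even, and multiplicative over pairs; the weights of positions and frequencies can
  thus be regrouped freely.\<close>

definition cauchy_weight :: "'b::euclidean_space \<Rightarrow> real" where
  "cauchy_weight x = (\<Prod>b\<in>Basis. 1 / (1 + (x \<bullet> b)\<^sup>2))"

lemma cauchy_weight_pos: "cauchy_weight x > 0"
  unfolding cauchy_weight_def by (intro prod_pos) (auto simp: add_pos_nonneg)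

lemma cauchy_weight_minus [simp]: "cauchy_weight (- x) = cauchy_weight x"
  by (simp add: cauchy_weight_def)

lemma cauchy_weight_Pair:
  "cauchy_weight (x :: 'a::euclidean_space, y :: 'b::euclidean_space) = cauchy_weight x * cauchy_weight y"
proof -
  have "(\<Prod>b\<in>(Basis :: ('a \<times> 'b) set). 1 / (1 + ((x, y) \<bullet> b)\<^sup>2)) =
    (\<Prod>b\<in>(\<lambda>u. (u, 0)) ` (Basis :: 'a set). 1 / (1 + ((x, y) \<bullet> b)\<^sup>2)) *
    (\<Prod>b\<in>(\<lambda>u. (0, u)) ` (Basis :: 'b set). 1 / (1 + ((x, y) \<bullet> b)\<^sup>2))"
    unfolding Basis_prod_def by (intro prod.union_disjoint) auto
  also have "\<dots> = cauchy_weight x * cauchy_weight y"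
    unfolding cauchy_weight_def by (subst (1 2) prod.reindex) (auto simp: inj_on_def)
  finally show ?thesis unfolding cauchy_weight_def[of "(x, y)"] .
qed

lemma integrable_cauchy_weight: "integrable lborel (cauchy_weight :: 'b::euclidean_space \<Rightarrow> real)"
proof -
  have "integrable lborel (\<lambda>x::real. 1 / (1 + x\<^sup>2))"
    using integrable_inverse_1_plus_square
    by (simp add: set_integrable_def einterval_eq_UNIV inverse_eq_divide)
  then show ?thesis
    unfolding cauchy_weight_def[abs_def] by (rule integrable_lborel_prod_coords)
qed

text \<open>Each of the factors costs (1 + |x|)^2, which is the origin of the exponent and seminorm
  order \<open>2 * DIM('b)\<close> used from here on.\<close>

lemma power_le_cauchy_weight:
  fixes x :: "'b::euclidean_space"
  shows "1 / (1 + norm x) ^ (2 * DIM('b)) \<le> cauchy_weight x"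
proof -
  have "(\<Prod>b\<in>(Basis :: 'b set). 1 / ((1 + norm x)\<^sup>2)) \<le> cauchy_weight x"
    unfolding cauchy_weight_def
  proof (rule prod_mono)
    fix b :: 'b assume b: "b \<in> Basis"
    have "(x \<bullet> b)\<^sup>2 \<le> (norm x)\<^sup>2"
      using Basis_le_norm[OF b, of x] by (intro abs_le_square_iff[THEN iffD1]) auto
    then have "1 + (x \<bullet> b)\<^sup>2 \<le> (1 + norm x)\<^sup>2" using norm_ge_zero[of x] by (simp add: power2_sum del: norm_ge_zero)
    then show "0 \<le> 1 / ((1 + norm x)\<^sup>2) \<and> 1 / ((1 + norm x)\<^sup>2) \<le> 1 / (1 + (x \<bullet> b)\<^sup>2)"
      by (auto intro!: divide_left_mono mult_pos_pos add_pos_nonneg zero_less_power)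
  qed
  then show ?thesis by (simp add: power_mult power_divide)
qed

text \<open>If r is the largest modulus of a coordinate, every factor 1 + (x . b)^2 is at most 2
  max(1, r^2), so the whole product is controlled by a power of one coordinate. Hence repeated
  derivatives in a single direction suffice for decay in all directions.\<close>

lemma coordinate_powers_le_cauchy_weight:
  fixes x :: "'b::euclidean_space"
  assumes w: "w \<ge> 0" "w \<le> K" "\<And>b. b \<in> Basis \<Longrightarrow> \<bar>x \<bullet> b\<bar> ^ (2 * DIM('b)) * w \<le> K"
  shows "w \<le> 2 ^ DIM('b) * K * cauchy_weight x"
proof -
  obtain b0 :: 'b where b0: "b0 \<in> Basis" "\<And>b. b \<in> Basis \<Longrightarrow> \<bar>x \<bullet> b\<bar> \<le> \<bar>x \<bullet> b0\<bar>"
  proof -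
    have fin: "finite ((\<lambda>b. \<bar>x \<bullet> b\<bar>) ` (Basis :: 'b set))" "(\<lambda>b. \<bar>x \<bullet> b\<bar>) ` (Basis :: 'b set) \<noteq> {}" by auto
    from Max_in[OF fin] obtain b where "Max ((\<lambda>b. \<bar>x \<bullet> b\<bar>) ` Basis) = \<bar>x \<bullet> b\<bar>" "b \<in> Basis"
      by (rule imageE)
    with Max_ge[OF fin(1)] that show thesis by fastforce
  qed
  define r where "r = \<bar>x \<bullet> b0\<bar>"
  have prod_eq: "cauchy_weight x = 1 / (\<Prod>b\<in>(Basis :: 'b set). 1 + (x \<bullet> b)\<^sup>2)"
    unfolding cauchy_weight_def by (simp add: prod_dividef)
  have ppos: "(\<Prod>b\<in>(Basis :: 'b set). 1 + (x \<bullet> b)\<^sup>2) > 0"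
    by (intro prod_pos) (auto simp: add_pos_nonneg)
  have "(\<Prod>b\<in>(Basis :: 'b set). 1 + (x \<bullet> b)\<^sup>2) \<le> (\<Prod>b\<in>(Basis :: 'b set). 2 * max 1 (r\<^sup>2))"
  proof (rule prod_mono)
    fix b :: 'b assume "b \<in> Basis"
    then have "(x \<bullet> b)\<^sup>2 \<le> r\<^sup>2"
      unfolding r_def using b0(2) by (intro abs_le_square_iff[THEN iffD1]) auto
    then show "0 \<le> 1 + (x \<bullet> b)\<^sup>2 \<and> 1 + (x \<bullet> b)\<^sup>2 \<le> 2 * max 1 (r\<^sup>2)" by (auto simp: max_def)
  qed
  also have "\<dots> = 2 ^ DIM('b) * (max 1 (r\<^sup>2)) ^ DIM('b)" by (simp add: power_mult_distrib)
  also have "\<dots> * w \<le> 2 ^ DIM('b) * K"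
  proof -
    have "(max 1 (r\<^sup>2)) ^ DIM('b) * w \<le> K"
    proof (cases "r\<^sup>2 \<le> 1")
      case True then show ?thesis using w(2) by (simp add: max_def)
    next
      case False
      then have "(max 1 (r\<^sup>2)) ^ DIM('b) = r ^ (2 * DIM('b))" by (simp add: max_def power_mult)
      then show ?thesis using w(3)[OF b0(1)] by (simp add: r_def)
    qed
    then show ?thesis by simp
  qed
  finally have "(\<Prod>b\<in>(Basis :: 'b set). 1 + (x \<bullet> b)\<^sup>2) * w \<le> 2 ^ DIM('b) * K"
    using w(1) by (simp add: mult_right_mono)
  then show ?thesis unfolding prod_eq using ppos by (simp add: pos_le_divide_eq mult.commute)
qed

text \<open>The short-time Fourier transform with Gaussian window. It is stated on any Euclidean
  space because it is applied on R^n, against coherent states, and on R^n x R^n, in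
  \<open>cross_pairing\<close>.\<close>

definition gabor_transform :: "('b::euclidean_space \<Rightarrow> complex) \<Rightarrow> 'b \<Rightarrow> 'b \<Rightarrow> complex" where
  "gabor_transform f y \<eta> = (\<integral>t. f t * cgauss (1/2) (t - y) (- (t \<bullet> \<eta>)) \<partial>lborel)"

text \<open>The shift t = y + s turns the transform into a window transform with k = 0, up to a
  factor of modulus one. Decay in y comes from the weight carried along in
  \<open>window_transform_decay\<close>, decay in \<eta> from the exponents m = 0 and m = 2 d for
  each coordinate, with d the dimension.\<close>

lemma gabor_transform_decay:
  "\<exists>C\<ge>0. \<forall>f :: 'b::euclidean_space \<Rightarrow> complex. schwartz f \<longrightarrow>
     (\<forall>y \<eta>. norm (gabor_transform f y \<eta>) \<le> C * schwartz_seminorm (2 * DIM('b)) f * (cauchy_weight y * cauchy_weight \<eta>))"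
proof -
  let ?N = "2 * DIM('b)"
  have "\<forall>e\<in>Basis. \<forall>m. \<exists>C\<ge>0. \<forall>f :: 'b \<Rightarrow> complex. \<forall>D. schwartz f \<longrightarrow>
      (\<forall>i\<le>m. \<forall>x. (1 + norm x) ^ ?N * norm (iterated_deriv (replicate i e) f x) \<le> D) \<longrightarrow>
      (\<forall>y \<eta>. (1 + norm y) ^ ?N * (\<bar>\<eta> \<bullet> e\<bar> ^ m * norm (window_transform e 0 f y \<eta>)) \<le> C * D)"
    using window_transform_decay by blast
  then obtain C where C: "\<And>e m. e \<in> Basis \<Longrightarrow> C e m \<ge> 0"
    and bound: "\<And>e m (f :: 'b \<Rightarrow> complex) D y \<eta>. e \<in> Basis \<Longrightarrow> schwartz f \<Longrightarrow>
      (\<forall>i\<le>m. \<forall>x. (1 + norm x) ^ ?N * norm (iterated_deriv (replicate i e) f x) \<le> D) \<Longrightarrow>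
      (1 + norm y) ^ ?N * (\<bar>\<eta> \<bullet> e\<bar> ^ m * norm (window_transform e 0 f y \<eta>)) \<le> C e m * D"
    by metis
  \<comment> \<open>One constant that dominates those of all directions and of both
    exponents.\<close>
  define K where "K = (\<Sum>e\<in>(Basis :: 'b set). C e 0 + C e ?N)"
  have K0: "K \<ge> 0" unfolding K_def using C by (intro sum_nonneg) auto
  have K: "C e 0 \<le> K" "C e ?N \<le> K" if "e \<in> Basis" for e
  proof -
    have "C e 0 + C e ?N \<le> K" unfolding K_def
      by (rule member_le_sum[where f="\<lambda>e. C e 0 + C e ?N"]) (use that C in auto)
    then show "C e 0 \<le> K" "C e ?N \<le> K" using C[OF that] by (smt (verit))+
  qed
  have "norm (gabor_transform f y \<eta>) \<le> 2 ^ DIM('b) * K * schwartz_seminorm ?N f * (cauchy_weight y * cauchy_weight \<eta>)"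
    if f: "schwartz f" for f :: "'b \<Rightarrow> complex" and y \<eta>
  proof -
    note [measurable] = schwartz_measurable[OF f]
    define S where "S = schwartz_seminorm ?N f"
    have S0: "S \<ge> 0" unfolding S_def by (rule schwartz_seminorm_nonneg[OF f])
    define w where "w = norm (gabor_transform f y \<eta>)"
    have wt: "norm (window_transform e 0 f y \<eta>) = w" for e
    proof -
      have "gabor_transform f y \<eta> = (\<integral>s. f (y + s) * cgauss (1/2) (y + s - y) (- ((y + s) \<bullet> \<eta>)) \<partial>lborel)"
        unfolding gabor_transform_def by (subst integral_lborel_affine[of 1 _ y]) simp_all
      also have "\<dots> = (\<integral>s. gexp 0 (- (y \<bullet> \<eta>)) * (f (y + s) * (of_real (s \<bullet> e) ^ 0 * cgauss (1/2) s (- (s \<bullet> \<eta>)))) \<partial>lborel)"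
      proof (rule Bochner_Integration.integral_cong[OF refl])
        fix s
        have "cgauss (1/2) (y + s - y) (- ((y + s) \<bullet> \<eta>)) =
            gexp 0 (- (y \<bullet> \<eta>)) * cgauss (1/2) s (- (s \<bullet> \<eta>))"
          unfolding gexp_mult by (simp add: inner_simps)
        then show "f (y + s) * cgauss (1/2) (y + s - y) (- ((y + s) \<bullet> \<eta>)) =
            gexp 0 (- (y \<bullet> \<eta>)) * (f (y + s) * (of_real (s \<bullet> e) ^ 0 * cgauss (1/2) s (- (s \<bullet> \<eta>))))"
          by (simp only: power_0 mult_1_left mult_ac)
      qed
      also have "\<dots> = gexp 0 (- (y \<bullet> \<eta>)) * window_transform e 0 f y \<eta>"
        unfolding window_transform_def integral_mult_right_zero ..
      finally show ?thesis unfolding w_def by (simp add: norm_mult)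
    qed
    have bound': "(1 + norm y) ^ ?N * (\<bar>\<eta> \<bullet> e\<bar> ^ m * w) \<le> K * S" if e: "e \<in> Basis" and m: "m = 0 \<or> m = ?N" for e m
    proof -
      have "replicate i e \<in> lists Basis" for i using e by (induction i) auto
      then have "(1 + norm y) ^ ?N * (\<bar>\<eta> \<bullet> e\<bar> ^ m * norm (window_transform e 0 f y \<eta>)) \<le> C e m * S"
        unfolding S_def using m by (intro bound[OF e f] allI impI schwartz_le_seminorm[OF f]) auto
      also have "\<dots> \<le> K * S" using K[OF e] m S0 by (intro mult_right_mono) auto
      finally show ?thesis unfolding wt .
    qed
    let ?Y = "(1 + norm y) ^ ?N"
    have Y: "?Y > 0" by (intro zero_less_power add_pos_nonneg) auto
    obtain e :: 'b where e: "e \<in> Basis" using nonempty_Basis by blast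
    have "w \<le> 2 ^ DIM('b) * (K * S / ?Y) * cauchy_weight \<eta>"
    proof (rule coordinate_powers_le_cauchy_weight)
      show "w \<ge> 0" unfolding w_def by simp
      show "w \<le> K * S / ?Y" using bound'[OF e, of 0] Y by (simp add: pos_le_divide_eq mult.commute)
      show "\<bar>\<eta> \<bullet> b\<bar> ^ ?N * w \<le> K * S / ?Y" if "b \<in> Basis" for b
        using bound'[OF that, of ?N] Y by (simp add: pos_le_divide_eq mult.commute)
    qed
    also have "\<dots> = 2 ^ DIM('b) * K * S * cauchy_weight \<eta> * (1 / ?Y)" by simp
    also have "\<dots> \<le> 2 ^ DIM('b) * K * S * cauchy_weight \<eta> * cauchy_weight y"
      by (intro mult_left_mono power_le_cauchy_weight mult_nonneg_nonneg K0 S0 less_imp_le[OF cauchy_weight_pos]) auto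
    finally show ?thesis unfolding w_def S_def by (simp only: mult_ac)
  qed
  then show ?thesis using K0 by (intro exI[of _ "2 ^ DIM('b) * K"]) auto
qed

lemma schwartz_le_cauchy_weight:
  assumes "schwartz (f :: 'b::euclidean_space \<Rightarrow> complex)"
  shows "norm (f x) \<le> schwartz_seminorm (2 * DIM('b)) f * cauchy_weight x"
proof -
  let ?Y = "(1 + norm x) ^ (2 * DIM('b))"
  have Y: "?Y > 0" by (intro zero_less_power add_pos_nonneg) auto
  have "norm (f x) \<le> schwartz_seminorm (2 * DIM('b)) f * (1 / ?Y)"
    using schwartz_le_seminorm[OF assms lists.Nil, of "2 * DIM('b)" x] Y by (simp add: pos_le_divide_eq mult.commute)
  also have "\<dots> \<le> schwartz_seminorm (2 * DIM('b)) f * cauchy_weight x"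
    by (intro mult_left_mono power_le_cauchy_weight schwartz_seminorm_nonneg assms)
  finally show ?thesis .
qed

lemma cauchy_weight_le_1: "cauchy_weight x \<le> 1"
  unfolding cauchy_weight_def by (intro prod_le_1) (auto simp: divide_le_eq_1 add_pos_nonneg)

lemma schwartz_integrable:
  assumes f: "schwartz (f :: 'b::euclidean_space \<Rightarrow> complex)"
  shows "integrable lborel f" and "square_integrable f"
    and "(\<integral>x. norm (f x) \<partial>lborel) \<le> integral\<^sup>L lborel (cauchy_weight :: 'b \<Rightarrow> real) * schwartz_seminorm (2 * DIM('b)) f"
proof -
  note [measurable] = schwartz_measurable[OF f]
  define S where "S = schwartz_seminorm (2 * DIM('b)) f"
  have S0: "S \<ge> 0" unfolding S_def by (rule schwartz_seminorm_nonneg[OF f])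
  have le: "norm (f x) \<le> S * cauchy_weight x" for x
    unfolding S_def by (rule schwartz_le_cauchy_weight[OF f])
  have i: "integrable lborel (\<lambda>x::'b. S * cauchy_weight x)"
    by (intro integrable_mult_right integrable_cauchy_weight)
  show int: "integrable lborel f"
    by (rule integrable_lborel_bound[OF i _ le]) measurable
  have "integrable lborel (\<lambda>x. (norm (f x))\<^sup>2)"
  proof (rule integrable_lborel_bound)
    show "norm ((norm (f x))\<^sup>2) \<le> S * (S * cauchy_weight x)" for x
    proof -
      have "norm (f x) \<le> S * 1"
        by (rule order_trans[OF le]) (intro mult_left_mono cauchy_weight_le_1 S0)
      then show ?thesis
        using le[of x] S0 by (simp add: power2_eq_square mult_mono)
    qed
    show "integrable lborel (\<lambda>x::'b. S * (S * cauchy_weight x))" using i by simp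
  qed simp
  then show "square_integrable f" unfolding square_integrable_def by simp
  have "(\<integral>x. norm (f x) \<partial>lborel) \<le> (\<integral>x. S * cauchy_weight x \<partial>(lborel :: 'b measure))"
    by (intro integral_mono integrable_norm int i le)
  then show "(\<integral>x. norm (f x) \<partial>lborel) \<le> integral\<^sup>L lborel (cauchy_weight :: 'b \<Rightarrow> real) * S"
    by (simp add: mult.commute)
qed

section \<open>The kernel of $A$ and its Weyl symbol\<close>

lemma gabor_transform_coherent:
  fixes f :: "real^'n \<Rightarrow> complex"
  shows "L2_inner f (coherent_state P) =
      of_real (cs_const CARD('n)) * gexp 0 (fst P \<bullet> snd P / 2) * gabor_transform f (fst P) (snd P)"
    and "(\<integral>u. f u * coherent_state P u \<partial>lborel) =
      of_real (cs_const CARD('n)) * gexp 0 (- (fst P \<bullet> snd P / 2)) * gabor_transform f (fst P) (- snd P)"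
proof -
  have split: "gexp (- (norm (u - fst P))\<^sup>2 / 2) (s + r) = gexp 0 s * cgauss (1/2) (u - fst P) r" for u s r
    by (simp add: gexp_mult)
  have 1: "f u * cnj (coherent_state P u) = of_real (cs_const CARD('n)) * gexp 0 (fst P \<bullet> snd P / 2) *
      (f u * cgauss (1/2) (u - fst P) (- (u \<bullet> snd P)))" for u
    using split[of u "fst P \<bullet> snd P / 2" "- (u \<bullet> snd P)"] by (simp add: coherent_state_gexp)
  have 2: "f u * coherent_state P u = of_real (cs_const CARD('n)) * gexp 0 (- (fst P \<bullet> snd P / 2)) *
      (f u * cgauss (1/2) (u - fst P) (- (u \<bullet> - snd P)))" for u
    using split[of u "- (fst P \<bullet> snd P / 2)" "u \<bullet> snd P"] by (simp add: coherent_state_gexp)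
  show "L2_inner f (coherent_state P) =
      of_real (cs_const CARD('n)) * gexp 0 (fst P \<bullet> snd P / 2) * gabor_transform f (fst P) (snd P)"
    unfolding L2_inner_def gabor_transform_def 1 integral_mult_right_zero ..
  show "(\<integral>u. f u * coherent_state P u \<partial>lborel) =
      of_real (cs_const CARD('n)) * gexp 0 (- (fst P \<bullet> snd P / 2)) * gabor_transform f (fst P) (- snd P)"
    unfolding gabor_transform_def 2 integral_mult_right_zero ..
qed

lemma coherent_transform_measurable:
  fixes f :: "real^'n \<Rightarrow> complex"
  assumes [measurable]: "f \<in> borel_measurable borel"
  shows "(\<lambda>P. L2_inner f (coherent_state P)) \<in> borel_measurable borel"
  unfolding L2_inner_def by measurable

lemma cauchy_weight_phase_space: "cauchy_weight P = cauchy_weight (fst P) * cauchy_weight (snd P)"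
  using cauchy_weight_Pair[of "fst P" "snd P"] by simp

text \<open>The conjugate occurs because kernels pair bilinearly while the inner product is
  sesquilinear: testing A \<phi> against \<psi> is <A \<phi>, conj \<psi>>. Its transform is a Gabor
  transform of f at the reflected frequency, where the weight has the same value.\<close>

lemma schwartz_admissible:
  fixes f :: "real^'n \<Rightarrow> complex"
  assumes f: "schwartz f"
  shows "coherent_admissible f" and "coherent_admissible (\<lambda>u. cnj (f u))"
proof -
  note [measurable] = schwartz_measurable[OF f]
  define S where "S = schwartz_seminorm (2 * DIM(real^'n)) f"
  have S0: "S \<ge> 0" unfolding S_def by (rule schwartz_seminorm_nonneg[OF f])
  obtain C where C: "C \<ge> 0"
    "\<And>y \<eta>. norm (gabor_transform f y \<eta>) \<le> C * S * (cauchy_weight y * cauchy_weight \<eta>)"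
    using gabor_transform_decay[where 'b="real^'n"] f unfolding S_def by blast
  have bd: "norm (f u) \<le> S" for u
    using order_trans[OF schwartz_le_cauchy_weight[OF f] mult_left_mono[OF cauchy_weight_le_1 S0[unfolded S_def]]]
    unfolding S_def by simp
  have i: "integrable lborel (\<lambda>P :: (real^'n) \<times> (real^'n). cs_const CARD('n) * (C * S * cauchy_weight P))"
    by (intro integrable_mult_right integrable_cauchy_weight)
  have n1: "norm (L2_inner f (coherent_state P)) \<le> cs_const CARD('n) * (C * S * cauchy_weight P)" for P
    unfolding gabor_transform_coherent norm_mult norm_gexp cauchy_weight_phase_space
    using C(2)[of "fst P" "snd P"] cs_const_pos[of "CARD('n)"] by simp
  have eq: "L2_inner (\<lambda>u. cnj (f u)) (coherent_state P) = cnj (\<integral>u. f u * coherent_state P u \<partial>lborel)" for P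
    unfolding L2_inner_def by (subst Bochner_Integration.integral_cnj[symmetric]) simp
  have n2: "norm (L2_inner (\<lambda>u. cnj (f u)) (coherent_state P)) \<le> cs_const CARD('n) * (C * S * cauchy_weight P)" for P
    unfolding eq gabor_transform_coherent norm_mult norm_gexp complex_mod_cnj cauchy_weight_phase_space
    using C(2)[of "fst P" "- snd P"] cs_const_pos[of "CARD('n)"] by simp
  show "coherent_admissible f"
    unfolding coherent_admissible_def
  proof (intro conjI)
    show "integrable lborel (\<lambda>P. L2_inner f (coherent_state P))"
      by (rule integrable_lborel_bound[OF i _ n1]) (simp add: coherent_transform_measurable)
  qed (use bd in \<open>auto intro: schwartz_integrable[OF f] schwartz_continuous[OF f]\<close>)
  show "coherent_admissible (\<lambda>u. cnj (f u))"
    unfolding coherent_admissible_def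
  proof (intro conjI)
    show "integrable lborel (\<lambda>P. L2_inner (\<lambda>u. cnj (f u)) (coherent_state P))"
      by (rule integrable_lborel_bound[OF i _ n2]) (simp add: coherent_transform_measurable)
    show "square_integrable (\<lambda>u. cnj (f u))"
      using schwartz_integrable(2)[OF f] by (simp add: square_integrable_def)
    show "continuous_on UNIV (\<lambda>u. cnj (f u))" by (intro continuous_intros schwartz_continuous f)
  qed (use bd in auto)
qed

section \<open>Test functions paired with rank one kernels\<close>

text \<open>The factor next to \<Theta> is the integral kernel of f |-> <f, \<Psi>_P> \<Psi>_Q, with
  output variable \<open>fst z\<close> and input variable \<open>snd z\<close>.\<close>

definition cross_pairing ::
    "((real^'n) \<times> (real^'n) \<Rightarrow> complex) \<Rightarrow> (real^'n) \<times> (real^'n) \<Rightarrow> (real^'n) \<times> (real^'n) \<Rightarrow> complex" where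
  "cross_pairing \<Theta> P Q = (\<integral>z. \<Theta> z * (coherent_state Q (fst z) * cnj (coherent_state P (snd z))) \<partial>lborel)"

lemma cross_pairing_measurable [measurable]:
  assumes [measurable]: "\<Theta> \<in> borel_measurable borel"
  shows "(\<lambda>p. cross_pairing \<Theta> (fst p) (snd p :: (real^'n) \<times> (real^'n))) \<in> borel_measurable borel"
  unfolding cross_pairing_def by measurable

lemma norm_coherent_product:
  fixes P Q :: "(real^'n) \<times> (real^'n)"
  shows "norm (coherent_state Q x * cnj (coherent_state P y)) \<le> cs_const CARD('n) * cs_const CARD('n)"
  unfolding norm_mult complex_mod_cnj using cs_const_pos[of "CARD('n)"]
  by (intro mult_mono norm_coherent_state_le) auto

text \<open>The product of the two coherent states is, up to constant and phase, a Gaussian wave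
  packet on the doubled space at position (fst Q, fst P); one Gabor transform in dimension 2n
  therefore controls P and Q together.\<close>

lemma norm_cross_pairing:
  "norm (cross_pairing \<Theta> P (Q :: (real^'n) \<times> (real^'n))) =
    cs_const CARD('n) * cs_const CARD('n) * norm (gabor_transform \<Theta> (fst Q, fst P) (- snd Q, snd P))"
proof -
  let ?c = "of_real (cs_const CARD('n)) :: complex"
  let ?s = "- (fst Q \<bullet> snd Q / 2) + fst P \<bullet> snd P / 2"
  have "\<Theta> z * (coherent_state Q (fst z) * cnj (coherent_state P (snd z))) =
    ?c * ?c * gexp 0 ?s *
      (\<Theta> z * cgauss (1/2) (z - (fst Q, fst P)) (- (z \<bullet> (- snd Q, snd P))))" for z
  proof -
    have r: "- (norm (fst z - fst Q))\<^sup>2 / 2 + - (norm (snd z - fst P))\<^sup>2 / 2 = 0 + - (1/2) * (norm (z - (fst Q, fst P)))\<^sup>2"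
      by (simp add: norm_prod_sq add_divide_distrib)
    have s: "fst z \<bullet> snd Q - fst Q \<bullet> snd Q / 2 + - (snd z \<bullet> snd P - fst P \<bullet> snd P / 2) =
        ?s + - (z \<bullet> (- snd Q, snd P))"
      by (simp add: inner_prod_def)
    have "coherent_state Q (fst z) * cnj (coherent_state P (snd z)) = ?c * ?c *
        (gexp (- (norm (fst z - fst Q))\<^sup>2 / 2) (fst z \<bullet> snd Q - fst Q \<bullet> snd Q / 2) *
         gexp (- (norm (snd z - fst P))\<^sup>2 / 2) (- (snd z \<bullet> snd P - fst P \<bullet> snd P / 2)))"
      by (simp add: coherent_state_gexp)
    also have "\<dots> = ?c * ?c * (gexp 0 ?s * cgauss (1/2) (z - (fst Q, fst P)) (- (z \<bullet> (- snd Q, snd P))))"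
      unfolding gexp_mult r s ..
    finally show ?thesis by (simp only: mult_ac)
  qed
  then have "cross_pairing \<Theta> P Q = ?c * ?c * gexp 0 ?s * gabor_transform \<Theta> (fst Q, fst P) (- snd Q, snd P)"
    unfolding cross_pairing_def gabor_transform_def integral_mult_right_zero[symmetric] by (simp only:)
  then show ?thesis using cs_const_pos[of "CARD('n)"] by (simp add: norm_mult)
qed

text \<open>The decay estimate yields weights in the positions and in the frequencies of the pair;
  multiplicativity and evenness of the weight regroup them into one for P and one for Q.\<close>

lemma cross_pairing_bound:
  "\<exists>M\<ge>0. \<forall>\<Theta> :: (real^'n) \<times> (real^'n) \<Rightarrow> complex. schwartz \<Theta> \<longrightarrow> (\<forall>P Q. norm (cross_pairing \<Theta> P Q) \<le>
     M * schwartz_seminorm (2 * DIM((real^'n) \<times> (real^'n))) \<Theta> * (cauchy_weight P * cauchy_weight Q))"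
proof -
  let ?N = "2 * DIM((real^'n) \<times> (real^'n))"
  let ?c = "cs_const CARD('n) * cs_const CARD('n)"
  obtain C where C: "C \<ge> 0" "\<And>f :: (real^'n) \<times> (real^'n) \<Rightarrow> complex. schwartz f \<Longrightarrow>
     (\<forall>y \<eta>. norm (gabor_transform f y \<eta>) \<le> C * schwartz_seminorm ?N f * (cauchy_weight y * cauchy_weight \<eta>))"
    using gabor_transform_decay[where 'b="(real^'n) \<times> (real^'n)"] by blast
  have c0: "?c \<ge> 0" using cs_const_pos[of "CARD('n)"] by simp
  have "norm (cross_pairing \<Theta> P Q) \<le> ?c * C * schwartz_seminorm ?N \<Theta> * (cauchy_weight P * cauchy_weight Q)"
    if "schwartz \<Theta>" for \<Theta> :: "(real^'n) \<times> (real^'n) \<Rightarrow> complex" and P Q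
  proof -
    have "norm (cross_pairing \<Theta> P Q) \<le> ?c * (C * schwartz_seminorm ?N \<Theta> *
        (cauchy_weight (fst Q, fst P) * cauchy_weight (- snd Q, snd P)))"
      unfolding norm_cross_pairing by (intro mult_left_mono C(2)[OF that, rule_format] c0)
    also have "\<dots> = ?c * C * schwartz_seminorm ?N \<Theta> * (cauchy_weight P * cauchy_weight Q)"
      unfolding cauchy_weight_Pair cauchy_weight_phase_space[of P] cauchy_weight_phase_space[of Q] cauchy_weight_minus
      by (simp only: mult_ac)
    finally show ?thesis .
  qed
  then show ?thesis using C(1) c0 by (intro exI[of _ "?c * C"]) auto
qed

lemma cross_pairing_integrable:
  fixes P Q :: "(real^'n) \<times> (real^'n)"
  assumes "schwartz \<Theta>"
  shows "integrable lborel (\<lambda>z. \<Theta> z * (coherent_state Q (fst z) * cnj (coherent_state P (snd z))))"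
proof -
  note [measurable] = schwartz_measurable[OF assms]
  let ?c = "cs_const CARD('n) * cs_const CARD('n)"
  have i: "integrable lborel (\<lambda>z. norm (\<Theta> z) * ?c)" using schwartz_integrable(1)[OF assms] by simp
  show ?thesis
  proof (rule integrable_lborel_bound[OF i])
    show "norm (\<Theta> z * (coherent_state Q (fst z) * cnj (coherent_state P (snd z)))) \<le> norm (\<Theta> z) * ?c" for z
      unfolding norm_mult[of "\<Theta> z"] by (intro mult_left_mono norm_coherent_product) simp
  qed measurable
qed

lemma integral_midpoint:
  fixes f :: "'a::euclidean_space \<times> 'a \<Rightarrow> 'b::{banach,second_countable_topology}"
  assumes "f \<in> borel_measurable borel"
  shows "(\<integral>p. f p \<partial>lborel) = (\<integral>(x, v). f (x + (1/2) *\<^sub>R v, x - (1/2) *\<^sub>R v) \<partial>lborel)"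
proof -
  note T = midpoint_map_measurable[where 'a='a]
  show ?thesis
    using T assms by (subst lborel_distr_midpoint[symmetric]) (simp add: integral_distr case_prod_unfold)
qed

text \<open>This identifies \<open>cross_symbol\<close> as a Weyl symbol. Completing the square
  gives |x-(p+q)/2|^2 + |v-(q-p)|^2 / 4; the Fourier transform in v adds the frequency part of the
  phase-space Gaussian, and 2^n is (4 pi)^(n/2) times pi^(-n/2). The first part is a majorant
  uniform in x.\<close>

lemma cross_symbol_fourier:
  fixes P Q :: "(real^'n) \<times> (real^'n)"
  defines "k \<equiv> \<lambda>x v. coherent_state Q (x + (1/2) *\<^sub>R v) * cnj (coherent_state P (x - (1/2) *\<^sub>R v))"
  shows "norm (k x v) \<le> cs_const CARD('n) * cs_const CARD('n) * gauss (1/4) (v - (fst Q - fst P))"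
    and "(\<integral>v. gexp 0 (- (v \<bullet> \<xi>)) * k x v \<partial>lborel) = cross_symbol P Q (x, \<xi>)"
proof -
  obtain p p' q q' where PQ: "P = (p, p')" "Q = (q, q')" by (cases P, cases Q)
  let ?c = "of_real (cs_const CARD('n)) :: complex"
  let ?s = "x \<bullet> (q' - p') - q \<bullet> q' / 2 + p \<bullet> p' / 2"
  let ?w = "\<lambda>\<xi>. (1/2) *\<^sub>R (p' + q') - \<xi>"
  have k: "gexp 0 (- (v \<bullet> \<xi>)) * k x v = ?c * ?c * cgauss 1 (x - (1/2) *\<^sub>R (p + q)) ?s *
      cgauss (1/4) (v - (q - p)) (v \<bullet> ?w \<xi>)" for v \<xi>
  proof -
    have r: "0 + (- (norm (x + (1/2) *\<^sub>R v - q))\<^sup>2 / 2 + - (norm (x - (1/2) *\<^sub>R v - p))\<^sup>2 / 2) =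
       - 1 * (norm (x - (1/2) *\<^sub>R (p + q)))\<^sup>2 + - (1/4) * (norm (v - (q - p)))\<^sup>2"
      unfolding power2_norm_eq_inner by (simp add: inner_simps inner_commute field_simps)
    have s: "- (v \<bullet> \<xi>) + ((x + (1/2) *\<^sub>R v) \<bullet> q' - q \<bullet> q' / 2 + - ((x - (1/2) *\<^sub>R v) \<bullet> p' - p \<bullet> p' / 2)) =
        ?s + v \<bullet> ?w \<xi>"
      by (simp add: inner_simps inner_commute field_simps)
    have "gexp 0 (- (v \<bullet> \<xi>)) * k x v = ?c * ?c * (gexp 0 (- (v \<bullet> \<xi>)) *
        (gexp (- (norm (x + (1/2) *\<^sub>R v - q))\<^sup>2 / 2) ((x + (1/2) *\<^sub>R v) \<bullet> q' - q \<bullet> q' / 2) *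
         gexp (- (norm (x - (1/2) *\<^sub>R v - p))\<^sup>2 / 2) (- ((x - (1/2) *\<^sub>R v) \<bullet> p' - p \<bullet> p' / 2))))"
      by (simp add: k_def coherent_state_gexp PQ)
    also have "\<dots> = ?c * ?c * (cgauss 1 (x - (1/2) *\<^sub>R (p + q)) ?s *
      cgauss (1/4) (v - (q - p)) (v \<bullet> ?w \<xi>))"
      unfolding gexp_mult r s ..
    finally show ?thesis by (simp only: mult.assoc)
  qed
  have "norm (k x v) = norm (gexp 0 (- (v \<bullet> 0)) * k x v)" by (simp add: norm_mult)
  also have "\<dots> = cs_const CARD('n) * cs_const CARD('n) * gauss 1 (x - (1/2) *\<^sub>R (p + q)) *
      gauss (1/4) (v - (q - p))"
    unfolding k norm_mult norm_gexp norm_of_real using cs_const_pos[of "CARD('n)"] by simp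
  also have "\<dots> \<le> cs_const CARD('n) * cs_const CARD('n) * 1 * gauss (1/4) (v - (q - p))"
    using cs_const_pos[of "CARD('n)"] by (intro mult_right_mono mult_left_mono) auto
  finally show "norm (k x v) \<le> cs_const CARD('n) * cs_const CARD('n) * gauss (1/4) (v - (fst Q - fst P))"
    by (simp add: PQ)
  have "(\<integral>v. gexp 0 (- (v \<bullet> \<xi>)) * k x v \<partial>lborel) = ?c * ?c * cgauss 1 (x - (1/2) *\<^sub>R (p + q)) ?s *
      (of_real (sqrt (pi / (1/4)) ^ CARD('n)) * gexp (- (norm (?w \<xi>))\<^sup>2 / (4 * (1/4))) ((q - p) \<bullet> ?w \<xi>))"
    unfolding k integral_mult_right_zero by (subst integral_gexp(2)) auto
  also have "\<dots> = of_real (cs_const CARD('n) * cs_const CARD('n) * sqrt (pi / (1/4)) ^ CARD('n)) *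
      (cgauss 1 (x - (1/2) *\<^sub>R (p + q)) ?s * gexp (- (norm (?w \<xi>))\<^sup>2 / (4 * (1/4))) ((q - p) \<bullet> ?w \<xi>))"
    by (simp only: of_real_mult mult_ac)
  also have "cs_const CARD('n) * cs_const CARD('n) * sqrt (pi / (1/4)) ^ CARD('n) = 2 ^ CARD('n)"
  proof -
    have "sqrt (pi / (1/4)) = 2 * sqrt pi" by (simp add: real_sqrt_mult mult.commute)
    then have "cs_const CARD('n) * cs_const CARD('n) * sqrt (pi / (1/4)) ^ CARD('n) =
        2 ^ CARD('n) * (cs_const CARD('n) * cs_const CARD('n) * sqrt pi ^ CARD('n))"
      by (simp only: power_mult_distrib mult_ac)
    then show ?thesis unfolding cs_const_sq by simp
  qed
  also have "cgauss 1 (x - (1/2) *\<^sub>R (p + q)) ?s * gexp (- (norm (?w \<xi>))\<^sup>2 / (4 * (1/4))) ((q - p) \<bullet> ?w \<xi>) =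
      cgauss 1 ((x, \<xi>) - (1/2) *\<^sub>R (P + Q)) (sympl (x, \<xi>) (P - Q) + sympl P Q / 2)"
  proof -
    have r: "- 1 * (norm (x - (1/2) *\<^sub>R (p + q)))\<^sup>2 + - (norm (?w \<xi>))\<^sup>2 / (4 * (1/4)) =
        - 1 * (norm ((x, \<xi>) - (1/2) *\<^sub>R (P + Q)))\<^sup>2"
      by (simp add: PQ norm_prod_sq norm_minus_commute)
    have s: "?s + (q - p) \<bullet> ?w \<xi> = sympl (x, \<xi>) (P - Q) + sympl P Q / 2"
      by (simp add: PQ sympl_def inner_simps inner_commute field_simps)
    show ?thesis unfolding gexp_mult r s ..
  qed
  finally show "(\<integral>v. gexp 0 (- (v \<bullet> \<xi>)) * k x v \<partial>lborel) = cross_symbol P Q (x, \<xi>)"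
    unfolding cross_symbol_def .
qed

text \<open>In midpoint coordinates Fubini transposes the partial Fourier transform from \<Phi> to
  the rank one kernel, where \<open>cross_symbol_fourier\<close> evaluates it. The transformed test
  function is handled through the integral formula directly.\<close>

lemma cross_pairing_fourier_snd:
  fixes P Q :: "(real^'n) \<times> (real^'n)"
  assumes \<Phi>: "schwartz \<Phi>"
  shows "(\<lambda>(y, z). fourier_snd \<Phi> ((1/2) *\<^sub>R (y + z), y - z :: real^'n)) \<in> borel_measurable borel"
    and "cross_pairing (\<lambda>(y, z). fourier_snd \<Phi> ((1/2) *\<^sub>R (y + z), y - z)) P Q =
      (\<integral>X. \<Phi> X * cross_symbol P Q X \<partial>lborel)"
proof -
  note [measurable] = schwartz_measurable[OF \<Phi>]
  let ?c = "cs_const CARD('n) * cs_const CARD('n)"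
  let ?E = "\<lambda>v. gauss (1/4) (v - (fst Q - fst P))"
  define k where "k x v = coherent_state Q (x + (1/2) *\<^sub>R v) * cnj (coherent_state P (x - (1/2) *\<^sub>R v))" for x v
  have k_norm: "norm (k x v) \<le> ?c * ?E v" for x v
    unfolding k_def by (rule cross_symbol_fourier(1))
  have k_int: "(\<integral>v. gexp 0 (- (v \<bullet> \<xi>)) * k x v \<partial>lborel) = cross_symbol P Q (x, \<xi>)" for x \<xi>
    unfolding k_def by (rule cross_symbol_fourier(2))
  have \<Phi>_pair[measurable]: "(\<lambda>x. \<Phi> (f x, g x)) \<in> borel_measurable M"
    if "f \<in> borel_measurable M" "g \<in> borel_measurable M" for f g and M :: "'z measure"
    using borel_measurable_continuous_Pair[OF that, of "\<lambda>x y. \<Phi> (x, y)"] schwartz_continuous[OF \<Phi>] by simp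
  have k_meas[measurable]: "(\<lambda>x. k (f x) (g x)) \<in> borel_measurable M"
    if [measurable]: "f \<in> borel_measurable M" "g \<in> borel_measurable M" for f g and M :: "'z measure"
    unfolding k_def by measurable
  have fourier: "fourier_snd \<Phi> (x, v) = (\<integral>\<xi>. gexp 0 (- (v \<bullet> \<xi>)) * \<Phi> (x, \<xi>) \<partial>lborel)" for x v
    by (simp add: fourier_snd_def gexp_def)
  have fourier_meas: "(\<lambda>z. fourier_snd \<Phi> (f z, g z)) \<in> borel_measurable borel"
    if [measurable]: "f \<in> borel_measurable borel" "g \<in> borel_measurable borel"
    for f g :: "(real^'n) \<times> (real^'n) \<Rightarrow> real^'n"
  proof -
    have "(\<lambda>(z, \<xi>). \<Phi> (f z, \<xi>)) \<in> borel_measurable (borel \<Otimes>\<^sub>M borel)"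
      unfolding case_prod_unfold by (rule \<Phi>_pair) measurable
    then show ?thesis unfolding fourier by measurable
  qed
  have sub_meas: "(\<lambda>z. (1/2) *\<^sub>R (fst z + snd z)) \<in> borel_measurable (borel :: ((real^'n) \<times> (real^'n)) measure)"
    "(\<lambda>z. fst z - snd z) \<in> borel_measurable (borel :: ((real^'n) \<times> (real^'n)) measure)"
    by measurable
  show \<Theta>_meas: "(\<lambda>(y, z). fourier_snd \<Phi> ((1/2) *\<^sub>R (y + z), y - z :: real^'n)) \<in> borel_measurable borel"
    unfolding case_prod_unfold by (rule fourier_meas[OF sub_meas])
  have \<Phi>_int: "integrable lborel \<Phi>" by (rule schwartz_integrable(1)[OF \<Phi>])
  \<comment> \<open>The full integrand in (x, \<xi>) and v before either integration, dominated by
    |\<Phi>| times a Gaussian in v; \<open>g\<close> below is the result of integrating out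
    \<xi>.\<close>
  define G where "G X v = gexp 0 (- (v \<bullet> snd X)) * \<Phi> X * k (fst X) v" for X v
  have G_meas: "case_prod G \<in> borel_measurable borel"
    unfolding G_def case_prod_unfold by measurable
  have G_norm: "norm (G X v) \<le> norm (\<Phi> X) * (?c * ?E v)" for X v
    unfolding G_def norm_mult norm_gexp using k_norm[of "fst X" v] by (simp add: mult_left_mono)
  have E_int: "integrable lborel (\<lambda>v :: real^'n. ?c * ?E v)"
    by (intro integrable_mult_right integrable_gaussian) simp
  have G_int: "integrable lborel (case_prod G)"
    by (rule integrable_lborel_bound[OF integrable_lborel_product[OF integrable_norm[OF \<Phi>_int] E_int] G_meas])
      (use G_norm in \<open>simp only: case_prod_unfold\<close>)
  define g where "g x v = fourier_snd \<Phi> (x, v) * k x v" for x v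
  have g_eq: "g x v = (\<integral>\<xi>. G (x, \<xi>) v \<partial>lborel)" for x v
    unfolding g_def fourier G_def integral_mult_left_zero[symmetric] by simp
  have g_meas: "case_prod g \<in> borel_measurable borel"
    unfolding g_def case_prod_unfold by (intro borel_measurable_times fourier_meas k_meas) measurable
  \<comment> \<open>Dominated by the marginal of |\<Phi>| in x times the same Gaussian in v.\<close>
  have g_int: "integrable lborel (case_prod g)"
  proof -
    have \<Phi>1: "integrable lborel (\<lambda>x. \<integral>\<xi>. norm (\<Phi> (x, \<xi>)) \<partial>lborel)"
      using integrable_norm[OF \<Phi>_int] unfolding lborel_prod[symmetric] by (rule lborel_pair.integrable_fst')
    show ?thesis
    proof (rule integrable_lborel_bound[OF integrable_lborel_product[OF \<Phi>1 E_int] g_meas], unfold case_prod_unfold)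
      fix z :: "(real^'n) \<times> (real^'n)"
        have "norm (fourier_snd \<Phi> (fst z, snd z)) \<le> (\<integral>\<xi>. norm (gexp 0 (- (snd z \<bullet> \<xi>)) * \<Phi> (fst z, \<xi>)) \<partial>lborel)"
          unfolding fourier by (rule integral_norm_bound)
        also have "\<dots> = (\<integral>\<xi>. norm (\<Phi> (fst z, \<xi>)) \<partial>lborel)" by (simp add: norm_mult)
        finally show "norm (g (fst z) (snd z)) \<le> (\<integral>\<xi>. norm (\<Phi> (fst z, \<xi>)) \<partial>lborel) * (?c * ?E (snd z))"
          unfolding g_def norm_mult by (intro mult_mono k_norm) (auto intro: integral_nonneg_AE)
    qed
  qed
  have G_int_v: "integrable lborel (\<lambda>X. G X v)" for v
  proof (rule integrable_lborel_bound[OF _ _ G_norm])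
    show "integrable lborel (\<lambda>X. norm (\<Phi> X) * (?c * ?E v))" using \<Phi>_int by simp
    show "(\<lambda>X. G X v) \<in> borel_measurable borel" unfolding G_def by measurable
  qed
  have mid: "(1/2) *\<^sub>R (x + (1/2) *\<^sub>R v + (x - (1/2) *\<^sub>R v)) = x" "x + (1/2) *\<^sub>R v - (x - (1/2) *\<^sub>R v) = v" for x v :: "real^'n"
    by (auto simp: vec_eq_iff)
  have "cross_pairing (\<lambda>(y, z). fourier_snd \<Phi> ((1/2) *\<^sub>R (y + z), y - z)) P Q = integral\<^sup>L lborel (case_prod g)"
    unfolding cross_pairing_def g_def k_def
    by (subst integral_midpoint)
      (use \<Theta>_meas in \<open>auto simp: mid case_prod_unfold intro!: Bochner_Integration.integral_cong\<close>)
  also have "\<dots> = (\<integral>v. \<integral>x. g x v \<partial>lborel \<partial>lborel)"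
    using g_int unfolding lborel_prod[symmetric] by (rule lborel_pair.integral_snd[symmetric])
  also have "\<dots> = (\<integral>v. \<integral>X. G X v \<partial>lborel \<partial>lborel)"
    unfolding g_eq
  proof (rule Bochner_Integration.integral_cong[OF refl])
    fix v :: "real^'n"
    show "(\<integral>x. \<integral>\<xi>. G (x, \<xi>) v \<partial>lborel \<partial>lborel) = (\<integral>X. G X v \<partial>lborel)"
      using integral_lborel_fst[of "\<lambda>x \<xi>. G (x, \<xi>) v"] G_int_v[of v] by (simp add: case_prod_unfold)
  qed
  also have "\<dots> = (\<integral>X. \<integral>v. G X v \<partial>lborel \<partial>lborel)"
    using G_int lborel_prod[where 'a="(real^'n) \<times> (real^'n)" and 'b="real^'n", symmetric]
    by (intro lborel_pair.Fubini_integral) simp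
  also have "\<dots> = (\<integral>X. \<Phi> X * cross_symbol P Q X \<partial>lborel)"
  proof (rule Bochner_Integration.integral_cong[OF refl])
    fix X
    have "(\<integral>v. G X v \<partial>lborel) = (\<integral>v. \<Phi> X * (gexp 0 (- (v \<bullet> snd X)) * k (fst X) v) \<partial>lborel)"
      unfolding G_def by (simp only: mult_ac)
    then show "(\<integral>v. G X v \<partial>lborel) = \<Phi> X * cross_symbol P Q X"
      unfolding integral_mult_right_zero k_int by simp
  qed
  finally show "cross_pairing (\<lambda>(y, z). fourier_snd \<Phi> ((1/2) *\<^sub>R (y + z), y - z)) P Q =
      (\<integral>X. \<Phi> X * cross_symbol P Q X \<partial>lborel)" .
qed

lemma cross_pairing_tensor:
  fixes \<phi> \<psi> :: "real^'n \<Rightarrow> complex"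
  assumes \<phi>: "schwartz \<phi>" and \<psi>: "schwartz \<psi>"
  shows "cross_pairing (\<lambda>(x, y). \<psi> x * \<phi> y) P Q =
    L2_inner \<phi> (coherent_state P) * cnj (L2_inner (\<lambda>u. cnj (\<psi> u)) (coherent_state Q))"
proof -
  have i1: "integrable lborel (\<lambda>x. \<psi> x * coherent_state Q x)"
    using integrable_L2_product[OF schwartz_integrable(2)[OF \<psi>], of "\<lambda>x. cnj (coherent_state Q x)"]
      square_integrable_coherent_state[of Q] by (simp add: square_integrable_def)
  have i2: "integrable lborel (\<lambda>y. \<phi> y * cnj (coherent_state P y))"
    by (rule integrable_L2_product[OF schwartz_integrable(2)[OF \<phi>] square_integrable_coherent_state])
  have "cross_pairing (\<lambda>(x, y). \<psi> x * \<phi> y) P Q =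
      (\<integral>(x, y). (\<psi> x * coherent_state Q x) * (\<phi> y * cnj (coherent_state P y)) \<partial>lborel)"
    unfolding cross_pairing_def case_prod_unfold by (simp only: mult_ac)
  also have "\<dots> = (\<integral>x. \<psi> x * coherent_state Q x \<partial>lborel) * L2_inner \<phi> (coherent_state P)"
    unfolding L2_inner_def by (rule integral_lborel_product[OF i1 i2])
  also have "(\<integral>x. \<psi> x * coherent_state Q x \<partial>lborel) = cnj (L2_inner (\<lambda>u. cnj (\<psi> u)) (coherent_state Q))"
    unfolding L2_inner_def by (subst Bochner_Integration.integral_cnj[symmetric]) simp
  finally show ?thesis by (simp only: mult.commute)
qed

section \<open>The distributional kernel of A\<close>

context weyl_bounded
begin

definition kernel :: "((real^'n) \<times> (real^'n) \<Rightarrow> complex) \<Rightarrow> complex" where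
  "kernel \<Theta> = of_real (1 / (2 * pi) ^ (2 * CARD('n))) *
     (\<integral>p. H (fst p) (snd p) * cross_pairing \<Theta> (fst p) (snd p) \<partial>lborel)"

text \<open>\<open>H\<close> is bounded and the weights of \<open>cross_pairing_bound\<close> are
  integrable over P and Q. Integrability is stated along with the bound because additivity of
  \<open>kernel\<close> relies on it.\<close>

lemma kernel_bound:
  "\<exists>C\<ge>0. \<forall>\<Theta>. schwartz \<Theta> \<longrightarrow>
     integrable lborel (\<lambda>p. H (fst p) (snd p) * cross_pairing \<Theta> (fst p) (snd p)) \<and>
     norm (kernel \<Theta>) \<le> C * schwartz_seminorm (2 * DIM((real^'n) \<times> (real^'n))) \<Theta>"
proof -
  let ?N = "2 * DIM((real^'n) \<times> (real^'n))"
  obtain M where M: "M \<ge> 0" "\<And>\<Theta> :: (real^'n) \<times> (real^'n) \<Rightarrow> complex. schwartz \<Theta> \<Longrightarrow> (\<forall>P Q. norm (cross_pairing \<Theta> P Q) \<le>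
     M * schwartz_seminorm ?N \<Theta> * (cauchy_weight P * cauchy_weight Q))"
    using cross_pairing_bound[where 'n='n] by blast
  obtain C where C: "\<And>P Q. norm (H P Q) \<le> C" using H_bounded by blast
  have C0: "C \<ge> 0" using C[of 0 0] norm_ge_zero order_trans by blast
  let ?w = "\<lambda>p :: ((real^'n) \<times> (real^'n)) \<times> ((real^'n) \<times> (real^'n)). cauchy_weight (fst p) * cauchy_weight (snd p)"
  have w: "integrable lborel ?w"
    using integrable_lborel_product[OF integrable_cauchy_weight integrable_cauchy_weight]
    by (simp add: case_prod_unfold)
  define W where "W = integral\<^sup>L lborel ?w"
  have W0: "W \<ge> 0" unfolding W_def
    by (intro integral_nonneg_AE AE_I2 mult_nonneg_nonneg less_imp_le[OF cauchy_weight_pos])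
  define a where "a = 1 / (2 * pi) ^ (2 * CARD('n))"
  have a0: "a \<ge> 0" by (simp add: a_def)
  have "integrable lborel (\<lambda>p. H (fst p) (snd p) * cross_pairing \<Theta> (fst p) (snd p)) \<and>
     norm (kernel \<Theta>) \<le> a * (C * M * W) * schwartz_seminorm ?N \<Theta>" if \<Theta>: "schwartz \<Theta>" for \<Theta>
  proof -
    note [measurable] = schwartz_measurable[OF \<Theta>]
    let ?S = "schwartz_seminorm ?N \<Theta>"
    let ?h = "\<lambda>p. H (fst p) (snd p) * cross_pairing \<Theta> (fst p) (snd p)"
    have le: "norm (?h p) \<le> C * M * ?S * ?w p" for p
    proof -
      have "norm (?h p) \<le> C * (M * ?S * ?w p)"
        unfolding norm_mult by (intro mult_mono C M(2)[OF \<Theta>, rule_format] C0) simp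
      then show ?thesis by (simp only: mult.assoc)
    qed
    have i: "integrable lborel (\<lambda>p. C * M * ?S * ?w p)" using w by (rule integrable_mult_right)
    have int: "integrable lborel ?h"
      by (rule integrable_lborel_bound[OF i _ le]) measurable
    have "norm (integral\<^sup>L lborel ?h) \<le> (\<integral>p. norm (?h p) \<partial>lborel)" by (rule integral_norm_bound)
    also have "\<dots> \<le> (\<integral>p. C * M * ?S * ?w p \<partial>lborel)"
      by (intro integral_mono integrable_norm int i le)
    also have "\<dots> = C * M * ?S * W" unfolding W_def by (rule integral_mult_right_zero)
    finally have "norm (kernel \<Theta>) \<le> a * (C * M * ?S * W)"
      unfolding kernel_def norm_mult a_def[symmetric] norm_of_real using a0 by (simp add: mult_left_mono)
    then show ?thesis using int by (simp add: mult_ac)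
  qed
  then show ?thesis
    using a0 C0 M(1) W0 by (intro exI[of _ "a * (C * M * W)"]) auto
qed

lemma kernel_tempered: "tempered_distribution kernel"
  unfolding tempered_distribution_def
proof (intro conjI allI impI)
  obtain C where C: "\<And>\<Theta>. schwartz \<Theta> \<Longrightarrow>
     integrable lborel (\<lambda>p. H (fst p) (snd p) * cross_pairing \<Theta> (fst p) (snd p))"
     "\<And>\<Theta>. schwartz \<Theta> \<Longrightarrow> norm (kernel \<Theta>) \<le> C * schwartz_seminorm (2 * DIM((real^'n) \<times> (real^'n))) \<Theta>"
    using kernel_bound by blast
  then show "\<exists>C N. \<forall>f. schwartz f \<longrightarrow> norm (kernel f) \<le> C * schwartz_seminorm N f" by blast
  fix f g :: "(real^'n) \<times> (real^'n) \<Rightarrow> complex" and a b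
  assume f: "schwartz f" and g: "schwartz g"
  have "cross_pairing (\<lambda>x. a * f x + b * g x) P Q = a * cross_pairing f P Q + b * cross_pairing g P Q" for P Q
  proof -
    have "cross_pairing (\<lambda>x. a * f x + b * g x) P Q =
        (\<integral>z. a * (f z * (coherent_state Q (fst z) * cnj (coherent_state P (snd z)))) +
          b * (g z * (coherent_state Q (fst z) * cnj (coherent_state P (snd z)))) \<partial>lborel)"
      unfolding cross_pairing_def by (simp only: distrib_right mult.assoc)
    also have "\<dots> = a * cross_pairing f P Q + b * cross_pairing g P Q"
      unfolding cross_pairing_def
      by (subst Bochner_Integration.integral_add)
        (auto intro!: integrable_mult_right cross_pairing_integrable f g)
    finally show ?thesis .
  qed
  then have "(\<integral>p. H (fst p) (snd p) * cross_pairing (\<lambda>x. a * f x + b * g x) (fst p) (snd p) \<partial>lborel) =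
      (\<integral>p. a * (H (fst p) (snd p) * cross_pairing f (fst p) (snd p)) +
        b * (H (fst p) (snd p) * cross_pairing g (fst p) (snd p)) \<partial>lborel)"
    by (simp add: distrib_left mult.left_commute)
  also have "\<dots> = a * (\<integral>p. H (fst p) (snd p) * cross_pairing f (fst p) (snd p) \<partial>lborel) +
      b * (\<integral>p. H (fst p) (snd p) * cross_pairing g (fst p) (snd p) \<partial>lborel)"
    by (subst Bochner_Integration.integral_add) (auto intro!: integrable_mult_right C f g)
  finally show "kernel (\<lambda>x. a * f x + b * g x) = a * kernel f + b * kernel g"
    unfolding kernel_def by (simp add: distrib_left mult.left_commute)
qed

text \<open>On a product test function the pairing splits into the two coherent transforms, so this
  is \<open>bilinear_expansion\<close> at \<phi> and conj \<psi>.\<close>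

lemma kernel_distributional: "distributional_kernel (\<lambda>\<phi>. distribution_of (A \<phi>)) kernel"
  unfolding distributional_kernel_def
proof (intro conjI allI impI kernel_tempered)
  fix \<phi> \<psi> :: "real^'n \<Rightarrow> complex" assume s: "schwartz \<phi>" "schwartz \<psi>"
  have "kernel (\<lambda>(x, y). \<psi> x * \<phi> y) = of_real (1 / (2 * pi) ^ (2 * CARD('n))) *
      (of_real ((2 * pi) ^ (2 * CARD('n))) * L2_inner (A \<phi>) (\<lambda>u. cnj (\<psi> u)))"
    unfolding kernel_def cross_pairing_tensor[OF s]
      bilinear_expansion(2)[OF schwartz_admissible(1)[OF s(1)] schwartz_admissible(2)[OF s(2)]]
    by (simp only: case_prod_unfold)
  also have "\<dots> = L2_inner (A \<phi>) (\<lambda>u. cnj (\<psi> u))"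
    unfolding mult.assoc[symmetric] of_real_mult[symmetric] by simp
  also have "\<dots> = distribution_of (A \<phi>) \<psi>"
    by (simp add: L2_inner_def distribution_of_def)
  finally show "kernel (\<lambda>(x, y). \<psi> x * \<phi> y) = distribution_of (A \<phi>) \<psi>" .
qed

end

section \<open>Identification of F as the Weyl symbol\<close>

context weyl_L1
begin

lemma distribution_of_F_tempered: "tempered_distribution (distribution_of F)"
  unfolding tempered_distribution_def distribution_of_def
proof (intro conjI allI impI)
  let ?K = "B / pi ^ CARD('n)"
  have K0: "?K \<ge> 0" using B0 by simp
  have [measurable]: "F \<in> borel_measurable borel" by (rule borel_measurable_continuous_onI[OF F_continuous])
  have le: "norm (F x * f x) \<le> ?K * norm (f x)" for f x
    unfolding norm_mult by (intro mult_right_mono F_bounded) simp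
  have int: "integrable lborel (\<lambda>x. F x * f x)" if f: "schwartz f" for f
    by (rule integrable_lborel_bound[OF _ _ le])
      (use schwartz_measurable[OF f] in \<open>simp_all add: schwartz_integrable(1)[OF f]\<close>)
  show "\<exists>C N. \<forall>f. schwartz f \<longrightarrow> norm (\<integral>x. F x * f x \<partial>lborel) \<le> C * schwartz_seminorm N f"
  proof (intro exI allI impI)
    fix f :: "(real^'n) \<times> (real^'n) \<Rightarrow> complex" assume f: "schwartz f"
    have "norm (\<integral>x. F x * f x \<partial>lborel) \<le> (\<integral>x. norm (F x * f x) \<partial>lborel)" by (rule integral_norm_bound)
    also have "\<dots> \<le> (\<integral>x. ?K * norm (f x) \<partial>lborel)"
      by (intro integral_mono integrable_norm int f integrable_mult_right schwartz_integrable le)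
    also have "\<dots> = ?K * (\<integral>x. norm (f x) \<partial>lborel)" by (rule integral_mult_right_zero)
    also have "\<dots> \<le> ?K * (integral\<^sup>L lborel (cauchy_weight :: (real^'n) \<times> (real^'n) \<Rightarrow> real) *
        schwartz_seminorm (2 * DIM((real^'n) \<times> (real^'n))) f)"
      by (intro mult_left_mono schwartz_integrable f K0)
    finally show "norm (\<integral>x. F x * f x \<partial>lborel) \<le>
        (?K * integral\<^sup>L lborel (cauchy_weight :: (real^'n) \<times> (real^'n) \<Rightarrow> real)) *
        schwartz_seminorm (2 * DIM((real^'n) \<times> (real^'n))) f"
      by (simp only: mult.assoc)
  qed
  fix f g :: "(real^'n) \<times> (real^'n) \<Rightarrow> complex" and a b
  assume f: "schwartz f" and g: "schwartz g"
  have "(\<integral>x. F x * (a * f x + b * g x) \<partial>lborel) = (\<integral>x. a * (F x * f x) + b * (F x * g x) \<partial>lborel)"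
    by (simp add: distrib_left mult.left_commute)
  also have "\<dots> = a * (\<integral>x. F x * f x \<partial>lborel) + b * (\<integral>x. F x * g x \<partial>lborel)"
    by (subst Bochner_Integration.integral_add) (auto intro!: integrable_mult_right int f g)
  finally show "(\<integral>x. F x * (a * f x + b * g x) \<partial>lborel) = a * (\<integral>x. F x * f x \<partial>lborel) + b * (\<integral>x. F x * g x \<partial>lborel)" .
qed

text \<open>Both sides are the integral of \<open>h\<close> over X and p, in opposite orders. Fubini
  applies because the integral over p of |H| times the modulus of the cross symbol is bounded
  uniformly in X, by \<open>nn_integral_H_gaussian\<close> with a = 1, and \<Phi> is
  integrable.\<close>

lemma F_weyl_symbol: "is_weyl_symbol (\<lambda>\<phi>. distribution_of (A \<phi>)) (distribution_of F)"
  unfolding is_weyl_symbol_def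
proof (intro conjI exI[of _ kernel] allI impI distribution_of_F_tempered kernel_distributional)
  fix \<Phi> :: "(real^'n) \<times> (real^'n) \<Rightarrow> complex" assume \<Phi>: "schwartz \<Phi>"
  note [measurable] = schwartz_measurable[OF \<Phi>]
  define c :: complex where "c = of_real ((2 * pi) ^ (2 * CARD('n)))"
  have c: "of_real (1 / (2 * pi) ^ (2 * CARD('n))) = 1 / c" "c \<noteq> 0" by (simp_all add: c_def)
  define h where "h X p = \<Phi> X * (H (fst p) (snd p) * cross_symbol (fst p) (snd p) X)" for X p
  have h_meas: "case_prod h \<in> borel_measurable (borel \<Otimes>\<^sub>M borel)"
    unfolding h_def case_prod_unfold by measurable
  define K where "K = 2 ^ (2 * CARD('n)) * B * sqrt (pi / 1) ^ (2 * CARD('n))"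
  have int: "integrable (lborel \<Otimes>\<^sub>M lborel) (case_prod h)"
  proof (rule integrableI_bounded)
    show "case_prod h \<in> borel_measurable (lborel \<Otimes>\<^sub>M lborel)" using h_meas by simp
    have "(\<integral>\<^sup>+x. ennreal (norm (case_prod h x)) \<partial>(lborel \<Otimes>\<^sub>M lborel)) =
        (\<integral>\<^sup>+X. \<integral>\<^sup>+p. ennreal (norm (h X p)) \<partial>lborel \<partial>lborel)"
      using h_meas by (subst lborel.nn_integral_fst[symmetric]) auto
    also have "\<dots> \<le> (\<integral>\<^sup>+X. ennreal (norm (\<Phi> X)) * ennreal (2 ^ CARD('n) * K) \<partial>lborel)"
    proof (rule nn_integral_mono)
      fix X :: "(real^'n) \<times> (real^'n)"
      have "(\<integral>\<^sup>+p. ennreal (norm (h X p)) \<partial>lborel) =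
          (\<integral>\<^sup>+p. ennreal (norm (\<Phi> X) * 2 ^ CARD('n)) *
            (ennreal (norm (H (fst p) (snd p))) * ennreal (gauss 1 (X - centre p))) \<partial>lborel)"
      proof (rule nn_integral_cong)
        fix p
        have "norm (h X p) = (norm (\<Phi> X) * 2 ^ CARD('n)) * (norm (H (fst p) (snd p)) *
            gauss 1 (X - centre p))"
          unfolding h_def norm_mult norm_cross_symbol by (simp only: mult_ac)
        then show "ennreal (norm (h X p)) = ennreal (norm (\<Phi> X) * 2 ^ CARD('n)) *
            (ennreal (norm (H (fst p) (snd p))) * ennreal (gauss 1 (X - centre p)))"
          by (simp add: ennreal_mult[symmetric])
      qed
      also have "\<dots> = ennreal (norm (\<Phi> X) * 2 ^ CARD('n)) * (\<integral>\<^sup>+p. ennreal (norm (H (fst p) (snd p))) *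
          ennreal (gauss 1 (X - centre p)) \<partial>lborel)"
        by (rule nn_integral_cmult) measurable
      also have "\<dots> \<le> ennreal (norm (\<Phi> X) * 2 ^ CARD('n)) * ennreal K"
        unfolding K_def by (intro mult_left_mono nn_integral_H_gaussian) auto
      also have "\<dots> = ennreal (norm (\<Phi> X)) * ennreal (2 ^ CARD('n) * K)"
        using B0 by (simp add: K_def ennreal_mult[symmetric] mult.assoc)
      finally show "(\<integral>\<^sup>+p. ennreal (norm (h X p)) \<partial>lborel) \<le> ennreal (norm (\<Phi> X)) * ennreal (2 ^ CARD('n) * K)" .
    qed
    also have "\<dots> = (\<integral>\<^sup>+X. ennreal (norm (\<Phi> X)) \<partial>lborel) * ennreal (2 ^ CARD('n) * K)"
      by (rule nn_integral_multc) measurable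
    also have "\<dots> < \<infinity>"
      using schwartz_integrable(1)[OF \<Phi>] by (simp add: integrable_iff_bounded ennreal_mult_less_top)
    finally show "(\<integral>\<^sup>+x. ennreal (norm (case_prod h x)) \<partial>(lborel \<Otimes>\<^sub>M lborel)) < \<infinity>" .
  qed
  have "dist_fourier_snd (midpoint_pullback kernel) \<Phi> =
      1 / c * (\<integral>p. H (fst p) (snd p) * (\<integral>X. \<Phi> X * cross_symbol (fst p) (snd p) X \<partial>lborel) \<partial>lborel)"
    unfolding dist_fourier_snd_def midpoint_pullback_def kernel_def cross_pairing_fourier_snd(2)[OF \<Phi>] c(1) ..
  also have "\<dots> = 1 / c * (\<integral>p. \<integral>X. h X p \<partial>lborel \<partial>lborel)"
    unfolding h_def integral_mult_right_zero[symmetric] by (simp only: mult.left_commute)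
  also have "\<dots> = 1 / c * (\<integral>X. \<integral>p. h X p \<partial>lborel \<partial>lborel)"
    unfolding lborel_pair.Fubini_integral[OF int] ..
  also have "\<dots> = 1 / c * (\<integral>X. \<Phi> X * (c * F X) \<partial>lborel)"
    unfolding h_def integral_mult_right_zero F_eq_cross_symbol_integral[symmetric] c_def ..
  also have "\<dots> = 1 / c * (\<integral>X. c * (F X * \<Phi> X) \<partial>lborel)"
    by (simp only: mult_ac)
  also have "\<dots> = distribution_of F \<Phi>"
    using c(2) unfolding integral_mult_right_zero distribution_of_def by simp
  finally show "distribution_of F \<Phi> = dist_fourier_snd (midpoint_pullback kernel) \<Phi>" ..
qed

end

text \<open>The two points differ by 2Z, so the overlap has modulus exactly exp(-|Z|^2), which the
  weight cancels; bilinearity and antisymmetry give \<sigma>(X+Z, X-Z) = -2 \<sigma>(X,Z).\<close>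

lemma coherent_quotient_phase:
  fixes X Z :: "(real^'n) \<times> (real^'n)"
  shows "w / L2_inner (coherent_state (X + Z)) (coherent_state (X - Z)) * of_real (exp (- (norm Z)\<^sup>2)) =
    w * gexp 0 (sympl X Z)"
proof -
  have XZ: "X + Z - (X - Z) = 2 *\<^sub>R Z" by (simp add: scaleR_2)
  have "sympl (X + Z) (X - Z) / 2 = - sympl X Z"
    unfolding sympl_bilinear sympl_flip[of Z X] by simp
  moreover have "- (norm (X + Z - (X - Z)))\<^sup>2 / 4 = - (norm Z)\<^sup>2"
    unfolding XZ by (simp add: power_mult_distrib)
  ultimately have "L2_inner (coherent_state (X + Z)) (coherent_state (X - Z)) = gexp (- (norm Z)\<^sup>2) (- sympl X Z)"
    unfolding inner_coherent_states by (simp only:)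
  moreover have "of_real (exp (- (norm Z)\<^sup>2)) = gexp (- (norm Z)\<^sup>2) (- sympl X Z) * gexp 0 (sympl X Z)"
    unfolding of_real_exp_gexp gexp_mult by simp
  ultimately show ?thesis by simp
qed

theorem theorem1p1:
  fixes A :: "(real^'n \<Rightarrow> complex) \<Rightarrow> (real^'n \<Rightarrow> complex)"
  assumes "bounded_L2_operator A"
    and "(SUP X :: (real^'n) \<times> (real^'n).
            ennreal (pi powr (- real CARD('n))) *
            (\<integral>\<^sup>+ Z. ennreal
               (norm (L2_inner (A (coherent_state (X + Z))) (coherent_state (X - Z)) /
                      L2_inner (coherent_state (X + Z)) (coherent_state (X - Z)))
                * exp (- (norm Z)\<^sup>2)) \<partial>lborel)) < \<infinity>"
  shows "\<exists>F :: (real^'n) \<times> (real^'n) \<Rightarrow> complex.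
           is_weyl_symbol (\<lambda>\<phi>. distribution_of (A \<phi>)) (distribution_of F) \<and>
           bounded (range F) \<and>
           continuous_on UNIV F \<and>
           (\<forall>X. F X =
              of_real (pi powr (- real CARD('n))) *
              (\<integral>Z. L2_inner (A (coherent_state (X + Z))) (coherent_state (X - Z)) /
                   L2_inner (coherent_state (X + Z)) (coherent_state (X - Z))
                   * of_real (exp (- (norm Z)\<^sup>2)) \<partial>lborel))"
proof -
  interpret weyl_bounded A by unfold_locales (rule assms(1))
  let ?R = "\<lambda>X Z. L2_inner (A (coherent_state (X + Z))) (coherent_state (X - Z)) /
      L2_inner (coherent_state (X + Z)) (coherent_state (X - Z))"
  define S where "S = (SUP X. ennreal (pi powr (- real CARD('n))) *
      (\<integral>\<^sup>+ Z. ennreal (norm (?R X Z) * exp (- (norm Z)\<^sup>2)) \<partial>lborel))"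
  have S: "S < \<infinity>" using assms(2) unfolding S_def .
  have pi_n: "pi powr (- real CARD('n)) = 1 / pi ^ CARD('n)"
    by (simp add: powr_minus powr_realpow divide_inverse)
  have norm_eq: "norm (?R X Z) * exp (- (norm Z)\<^sup>2) = norm (H (X + Z) (X - Z))" for X Z
  proof -
    have "norm (?R X Z) * exp (- (norm Z)\<^sup>2) = norm (?R X Z * of_real (exp (- (norm Z)\<^sup>2)))"
      unfolding norm_mult norm_of_real abs_exp_cancel ..
    then show ?thesis unfolding coherent_quotient_phase norm_mult norm_gexp H_def by simp
  qed
  \<comment> \<open>Finiteness of the supremum enters here: \<open>enn2real\<close> then loses
    nothing, and multiplying by pi^n removes the normalisation.\<close>
  have HB: "(\<integral>\<^sup>+Z. ennreal (norm (H (X + Z) (X - Z))) \<partial>lborel) \<le> ennreal (enn2real (ennreal (pi ^ CARD('n)) * S))" for X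
  proof -
    let ?I = "\<integral>\<^sup>+Z. ennreal (norm (H (X + Z) (X - Z))) \<partial>lborel"
    have "ennreal (pi powr (- real CARD('n))) * ?I \<le> S"
      unfolding S_def norm_eq by (rule SUP_upper) simp
    then have "ennreal (pi ^ CARD('n)) * (ennreal (1 / pi ^ CARD('n)) * ?I) \<le> ennreal (pi ^ CARD('n)) * S"
      unfolding pi_n by (rule mult_left_mono) simp
    moreover have "ennreal (pi ^ CARD('n)) * (ennreal (1 / pi ^ CARD('n)) * ?I) = ?I"
      by (simp add: mult.assoc[symmetric] ennreal_mult[symmetric])
    moreover have "ennreal (enn2real (ennreal (pi ^ CARD('n)) * S)) = ennreal (pi ^ CARD('n)) * S"
      using S by (intro ennreal_enn2real) (simp add: ennreal_mult_less_top)
    ultimately show ?thesis by simp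
  qed
  interpret weyl_L1 A "enn2real (ennreal (pi ^ CARD('n)) * S)"
    by unfold_locales (simp, rule HB)
  show ?thesis
  proof (intro exI[of _ F] conjI allI F_weyl_symbol F_continuous)
    show "bounded (range F)"
      using F_bounded by (auto simp: bounded_iff)
    show "F X = of_real (pi powr (- real CARD('n))) *
        (\<integral>Z. ?R X Z * of_real (exp (- (norm Z)\<^sup>2)) \<partial>lborel)" for X
      unfolding F_def coherent_quotient_phase pi_n H_def ..
  qed
qed

end
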